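(* Let $V$ be an open set of a real Hilbert space $H$ and let $\mathcal{L}\in C^1(V,\mathbb{R})$ satisfy Hypothesis (B) of the context. Suppose: (a) $u_0\in V$ is the unique critical point of $\mathcal{L}$; (b) the reduction maps $\varphi$ and $\mathcal{L}^\circ$ of $\mathcal{L}$ near $u_0$ (defined in the context) are of classes $C^1$ and $C^2$, respectively; (c) $\mathcal{L}$ satisfies the (PS) condition. Then for any $\epsilon>0$ and $r>0$ such that $\bar B_H(u_0,r)\subset V$ and $\sup\{|\mathcal{L}(u)|:u\in\bar B_H(u_0,r)\}<\infty$, there exists a functional $\tilde{\mathcal{L}}\in C^1(V,\mathbb{R})$ with the following properties: (i) $\tilde{\mathcal{L}}$ satisfies Hypothesis (B) and the (PS) condition; (ii) $\sup_{u\in V}|\mathcal{L}(u)-\tilde{\mathcal{L}}(u)|<\epsilon$, $\sup_{u\in V}\|\mathcal{L}'(u)-\tilde{\mathcal{L}}'(u)\|<\epsilon$ and $\sup_{u\in V}\|\mathcal{L}''(u)-\tilde{\mathcal{L}}''(u)\|<\epsilon$, where $\mathcal{L}''(u)$ and $\tilde{\mathcal{L}}''(u)$ are the Gâteaux derivatives of $\mathcal{L}'$ and $\tilde{\mathcal{L}}'$ at $u$; (iii) $\mathcal{L}(u)=\tilde{\mathcal{L}}(u)$ if $u\in V$ and $\|u-u_0\|\ge r$; (iv) the critical points of $\tilde{\mathcal{L}}$, if any, are in $B_H(u_0,r)$ and nondegenerate (so finitely many); moreover the Morse indexes of these critical points lie in $[m^-,m^-+n^0]$, where $m^-$ and $n^0$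 are the Morse index and nullity of $u_0$.
   Context: Notation: $(\cdot,\cdot)_H$, $\|\cdot\|$ are the inner product and norm of $H$; $\mathscr{L}_s(H)$ is the space of bounded self-adjoint operators; $B_H(u_0,r)$, $\bar B_H(u_0,r)$ are open and closed balls. Hypothesis (B) for a functional $\mathcal{L}\in C^1(V,\mathbb{R})$: $\nabla\mathcal{L}$ has a Gâteaux derivative $B(u)\in\mathscr{L}_s(H)$ at every $u\in V$, and $B=P+Q$, where for each $u\in V$, $P(u)\in\mathscr{L}_s(H)$ is positive definite, $Q(u)\in\mathscr{L}_s(H)$ is compact, and: (i) for any $u\in H$ the map $V\ni x\mapsto P(x)u\in H$ is continuous; (ii) $Q:V\to\mathscr{L}(H)$ is continuous; (iii) each $u_0\in V$ has a neighborhood $\mathscr{U}(u_0)$ and a constant $C_0>0$ with $(P(u)v,v)_H\ge C_0\|v\|^2$ for all $v\in H$, $u\in\mathscr{U}(u_0)$. For a critical point $u$, the Morse index and nullity are $\dim H^-$ and $\dim H^0$, where $H^-$ and $H^0$ are the negative definite and null spaces of $B(u)$ (both finite dimensional); $u$ is nondegenerate if its nullity is $0$. Reduction maps near $u_0$: with $H^0=\mathrm{Ker}\,B(u_0)$ and $P^0$ the orthogonal projection onto $H^0$, for small $\epsilon_0>0$ there is a unique continuous map $\varphi:B_{H^0}(\theta,\epsilon_0)\to(H^0)^\perp$ with $\varphi(\theta)=\theta$ and $(I-P^0)\nabla\mathcal{L}(u_0+z+\varphi(z))=0$ for all $z$; and $\mathcal{L}^\circ(z):=\mathcal{L}(u_0+z+\varphi(z))$.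 ($\theta$ is the origin.) (PS) condition: every sequence $(u_k)\subset V$ with $\sup_k|\mathcal{L}(u_k)|<\infty$ and $\mathcal{L}'(u_k)\to0$ has a convergent subsequence. *)

theory Defs
  imports "HOL-Analysis.Analysis"
begin

text \<open>
  A real Hilbert space is a type of sort \<open>{real_inner, complete_space}\<close>. A functional on an open
  set \<open>V\<close> is a total function of which only the values on \<open>V\<close> matter: all derivatives below
  are taken at points of \<open>V\<close> and depend only on the values nearby.
\<close>

subsection \<open>Derivatives\<close>

text \<open>
  \<open>U\<close> may be open in the whole space or only relatively open in a closed subspace of a Hilbert
  space. In the latter case the derivative is determined only along the subspace; \<open>D\<close> is then
  some extension to the whole space, and extending by the orthogonal projection shows that these
  notions agree with being C1 or C2 on an open subset of the subspace.
\<close>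

definition C1_on :: "'a::real_normed_vector set \<Rightarrow> ('a \<Rightarrow> 'b::real_normed_vector) \<Rightarrow> bool" where
  "C1_on U f \<longleftrightarrow> (\<exists>D :: 'a \<Rightarrow> 'a \<Rightarrow>\<^sub>L 'b.
     (\<forall>x\<in>U. (f has_derivative blinfun_apply (D x)) (at x within U)) \<and> continuous_on U D)"

definition C2_on :: "'a::real_normed_vector set \<Rightarrow> ('a \<Rightarrow> 'b::real_normed_vector) \<Rightarrow> bool" where
  "C2_on U f \<longleftrightarrow> (\<exists>D :: 'a \<Rightarrow> 'a \<Rightarrow>\<^sub>L 'b.
     (\<forall>x\<in>U. (f has_derivative blinfun_apply (D x)) (at x within U)) \<and> C1_on U D)"

definition deriv_at :: "('a::real_normed_vector \<Rightarrow> real) \<Rightarrow> 'a \<Rightarrow> 'a \<Rightarrow>\<^sub>L real" where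
  "deriv_at L u = Blinfun (frechet_derivative L (at u))"

definition gradient :: "('a::real_inner \<Rightarrow> real) \<Rightarrow> 'a \<Rightarrow> 'a" where
  "gradient L u = (THE g. GDERIV L u :> g)"

definition has_gateaux_derivative ::
  "('a::real_normed_vector \<Rightarrow> 'b::real_normed_vector) \<Rightarrow> 'a \<Rightarrow>\<^sub>L 'b \<Rightarrow> 'a \<Rightarrow> bool" where
  "has_gateaux_derivative F A u \<longleftrightarrow>
     (\<forall>v. ((\<lambda>t::real. (F (u + t *\<^sub>R v) - F u) /\<^sub>R t) \<longlongrightarrow> blinfun_apply A v) (at 0))"

definition gateaux_derivative ::
  "('a::real_normed_vector \<Rightarrow> 'b::real_normed_vector) \<Rightarrow> 'a \<Rightarrow> 'a \<Rightarrow>\<^sub>L 'b" where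
  "gateaux_derivative F u = (THE A. has_gateaux_derivative F A u)"

text \<open>
  The second derivative of \<open>L\<close> appears both as the operator \<open>B(u)\<close>, the Gateaux derivative of
  the gradient, and as \<open>L''(u)\<close>, the Gateaux derivative of \<open>L'\<close> with values in the dual space.
\<close>

definition hessian :: "('a::real_inner \<Rightarrow> real) \<Rightarrow> 'a \<Rightarrow> 'a \<Rightarrow>\<^sub>L 'a" where
  "hessian L u = gateaux_derivative (gradient L) u"

definition deriv2_at :: "('a::real_normed_vector \<Rightarrow> real) \<Rightarrow> 'a \<Rightarrow> 'a \<Rightarrow>\<^sub>L ('a \<Rightarrow>\<^sub>L real)" where
  "deriv2_at L u = gateaux_derivative (deriv_at L) u"

definition critical_points :: "'a::real_normed_vector set \<Rightarrow> ('a \<Rightarrow> real) \<Rightarrow> 'a set" where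
  "critical_points V L = {u \<in> V. deriv_at L u = 0}"

subsection \<open>Operators\<close>

definition selfadjoint :: "('a::real_inner \<Rightarrow>\<^sub>L 'a) \<Rightarrow> bool" where
  "selfadjoint A \<longleftrightarrow> (\<forall>x y. blinfun_apply A x \<bullet> y = x \<bullet> blinfun_apply A y)"

definition positive_definite :: "('a::real_inner \<Rightarrow>\<^sub>L 'a) \<Rightarrow> bool" where
  "positive_definite A \<longleftrightarrow> (\<forall>x. x \<noteq> 0 \<longrightarrow> blinfun_apply A x \<bullet> x > 0)"

definition compact_operator :: "('a::real_normed_vector \<Rightarrow>\<^sub>L 'b::real_normed_vector) \<Rightarrow> bool" where
  "compact_operator A \<longleftrightarrow> (\<forall>S. bounded S \<longrightarrow> compact (closure (blinfun_apply A ` S)))"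

definition null_space :: "('a::real_normed_vector \<Rightarrow>\<^sub>L 'b::real_normed_vector) \<Rightarrow> 'a set" where
  "null_space A = {x. blinfun_apply A x = 0}"

definition orth_proj :: "'a::real_inner set \<Rightarrow> 'a \<Rightarrow> 'a" where
  "orth_proj S x = (THE y. y \<in> S \<and> x - y \<in> orthogonal_comp S)"

text \<open>
  The spectral decomposition of the space into the negative definite, null and positive definite
  spaces of a self-adjoint operator: \<open>N\<close> and \<open>P\<close> are invariant, and the space is the orthogonal
  direct sum of \<open>N\<close>, the kernel and \<open>P\<close>. Invariance is what makes \<open>N\<close> and \<open>P\<close> unique.
\<close>

definition definite_decomposition :: "('a::real_inner \<Rightarrow>\<^sub>L 'a) \<Rightarrow> 'a set \<Rightarrow> 'a set \<Rightarrow> bool" where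
  "definite_decomposition A N P \<longleftrightarrow>
     subspace N \<and> subspace P \<and>
     blinfun_apply A ` N \<subseteq> N \<and> blinfun_apply A ` P \<subseteq> P \<and>
     (\<forall>x\<in>N. x \<noteq> 0 \<longrightarrow> blinfun_apply A x \<bullet> x < 0) \<and>
     (\<forall>x\<in>P. x \<noteq> 0 \<longrightarrow> blinfun_apply A x \<bullet> x > 0) \<and>
     (\<forall>x\<in>N. \<forall>z\<in>null_space A. orthogonal x z) \<and>
     (\<forall>x\<in>P. \<forall>z\<in>null_space A. orthogonal x z) \<and>
     (\<forall>x\<in>N. \<forall>y\<in>P. orthogonal x y) \<and>
     (\<forall>v. \<exists>x\<in>N. \<exists>z\<in>null_space A. \<exists>y\<in>P. v = x + z + y)"

definition negative_space :: "('a::real_inner \<Rightarrow>\<^sub>L 'a) \<Rightarrow> 'a set" where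
  "negative_space A = (THE N. \<exists>P. definite_decomposition A N P)"

text \<open>The library's \<open>dim\<close> is 0 on infinite-dimensional subspaces.\<close>

definition edim :: "'a::real_vector set \<Rightarrow> enat" where
  "edim S = (if \<exists>B. finite B \<and> S \<subseteq> span B then enat (dim S) else \<infinity>)"

definition morse_index :: "('a::real_inner \<Rightarrow> real) \<Rightarrow> 'a \<Rightarrow> enat" where
  "morse_index L u = edim (negative_space (hessian L u))"

definition nullity :: "('a::real_inner \<Rightarrow> real) \<Rightarrow> 'a \<Rightarrow> enat" where
  "nullity L u = edim (null_space (hessian L u))"

definition nondegenerate :: "('a::real_inner \<Rightarrow> real) \<Rightarrow> 'a \<Rightarrow> bool" where
  "nondegenerate L u \<longleftrightarrow> nullity L u = 0"

subsection \<open>Hypotheses on functionals\<close>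

definition hypothesis_B :: "'a::{real_inner,complete_space} set \<Rightarrow> ('a \<Rightarrow> real) \<Rightarrow> bool" where
  "hypothesis_B V L \<longleftrightarrow>
     (\<exists>B P Q :: 'a \<Rightarrow> 'a \<Rightarrow>\<^sub>L 'a.
        (\<forall>u\<in>V. has_gateaux_derivative (gradient L) (B u) u \<and> selfadjoint (B u) \<and>
               B u = P u + Q u \<and>
               selfadjoint (P u) \<and> positive_definite (P u) \<and>
               selfadjoint (Q u) \<and> compact_operator (Q u)) \<and>
        (\<forall>v. continuous_on V (\<lambda>u. blinfun_apply (P u) v)) \<and>
        continuous_on V Q \<and>
        (\<forall>u\<^sub>0\<in>V. \<exists>U C. open U \<and> u\<^sub>0 \<in> U \<and> U \<subseteq> V \<and> C > 0 \<and>
           (\<forall>u\<in>U. \<forall>v. blinfun_apply (P u) v \<bullet> v \<ge> C * (norm v)\<^sup>2)))"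

definition palais_smale :: "'a::real_normed_vector set \<Rightarrow> ('a \<Rightarrow> real) \<Rightarrow> bool" where
  "palais_smale V L \<longleftrightarrow>
     (\<forall>u :: nat \<Rightarrow> 'a. range u \<subseteq> V \<and> bounded (range (\<lambda>k. L (u k))) \<and>
          (\<lambda>k. deriv_at L (u k)) \<longlonglongrightarrow> 0
        \<longrightarrow> (\<exists>s. strict_mono s \<and> convergent (u \<circ> s)))"

text \<open>
  \<open>\<phi>\<close> is the reduction map of \<open>L\<close> at \<open>u\<^sub>0\<close> on the ball of radius \<open>e\<close> in the kernel of the
  Hessian. By the implicit function theorem it is unique on sufficiently small balls.
\<close>

definition reduction_map ::
  "'a::{real_inner,complete_space} set \<Rightarrow> ('a \<Rightarrow> real) \<Rightarrow> 'a \<Rightarrow> real \<Rightarrow> ('a \<Rightarrow> 'a) \<Rightarrow> bool" where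
  "reduction_map V L u\<^sub>0 e \<phi> \<longleftrightarrow>
     (let H0 = null_space (hessian L u\<^sub>0) in
        e > 0 \<and> continuous_on (H0 \<inter> ball 0 e) \<phi> \<and> \<phi> 0 = 0 \<and>
        (\<forall>z \<in> H0 \<inter> ball 0 e. \<phi> z \<in> orthogonal_comp H0 \<and> u\<^sub>0 + z + \<phi> z \<in> V \<and>
           gradient L (u\<^sub>0 + z + \<phi> z) - orth_proj H0 (gradient L (u\<^sub>0 + z + \<phi> z)) = 0))"

definition reduced_functional ::
  "('a::real_vector \<Rightarrow> real) \<Rightarrow> 'a \<Rightarrow> ('a \<Rightarrow> 'a) \<Rightarrow> 'a \<Rightarrow> real" where
  "reduced_functional L u\<^sub>0 \<phi> z = L (u\<^sub>0 + z + \<phi> z)"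

end

theory Submission
  imports Defs
begin

text \<open>
  Perturb \<open>L\<close> by \<open>\<tau>(|u - u\<^sub>0|\<^sup>2) (b \<bullet> (u - u\<^sub>0))\<close> with a cutoff \<open>\<tau>\<close> and a small vector \<open>b\<close> in
  the kernel of \<open>B(u\<^sub>0)\<close>. The support is a ball so small that \<open>P\<close> is uniformly positive on it; then
  \<open>P\<close> absorbs the Hessian of the perturbation and \<open>Q\<close> is unchanged. On the transition annulus the
  gradient of \<open>L\<close> is bounded away from 0 by (PS), so critical points of the perturbed functional
  solve \<open>\<nabla>L(u) = - b\<close> near \<open>u\<^sub>0\<close>. They lie on the graph of \<open>\<phi>\<close> over solutions of
  \<open>\<nabla>L\<degree>(z) = - b\<close> in the kernel and are nondegenerate when \<open>- b\<close> is a regular value of \<open>\<nabla>L\<degree>\<close>,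
  which Sard's theorem provides. The index bounds hold since \<open>B(u)\<close> stays negative on the negative
  space and positive on the positive space of \<open>B(u\<^sub>0)\<close> for \<open>u\<close> near \<open>u\<^sub>0\<close>.
\<close>

subsection \<open>Hilbert space preliminaries\<close>

text \<open>The obstacle is regularity. \<open>P\<close> is only strongly continuous, so
  \<open>gradient L\<close> is Gateaux but perhaps not Frechet differentiable, and the inverse and
  implicit function theorems do not apply to it. Quantitative information therefore comes from
  scalar mean values: the difference of two gradients is paired with one fixed test vector, for
  which the form of the Hessian is bounded below on a whole ball. The vector is taken in the kernel
  because \<open>gradient L\<close> has values in the kernel along the graph of \<phi>. The equation
  for critical points thus becomes one for a C1 map of a finite-dimensional space into itself, the
  case in which Sard's theorem holds for C1 maps. It is proved here by counting separated values,
  intrinsically in the kernel. The size of the perturbation is linear in the vector, with a factor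
  fixed beforehand. So the vector can be chosen last, below three bounds at once: the lower bound of
  the gradient on the annulus, the coercivity constant of \<open>P\<close> and the tolerance.
  Finiteness of the critical set is that of a regular fiber over a compact ball.\<close>

lemma parallelogram_bound:
  fixes x y :: "'a::real_inner"
  assumes "d \<le> (norm ((x + y) /\<^sub>R 2))\<^sup>2" "(norm x)\<^sup>2 \<le> d + e" "(norm y)\<^sup>2 \<le> d + e"
  shows "(norm (x - y))\<^sup>2 \<le> 4 * e"
proof -
  have "(norm (x - y))\<^sup>2 = 2 * (norm x)\<^sup>2 + 2 * (norm y)\<^sup>2 - 4 * (norm ((x + y) /\<^sub>R 2))\<^sup>2"
    by (simp add: power2_norm_eq_inner inner_simps inner_commute field_simps)
  with assms show ?thesis by simp
qed

lemma convex_midpoint_mem: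
  assumes "convex K" "x \<in> K" "y \<in> K"
  shows "(x + y) /\<^sub>R 2 \<in> K"
proof -
  have "(1/2) *\<^sub>R x + (1/2) *\<^sub>R y \<in> K" by (rule convexD[OF assms]) simp_all
  then show ?thesis by (simp add: scaleR_add_right)
qed

text \<open>
  The points of almost minimal norm in the nested sets converge, because the parallelogram law
  makes almost minimal points of a convex set close to each other.
\<close>

lemma nested_closed_convex_nonempty:
  fixes K :: "nat \<Rightarrow> 'a::{real_inner,complete_space} set"
  assumes cl: "\<And>n. closed (K n)" and cv: "\<And>n. convex (K n)" and ne: "\<And>n. K n \<noteq> {}"
    and nest: "\<And>m n. m \<le> n \<Longrightarrow> K n \<subseteq> K m"
    and bd: "\<And>x. x \<in> K 0 \<Longrightarrow> norm x \<le> R"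
  shows "\<exists>f. \<forall>n. f \<in> K n"
proof -
  define d where "d n = (INF x\<in>K n. (norm x)\<^sup>2)" for n
  have bb: "bdd_below ((\<lambda>x. (norm x)\<^sup>2) ` K n)" for n
    by (rule bdd_belowI2[of _ 0]) auto
  have dle: "d n \<le> (norm x)\<^sup>2" if "x \<in> K n" for n x
    unfolding d_def using that by (intro cINF_lower bb)
  have dmono: "d m \<le> d n" if "m \<le> n" for m n
    unfolding d_def by (rule cINF_superset_mono[OF ne bb nest[OF that]]) auto
  have dbd: "d n \<le> R\<^sup>2" for n
  proof -
    obtain x where "x \<in> K n" using ne by auto
    then have "(norm x)\<^sup>2 \<le> R\<^sup>2" using bd nest[of 0 n] by (intro power_mono) auto
    with dle[OF \<open>x \<in> K n\<close>] show ?thesis by simp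
  qed
  have "\<exists>x\<in>K n. (norm x)\<^sup>2 < d n + inverse (real (Suc n))" for n
    unfolding d_def using cINF_less_iff[OF ne bb, of n "(INF x\<in>K n. (norm x)\<^sup>2) + inverse (real (Suc n))"]
    by auto
  then obtain f where f: "\<And>n. f n \<in> K n" "\<And>n. (norm (f n))\<^sup>2 < d n + inverse (real (Suc n))"
    by metis
  have "incseq d" using dmono by (auto simp: incseq_def)
  then obtain D where D: "d \<longlonglongrightarrow> D" "\<And>n. d n \<le> D"
    using incseq_convergent[of d "R\<^sup>2"] dbd by metis
  \<comment> \<open>Both points and their midpoint lie in \<open>K N\<close>, where squared norms
    are at least \<open>d N\<close>; the excess is at most the gap \<open>D - d N\<close> plus the
    reciprocal, and both vanish as N grows.\<close>
  have close: "(norm (f m - f n))\<^sup>2 \<le> 4 * (D - d N + inverse (real (Suc N)))" if "N \<le> m" "N \<le> n" for m n N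
  proof (rule parallelogram_bound)
    have mem: "f m \<in> K N" "f n \<in> K N" using f nest that by blast+
    show "d N \<le> (norm ((f m + f n) /\<^sub>R 2))\<^sup>2" by (intro dle convex_midpoint_mem cv mem)
    have "inverse (real (Suc m)) \<le> inverse (real (Suc N))" "inverse (real (Suc n)) \<le> inverse (real (Suc N))"
      using that by (auto intro!: le_imp_inverse_le)
    with f(2)[of m] f(2)[of n] D(2)[of m] D(2)[of n] 
    show "(norm (f m))\<^sup>2 \<le> d N + (D - d N + inverse (real (Suc N)))" "(norm (f n))\<^sup>2 \<le> d N + (D - d N + inverse (real (Suc N)))"
      by linarith+
  qed
  have lim0: "(\<lambda>N. 4 * (D - d N + inverse (real (Suc N)))) \<longlonglongrightarrow> 4 * (D - D + 0)"
    by (intro tendsto_intros D LIMSEQ_inverse_real_of_nat)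
  have "Cauchy f"
  proof (rule CauchyI)
    fix e :: real assume "e > 0"
    have "eventually (\<lambda>N. 4 * (D - d N + inverse (real (Suc N))) < e\<^sup>2) sequentially"
      using order_tendstoD(2)[OF lim0, of "e\<^sup>2"] \<open>e > 0\<close> by simp
    then obtain N where "4 * (D - d N + inverse (real (Suc N))) < e\<^sup>2"
      unfolding eventually_sequentially by blast
    then have "norm (f m - f n) < e" if "m \<ge> N" "n \<ge> N" for m n
      using close[OF that] \<open>e > 0\<close> by (intro power2_less_imp_less[of _ e]) linarith+
    then show "\<exists>N. \<forall>m\<ge>N. \<forall>n\<ge>N. norm (f m - f n) < e" by (intro exI[of _ N]) simp
  qed
  then obtain g where g: "f \<longlonglongrightarrow> g" by (auto simp: Cauchy_convergent_iff convergent_def)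
  have "g \<in> K n" for n
  proof (rule Lim_in_closed_set[OF cl _ _ g])
    show "eventually (\<lambda>k. f k \<in> K n) sequentially"
      unfolding eventually_sequentially using f(1) nest by blast
  qed simp
  then show ?thesis by blast
qed

text \<open>A substitute for weak sequential compactness of bounded sets.\<close>

lemma weak_cluster_point:
  fixes v :: "nat \<Rightarrow> 'a::{real_inner,complete_space}"
  assumes "\<And>n. norm (v n) \<le> R"
  obtains f where "\<And>C n. closed C \<Longrightarrow> convex C \<Longrightarrow> (\<And>m. m \<ge> n \<Longrightarrow> v m \<in> C) \<Longrightarrow> f \<in> C"
proof -
  \<comment> \<open>A closed convex set containing a tail of the sequence contains the closed convex
    hull of that tail, so any point common to all \<open>K n\<close> will do.\<close>
  define K where "K n = closure (convex hull (v ` {n..}))" for n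
  have "\<exists>f. \<forall>n. f \<in> K n"
  proof (rule nested_closed_convex_nonempty)
    show "K n \<subseteq> K m" if "m \<le> n" for m n
      unfolding K_def using that by (intro closure_mono hull_mono image_mono) auto
    have "K 0 \<subseteq> cball 0 R"
      unfolding K_def using assms
      by (intro closure_minimal hull_minimal) auto
    then show "norm x \<le> R" if "x \<in> K 0" for x using that by auto
  qed (auto simp: K_def)
  then obtain f where f: "\<And>n. f \<in> K n" by blast
  show thesis
  proof (rule that)
    fix C :: "'a set" and n
    assume C: "closed C" "convex C" and m: "\<And>m. m \<ge> n \<Longrightarrow> v m \<in> C"
    have "K n \<subseteq> C" unfolding K_def using C m by (intro closure_minimal hull_minimal) auto
    then show "f \<in> C" using f by blast
  qed
qed

text \<open>The point g of least norm on the hyperplane \<open>f x = 1\<close> is orthogonal to the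
  kernel of f, and a multiple of it represents f. It is a weak cluster point of a minimizing
  sequence: the hyperplane and all balls are closed and convex, so they retain such points.\<close>

lemma Riesz_representation:
  fixes f :: "'a::{real_inner,complete_space} \<Rightarrow> real"
  assumes "bounded_linear f"
  obtains g where "\<And>x. f x = x \<bullet> g"
proof (cases "\<forall>x. f x = 0")
  case True
  then show ?thesis using that[of 0] by simp
next
  case False
  interpret f: bounded_linear f by fact
  obtain x\<^sub>0 where x0: "f x\<^sub>0 \<noteq> 0" using False by blast
  define C where "C = {x. f x = 1}"
  have C: "closed C" "convex C" "C \<noteq> {}"
  proof -
    show "closed C" unfolding C_def
      by (rule closed_Collect_eq[OF linear_continuous_on[OF assms] continuous_on_const])
    show "convex C" unfolding C_def convex_def by (simp add: f.add f.scale)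
    have "x\<^sub>0 /\<^sub>R f x\<^sub>0 \<in> C" unfolding C_def using x0 by (simp add: f.scale)
    then show "C \<noteq> {}" by blast
  qed
  define d where "d = (INF x\<in>C. (norm x)\<^sup>2)"
  have bb: "bdd_below ((\<lambda>x. (norm x)\<^sup>2) ` C)"
    by (rule bdd_belowI2[of _ 0]) auto
  have dle: "d \<le> (norm x)\<^sup>2" if "x \<in> C" for x
    unfolding d_def using that by (intro cINF_lower bb)
  have "\<exists>x\<in>C. (norm x)\<^sup>2 < d + inverse (real (Suc n))" for n
    unfolding d_def using cINF_less_iff[OF C(3) bb, of "(INF x\<in>C. (norm x)\<^sup>2) + inverse (real (Suc n))"]
    by auto
  then obtain v where v: "\<And>n. v n \<in> C" "\<And>n. (norm (v n))\<^sup>2 < d + inverse (real (Suc n))"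
    by metis
  have vn: "norm (v m) \<le> sqrt (d + inverse (real (Suc n)))" if "n \<le> m" for m n
  proof (rule real_le_rsqrt)
    have "inverse (real (Suc m)) \<le> inverse (real (Suc n))" using that by (auto intro!: le_imp_inverse_le)
    with v(2)[of m] show "(norm (v m))\<^sup>2 \<le> d + inverse (real (Suc n))" by linarith
  qed
  obtain g where g: "\<And>C n. closed C \<Longrightarrow> convex C \<Longrightarrow> (\<And>m. m \<ge> n \<Longrightarrow> v m \<in> C) \<Longrightarrow> g \<in> C"
    using weak_cluster_point[of v "sqrt (d + inverse (real (Suc 0)))"] vn by blast
  have gC: "g \<in> C" using g[of C 0] C v by blast
  have "d \<ge> 0" unfolding d_def by (rule cINF_greatest[OF C(3)]) simp
  have "(norm g)\<^sup>2 \<le> d + inverse (real (Suc n))" for n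
  proof -
    have "g \<in> cball 0 (sqrt (d + inverse (real (Suc n))))"
      by (rule g[of _ n]) (use vn in auto)
    then have "(norm g)\<^sup>2 \<le> (sqrt (d + inverse (real (Suc n))))\<^sup>2" by (intro power_mono) auto
    then show ?thesis using \<open>d \<ge> 0\<close> by simp
  qed
  then have "(norm g)\<^sup>2 \<le> d + 0"
    by (intro LIMSEQ_le_const[OF tendsto_add[OF tendsto_const LIMSEQ_inverse_real_of_nat]]) auto
  then have gd: "(norm g)\<^sup>2 \<le> d" by simp
  have orth: "h \<bullet> g = 0" if "f h = 0" for h
  proof (cases "h = 0")
    case False
    \<comment> \<open>This t minimizes the norm of \<open>g + t *\<^sub>R h\<close>; the squared
      norm drops by the square of \<open>h \<bullet> g\<close> divided by
      \<open>h \<bullet> h\<close>, which minimality of g forbids unless it is 0.\<close>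
    define t where "t = - (h \<bullet> g) / (h \<bullet> h)"
    have hh: "h \<bullet> h > 0" using False by simp
    have "g + t *\<^sub>R h \<in> C" using gC that by (simp add: C_def f.add f.scale)
    then have "(norm g)\<^sup>2 \<le> (norm (g + t *\<^sub>R h))\<^sup>2" using dle[of "g + t *\<^sub>R h"] gd by linarith
    also have "\<dots> = (norm g)\<^sup>2 + 2 * t * (h \<bullet> g) + t * t * (h \<bullet> h)"
      by (simp add: power2_norm_eq_inner inner_simps inner_commute)
    also have "\<dots> = (norm g)\<^sup>2 - (h \<bullet> g)\<^sup>2 / (h \<bullet> h)"
      using hh by (simp add: t_def field_simps power2_eq_square)
    finally have "(h \<bullet> g)\<^sup>2 / (h \<bullet> h) \<le> 0" by simp
    then show ?thesis using hh by (simp add: divide_le_0_iff)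
  qed simp
  have fg: "f g = 1" using gC by (simp add: C_def)
  then have "g \<noteq> 0" using f.zero by force
  show ?thesis
  proof (rule that[of "g /\<^sub>R (g \<bullet> g)"])
    fix x
    have "(x - f x *\<^sub>R g) \<bullet> g = 0" by (rule orth) (simp add: f.diff f.scale fg)
    then show "f x = x \<bullet> (g /\<^sub>R (g \<bullet> g))" using \<open>g \<noteq> 0\<close> by (simp add: inner_simps field_simps)
  qed
qed

section \<open>Finite orthonormal systems: projections, compactness and dimension counts\<close>

definition orthonormal :: "'a::real_inner set \<Rightarrow> bool" where
  "orthonormal S \<longleftrightarrow> finite S \<and> (\<forall>e\<in>S. \<forall>f\<in>S. e \<bullet> f = (if e = f then 1 else 0))"

definition proj :: "'a::real_inner set \<Rightarrow> 'a \<Rightarrow> 'a" where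
  "proj S x = (\<Sum>e\<in>S. (x \<bullet> e) *\<^sub>R e)"

lemma orthonormal_finite: "orthonormal S \<Longrightarrow> finite S"
  by (simp add: orthonormal_def)

lemma orthonormal_inner: "orthonormal S \<Longrightarrow> e \<in> S \<Longrightarrow> f \<in> S \<Longrightarrow> e \<bullet> f = (if e = f then 1 else 0)"
  by (simp add: orthonormal_def)

lemma orthonormal_norm: "orthonormal S \<Longrightarrow> e \<in> S \<Longrightarrow> norm e = 1"
  by (simp add: norm_eq_sqrt_inner orthonormal_inner)

lemma orthonormal_empty [simp]: "orthonormal {}"
  by (simp add: orthonormal_def)

lemma orthonormal_insert:
  assumes "orthonormal S" "norm e = 1" "\<And>f. f \<in> S \<Longrightarrow> e \<bullet> f = 0"
  shows "orthonormal (insert e S)" "e \<notin> S"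
proof -
  have e: "e \<bullet> e = 1" using assms(2) by (simp add: norm_eq_1)
  then show "e \<notin> S" using assms(3) by force
  then show "orthonormal (insert e S)"
    using assms(1,3) e unfolding orthonormal_def by (auto simp: inner_commute)
qed

lemma inner_sum_orthonormal:
  assumes "orthonormal S" "f \<in> S"
  shows "(\<Sum>e\<in>S. c e *\<^sub>R e) \<bullet> f = c f"
proof -
  have "(\<Sum>e\<in>S. c e *\<^sub>R e) \<bullet> f = (\<Sum>e\<in>S. if e = f then c e else 0)"
    unfolding inner_sum_left using assms by (intro sum.cong) (auto simp: orthonormal_inner)
  then show ?thesis using assms by (simp add: orthonormal_finite)
qed

lemma orthonormal_independent: "orthonormal S \<Longrightarrow> independent S"
  by (intro pairwise_orthogonal_independent)
     (auto simp: pairwise_def orthogonal_def orthonormal_inner dest: orthonormal_norm)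

lemma proj_inner: "orthonormal S \<Longrightarrow> e \<in> S \<Longrightarrow> proj S x \<bullet> e = x \<bullet> e"
  unfolding proj_def by (rule inner_sum_orthonormal)

lemma proj_in_span: "proj S x \<in> span S"
  unfolding proj_def by (intro span_sum span_scale span_base)

lemma span_orthogonal:
  assumes "\<And>e. e \<in> S \<Longrightarrow> x \<bullet> e = 0" "y \<in> span S"
  shows "x \<bullet> y = 0"
proof -
  have "orthogonal x y"
    using orthogonal_to_span[of y S x] assms by (auto simp: orthogonal_def)
  then show ?thesis by (simp add: orthogonal_def)
qed

lemma diff_proj_orthogonal:
  assumes "orthonormal S" "y \<in> span S"
  shows "(x - proj S x) \<bullet> y = 0"
  using assms by (intro span_orthogonal[OF _ assms(2)]) (simp add: inner_diff_left proj_inner)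

lemma proj_span:
  assumes "orthonormal S" "x \<in> span S"
  shows "proj S x = x"
proof -
  have "x - proj S x \<in> span S" using assms proj_in_span by (intro span_diff) auto
  from diff_proj_orthogonal[OF assms(1) this, of x] have "x - proj S x = 0"
    by (simp only: inner_eq_zero_iff)
  then show ?thesis by (simp only: right_minus_eq)
qed

lemma span_orthonormal_iff: "orthonormal S \<Longrightarrow> x \<in> span S \<longleftrightarrow> proj S x = x"
  using proj_span proj_in_span by metis

lemma bounded_linear_proj: "bounded_linear (proj S)"
  unfolding proj_def
  by (intro bounded_linear_sum bounded_linear_scaleR_const bounded_linear_inner_left)

lemma proj_add: "proj S (x + y) = proj S x + proj S y"
  and proj_diff: "proj S (x - y) = proj S x - proj S y"
  and proj_zero [simp]: "proj S 0 = 0"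
  using bounded_linear_proj[of S]
  by (auto simp: linear_simps)

lemma proj_eq_0_iff:
  assumes S: "orthonormal S"
  shows "proj S x = 0 \<longleftrightarrow> (\<forall>e\<in>S. x \<bullet> e = 0)"
proof
  assume "proj S x = 0" then show "\<forall>e\<in>S. x \<bullet> e = 0"
    using proj_inner[OF S, of _ x] by simp
next
  assume "\<forall>e\<in>S. x \<bullet> e = 0" then show "proj S x = 0" by (simp add: proj_def)
qed

text \<open>The sum on the right depends only on the values at finitely many vectors. Strong
  continuity of an operator family thus becomes a uniform estimate on a finite-dimensional
  subspace.\<close>

lemma norm_blinfun_span_le:
  assumes S: "orthonormal S" and v: "v \<in> span S"
  shows "norm (blinfun_apply A v) \<le> (\<Sum>e\<in>S. norm (blinfun_apply A e)) * norm v"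
proof -
  have "A v = A (proj S v)" using proj_span[OF S v] by simp
  also have "\<dots> = (\<Sum>e\<in>S. (v \<bullet> e) *\<^sub>R A e)"
    by (simp add: proj_def blinfun.sum_right blinfun.scaleR_right)
  also have "norm \<dots> \<le> (\<Sum>e\<in>S. norm (A e) * norm v)"
  proof (rule sum_norm_le)
    fix e assume "e \<in> S"
    have "\<bar>v \<bullet> e\<bar> \<le> norm v" using Cauchy_Schwarz_ineq2[of v e] orthonormal_norm[OF S \<open>e \<in> S\<close>] by simp
    then show "norm ((v \<bullet> e) *\<^sub>R A e) \<le> norm (A e) * norm v"
      by (simp add: mult.commute[of "norm (A e)"] mult_right_mono)
  qed
  finally show ?thesis by (simp add: sum_distrib_right)
qed

lemma norm_proj_Pythagoras:
  assumes "orthonormal S"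
  shows "(norm x)\<^sup>2 = (norm (proj S x))\<^sup>2 + (norm (x - proj S x))\<^sup>2"
proof -
  have "orthogonal (proj S x) (x - proj S x)"
    unfolding orthogonal_def by (subst inner_commute) (rule diff_proj_orthogonal[OF assms proj_in_span])
  from norm_add_Pythagorean[OF this] show ?thesis by simp
qed

lemma norm_proj_le: "orthonormal S \<Longrightarrow> norm (proj S x) \<le> norm x"
  by (rule power2_le_imp_le) (auto simp: norm_proj_Pythagoras[of S x])

lemma closed_span_orthonormal:
  assumes "orthonormal S" shows "closed (span S)"
proof -
  have "span S = {x. proj S x = x}" using span_orthonormal_iff[OF assms] by auto
  then show ?thesis
    by (simp add: closed_Collect_eq linear_continuous_on[OF bounded_linear_proj] continuous_on_id)
qed

lemma closed_orthogonal: "closed {x. \<forall>e\<in>S. x \<bullet> e = 0}"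
proof -
  have "{x. \<forall>e\<in>S. x \<bullet> e = 0} = (\<Inter>e\<in>S. {x. x \<bullet> e = 0})" by auto
  moreover have "closed {x. x \<bullet> e = 0}" for e :: 'a
    by (rule closed_Collect_eq) (intro continuous_intros)+
  ultimately show ?thesis by auto
qed

lemma subspace_orthogonal: "subspace {x. \<forall>e\<in>S. x \<bullet> e = 0}"
  by (auto simp: subspace_def inner_simps)

text \<open>The combinations with coefficients in [-R, R] form a compact set, by induction on the
  basis: each new vector gives a continuous image of an interval times the previous set. The ball in
  the span is a closed part of it.\<close>

lemma compact_span_cball:
  assumes "orthonormal S"
  shows "compact (span S \<inter> cball 0 R)"
proof -
  have "compact {\<Sum>e\<in>T. c e *\<^sub>R e |c. \<forall>e. \<bar>c e\<bar> \<le> R}" if "finite T" for T :: "'a set"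
    using that
  proof (induction T)
    case empty
    have "{\<Sum>e\<in>{}. c e *\<^sub>R e |c. \<forall>e. \<bar>c e\<bar> \<le> R} \<subseteq> {0}" by auto
    then show ?case using finite_imp_compact finite_subset by blast
  next
    case (insert f T)
    let ?C = "{\<Sum>e\<in>T. c e *\<^sub>R e |c. \<forall>e. \<bar>c e\<bar> \<le> R}"
    have "{\<Sum>e\<in>insert f T. c e *\<^sub>R e |c. \<forall>e. \<bar>c e\<bar> \<le> R} = (\<lambda>(a, x). a *\<^sub>R f + x) ` ({-R..R} \<times> ?C)"
    proof (intro set_eqI iffI)
      fix x assume "x \<in> {\<Sum>e\<in>insert f T. c e *\<^sub>R e |c. \<forall>e. \<bar>c e\<bar> \<le> R}"
      then obtain c where c: "x = (\<Sum>e\<in>insert f T. c e *\<^sub>R e)" "\<forall>e. \<bar>c e\<bar> \<le> R" by blast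
      have "x = (\<lambda>(a, x). a *\<^sub>R f + x) (c f, \<Sum>e\<in>T. c e *\<^sub>R e)"
        using insert.hyps c by simp
      moreover have "(c f, \<Sum>e\<in>T. c e *\<^sub>R e) \<in> {-R..R} \<times> ?C"
        using c(2) abs_le_iff[of "c f" R] by auto
      ultimately show "x \<in> (\<lambda>(a, x). a *\<^sub>R f + x) ` ({-R..R} \<times> ?C)" by blast
    next
      fix x assume "x \<in> (\<lambda>(a, x). a *\<^sub>R f + x) ` ({-R..R} \<times> ?C)"
      then obtain a c where c: "x = a *\<^sub>R f + (\<Sum>e\<in>T. c e *\<^sub>R e)" "-R \<le> a" "a \<le> R" "\<forall>e. \<bar>c e\<bar> \<le> R"
        by auto
      have sT: "(\<Sum>e\<in>T. (c(f := a)) e *\<^sub>R e) = (\<Sum>e\<in>T. c e *\<^sub>R e)"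
        using insert.hyps by (intro sum.cong) auto
      have "x = (\<Sum>e\<in>insert f T. (c(f := a)) e *\<^sub>R e)"
        unfolding sum.insert[OF insert.hyps] sT c(1) by simp
      moreover have "\<forall>e. \<bar>(c(f := a)) e\<bar> \<le> R" using c by auto
      ultimately show "x \<in> {\<Sum>e\<in>insert f T. c e *\<^sub>R e |c. \<forall>e. \<bar>c e\<bar> \<le> R}" by blast
    qed
    moreover have "continuous_on ({-R..R} \<times> ?C) (\<lambda>(a, x). a *\<^sub>R f + x)"
      unfolding split_def by (intro continuous_intros)
    ultimately show ?case
      by (simp only: compact_continuous_image[OF _ compact_Times[OF compact_Icc insert.IH]])
  qed
  then have cC: "compact {\<Sum>e\<in>S. c e *\<^sub>R e |c. \<forall>e. \<bar>c e\<bar> \<le> R}" using assms orthonormal_finite by blast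
  have eq: "span S \<inter> cball 0 R = {\<Sum>e\<in>S. c e *\<^sub>R e |c. \<forall>e. \<bar>c e\<bar> \<le> R} \<inter> (span S \<inter> cball 0 R)"
  proof -
    have "x \<in> {\<Sum>e\<in>S. c e *\<^sub>R e |c. \<forall>e. \<bar>c e\<bar> \<le> R}" if "x \<in> span S \<inter> cball 0 R" for x
    proof -
      define c where "c e = (if e \<in> S then x \<bullet> e else 0)" for e
      have xR: "norm x \<le> R" using that by simp
      have "x = (\<Sum>e\<in>S. c e *\<^sub>R e)"
        using proj_span[OF assms, of x] that unfolding proj_def c_def by simp
      moreover have "\<bar>c e\<bar> \<le> R" for e
      proof (cases "e \<in> S")
        case True
        have "\<bar>x \<bullet> e\<bar> \<le> norm x * norm e" by (rule Cauchy_Schwarz_ineq2)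
        then show ?thesis using orthonormal_norm[OF assms True] xR True by (simp add: c_def)
      next
        case False
        then show ?thesis using order_trans[OF norm_ge_zero xR] by (simp add: c_def)
      qed
      ultimately show ?thesis by blast
    qed
    then show ?thesis by blast
  qed
  have cl: "closed (span S \<inter> cball 0 R)"
    by (intro closed_Int closed_span_orthonormal assms closed_cball)
  show ?thesis by (subst eq) (rule compact_Int_closed[OF cC cl])
qed

text \<open>A system of maximal cardinality spans \<open>E\<close>: any further vector, minus its
  projection and normalized, would enlarge it. The hypothesis bounds cardinalities of orthonormal
  systems because for a kernel that is the form in which finite dimension becomes known.\<close>

lemma orthonormal_extension:
  fixes E :: "'a::real_inner set"
  assumes E: "subspace E" and bd: "\<And>S. orthonormal S \<Longrightarrow> S \<subseteq> E \<Longrightarrow> card S \<le> k"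
    and S0: "orthonormal S\<^sub>0" "S\<^sub>0 \<subseteq> E"
  obtains S where "orthonormal S" "S\<^sub>0 \<subseteq> S" "span S = E"
proof -
  define P where "P S \<longleftrightarrow> orthonormal S \<and> S\<^sub>0 \<subseteq> S \<and> S \<subseteq> E" for S
  have "\<exists>S. P S \<and> (\<forall>T. P T \<longrightarrow> card T \<le> card S)"
    by (rule ex_has_greatest_nat[of P S\<^sub>0 card "Suc k"]) (use S0 bd in \<open>auto simp: P_def less_Suc_eq_le\<close>)
  then obtain S where S: "P S" "\<And>T. P T \<Longrightarrow> card T \<le> card S" by blast
  then have oS: "orthonormal S" "S\<^sub>0 \<subseteq> S" "S \<subseteq> E" by (auto simp: P_def)
  have "x \<in> span S" if "x \<in> E" for x
  proof (rule ccontr)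
    assume "x \<notin> span S"
    define y where "y = x - proj S x"
    have "y \<noteq> 0" using \<open>x \<notin> span S\<close> proj_in_span[of S x] by (auto simp: y_def)
    have "proj S x \<in> E" using proj_in_span span_minimal[OF oS(3) E] by blast
    then have "y \<in> E" unfolding y_def using that E by (simp add: subspace_diff)
    have yo: "y \<bullet> e = 0" if "e \<in> S" for e
      unfolding y_def using that by (intro diff_proj_orthogonal oS span_base)
    define e where "e = y /\<^sub>R norm y"
    have e: "norm e = 1" "\<And>f. f \<in> S \<Longrightarrow> e \<bullet> f = 0" "e \<in> E"
      using \<open>y \<noteq> 0\<close> yo \<open>y \<in> E\<close> E by (auto simp: e_def subspace_scale)
    note i = orthonormal_insert[OF oS(1) e(1,2)]
    have "P (insert e S)" unfolding P_def using i oS e by auto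
    from S(2)[OF this] show False using i oS by (simp add: orthonormal_finite)
  qed
  moreover have "span S \<subseteq> E" by (rule span_minimal[OF oS(3) E])
  ultimately show thesis using that oS by blast
qed

lemma orthonormal_card_le:
  assumes "orthonormal S" "finite T" "S \<subseteq> span T"
  shows "card S \<le> card T"
  using independent_span_bound[OF assms(2) orthonormal_independent[OF assms(1)] assms(3)] by simp

lemma orthonormal_basis_extension:
  assumes "finite T" "orthonormal S\<^sub>0" "S\<^sub>0 \<subseteq> span T"
  obtains S where "orthonormal S" "S\<^sub>0 \<subseteq> S" "span S = span T" "card S \<le> card T"
proof -
  obtain S where S: "orthonormal S" "S\<^sub>0 \<subseteq> S" "span S = span T"
    by (rule orthonormal_extension[OF subspace_span orthonormal_card_le assms(2,3)]) (use assms in auto)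
  then show thesis
    using that orthonormal_card_le[OF S(1) assms(1)] span_superset[of S] by auto
qed

lemma orthonormal_card_unique:
  assumes "orthonormal S" "orthonormal T" "span S = span T"
  shows "card S = card T"
  using orthonormal_card_le[of S T] orthonormal_card_le[of T S] assms span_superset
  by (metis antisym orthonormal_finite)

text \<open>The projection onto \<open>span T\<close> cannot be injective on the larger
  \<open>span S\<close>. All comparisons of Morse indices, and the normal vector in the proof of
  Sard's theorem, rest on this count.\<close>

lemma exists_orthogonal_in_span:
  assumes S: "orthonormal S" and T: "finite T" "card T < card S"
  obtains x where "x \<in> span S" "x \<noteq> 0" "\<And>t. t \<in> T \<Longrightarrow> x \<bullet> t = 0"
proof -
  obtain T' where T': "orthonormal T'" "span T' = span T" "card T' \<le> card T"
    by (rule orthonormal_basis_extension[OF T(1), of "{}"]) auto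
  have "\<exists>x\<in>span S. x \<noteq> 0 \<and> proj T' x = 0"
  proof (rule ccontr)
    assume neg: "\<not> ?thesis"
    have lin: "linear (proj T')" using bounded_linear_proj bounded_linear.linear by blast
    have "inj_on (proj T') (span S)"
      using neg linear_injective_on_subspace_0[OF lin subspace_span] by blast
    then have "independent (proj T' ` S)" "inj_on (proj T') S"
      using linear_independent_injective_image[OF lin] orthonormal_independent[OF S]
        inj_on_subset[OF _ span_superset] by blast+
    moreover have "proj T' ` S \<subseteq> span T'" using proj_in_span by blast
    ultimately have "card S \<le> card T'"
      using independent_span_bound[OF orthonormal_finite[OF T'(1)]] by (metis card_image)
    then show False using T T' by simp
  qed
  then obtain x where x: "x \<in> span S" "x \<noteq> 0" "proj T' x = 0" by blast
  have "x \<bullet> t = 0" if "t \<in> T" for t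
  proof (rule span_orthogonal[of T'])
    show "x \<bullet> e = 0" if "e \<in> T'" for e using x that proj_eq_0_iff[OF T'(1)] by blast
    show "t \<in> span T'" using that T' span_base by blast
  qed
  then show thesis using that x by blast
qed

lemma edim_span_orthonormal:
  assumes "orthonormal S" shows "edim (span S) = enat (card S)"
  using assms orthonormal_finite orthonormal_independent unfolding edim_def
  by (auto simp: dim_eq_card_independent)

subsection \<open>Self-adjoint compact perturbations of positive operators\<close>

text \<open>The positive part may be infinite-dimensional and may lack eigenvectors, so only
  positivity of the form on the orthogonal complement of \<open>S\<close> and \<open>T\<close> is
  recorded for it.\<close>

definition spectral_frame :: "('a::real_inner \<Rightarrow>\<^sub>L 'a) \<Rightarrow> 'a set \<Rightarrow> 'a set \<Rightarrow> bool" where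
  "spectral_frame A S T \<longleftrightarrow> orthonormal S \<and> orthonormal T \<and> (\<forall>e\<in>S. \<forall>f\<in>T. e \<bullet> f = 0) \<and>
     (\<forall>e\<in>S. \<exists>l<0. blinfun_apply A e = l *\<^sub>R e) \<and> span T = null_space A \<and>
     (\<forall>x. (\<forall>e\<in>S \<union> T. x \<bullet> e = 0) \<longrightarrow> x \<noteq> 0 \<longrightarrow> blinfun_apply A x \<bullet> x > 0)"

lemma subspace_null_space: "subspace (null_space A)"
  by (auto simp: subspace_def null_space_def blinfun.bilinear_simps)

lemma selfadjointD: "selfadjoint A \<Longrightarrow> blinfun_apply A x \<bullet> y = x \<bullet> blinfun_apply A y"
  by (simp add: selfadjoint_def)

text \<open>Nonnegativity at \<open>x - A x / N\<close>, where N exceeds the norm of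
  \<open>A\<close>, yields the estimate. It says that a small value of a nonnegative form forces a
  small \<open>A x\<close>, and a zero of the form lies in the kernel.\<close>

lemma nonneg_form_bound:
  fixes A :: "'a::real_inner \<Rightarrow>\<^sub>L 'a"
  assumes A: "selfadjoint A" and X: "subspace X" "\<And>x. x \<in> X \<Longrightarrow> A x \<in> X"
    and nonneg: "\<And>x. x \<in> X \<Longrightarrow> A x \<bullet> x \<ge> 0" and x: "x \<in> X"
  shows "(norm (A x))\<^sup>2 \<le> (norm A + 1) * (A x \<bullet> x)"
proof -
  define w where "w = A x"
  define N where "N = norm A + 1"
  have N: "N > 0" "norm A \<le> N" by (simp_all add: N_def add_nonneg_pos)
  have "norm (A w) \<le> N * norm w"
    using norm_blinfun[of A w] mult_right_mono[OF N(2) norm_ge_zero[of w]] by linarith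
  have "A w \<bullet> w \<le> norm (A w) * norm w" by (rule norm_cauchy_schwarz)
  also have "\<dots> \<le> N * norm w * norm w"
    by (intro mult_right_mono norm_ge_zero) fact
  finally have Aw: "A w \<bullet> w \<le> N * (norm w)\<^sup>2" by (simp add: power2_eq_square)
  have "x - (1/N) *\<^sub>R w \<in> X"
    using X x by (simp add: w_def subspace_diff subspace_scale)
  from nonneg[OF this] have "0 \<le> A x \<bullet> x - (1/N) * (A x \<bullet> w) - (1/N) * (A w \<bullet> x) + (1/N) * (1/N) * (A w \<bullet> w)"
    by (simp add: blinfun.bilinear_simps inner_diff_left inner_diff_right algebra_simps)
  also have "A w \<bullet> x = A x \<bullet> w"
    using selfadjointD[OF A, of w x] by (simp add: inner_commute)
  also have "A x \<bullet> w = (norm w)\<^sup>2" by (simp add: w_def power2_norm_eq_inner)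
  also have "A x \<bullet> x - (1/N) * (norm w)\<^sup>2 - (1/N) * (norm w)\<^sup>2 + (1/N) * (1/N) * (A w \<bullet> w)
      \<le> A x \<bullet> x - (1/N) * (norm w)\<^sup>2 - (1/N) * (norm w)\<^sup>2 + (1/N) * (1/N) * (N * (norm w)\<^sup>2)"
    using N by (intro add_left_mono mult_left_mono Aw) auto
  also have "\<dots> = A x \<bullet> x - (norm w)\<^sup>2 / N" using N by (simp add: field_simps)
  finally have "(norm w)\<^sup>2 / N \<le> A x \<bullet> x" by simp
  then show ?thesis using N by (simp add: w_def N_def field_simps)
qed

lemma compact_operator_subseq:
  fixes v :: "nat \<Rightarrow> 'a::real_normed_vector"
  assumes "compact_operator Q" "\<And>n. norm (v n) \<le> R"
  obtains s q where "strict_mono s" "(\<lambda>n. blinfun_apply Q (v (s n))) \<longlonglongrightarrow> q"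
proof -
  have "seq_compact (closure (Q ` cball 0 R))"
    using assms(1) by (simp add: compact_operator_def compact_imp_seq_compact)
  moreover have "\<forall>n. Q (v n) \<in> closure (Q ` cball 0 R)"
    using assms(2) closure_subset[of "Q ` cball 0 R"] by fastforce
  ultimately obtain q s where "strict_mono s" "((\<lambda>n. Q (v n)) \<circ> s) \<longlonglongrightarrow> q"
    by (rule seq_compactE)
  then show thesis using that by (simp add: o_def)
qed

locale compact_perturbation =
  fixes A P Q :: "'a::{real_inner,complete_space} \<Rightarrow>\<^sub>L 'a" and C :: real
  assumes selfadjoint: "selfadjoint A" and decomp: "A = P + Q"
    and C_pos: "C > 0" and coercive: "C * (norm v)\<^sup>2 \<le> P v \<bullet> v"
    and compact: "compact_operator Q"
begin

text \<open>Cover the compact image of the unit ball under \<open>Q\<close> by finitely many balls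
  of radius \<open>C/2\<close>. Two orthonormal e, f with images in one ball would make the form
  positive at e - f: the part of \<open>P\<close> is at least 2C, while that of \<open>Q\<close> is
  below 2C in modulus. So cardinality is bounded by the number of balls.\<close>

lemma nonpositive_card_bounded:
  "\<exists>k. \<forall>S. orthonormal S \<longrightarrow> (\<forall>x\<in>span S. A x \<bullet> x \<le> 0) \<longrightarrow> card S \<le> k"
proof -
  have "compact (closure (Q ` cball 0 1))" using compact by (simp add: compact_operator_def)
  then obtain D where D: "finite D" "closure (Q ` cball 0 1) \<subseteq> (\<Union>d\<in>D. ball d (C/2))"
    unfolding compact_eq_totally_bounded using C_pos by (meson half_gt_zero)
  show ?thesis
  proof (intro exI[of _ "card D"] allI impI)
    fix S :: "'a set" assume S: "orthonormal S" and neg: "\<forall>x\<in>span S. A x \<bullet> x \<le> 0"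
    have "\<exists>d\<in>D. Q e \<in> ball d (C/2)" if "e \<in> S" for e
    proof -
      have "Q e \<in> closure (Q ` cball 0 1)"
        using orthonormal_norm[OF S that] closure_subset[of "Q ` cball 0 1"] by auto
      then show ?thesis using D(2) by blast
    qed
    then obtain g where g: "\<And>e. e \<in> S \<Longrightarrow> g e \<in> D" "\<And>e. e \<in> S \<Longrightarrow> dist (g e) (Q e) < C/2"
      by (auto simp: mem_ball) metis
    have "inj_on g S"
    proof (rule inj_onI, rule ccontr)
      fix e f assume ef: "e \<in> S" "f \<in> S" "g e = g f" "e \<noteq> f"
      define x where "x = e - f"
      have "x \<in> span S" unfolding x_def using ef by (intro span_diff span_base)
      then have "A x \<bullet> x \<le> 0" using neg by blast
      have nx: "(norm x)\<^sup>2 = 2"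
        using ef S by (simp add: x_def power2_norm_eq_inner inner_diff_left inner_diff_right orthonormal_inner)
      have n2: "norm x \<le> 2" by (rule power2_le_imp_le) (simp_all add: nx)
      have "dist (Q e) (Q f) < C"
        using g(2)[OF ef(1)] g(2)[OF ef(2)] ef(3) dist_triangle_half_r[of "g e" "Q e" C "Q f"] by simp
      then have nQ: "norm (Q x) < C" by (simp add: x_def blinfun.diff_right dist_norm)
      have "\<bar>Q x \<bullet> x\<bar> \<le> norm (Q x) * norm x" by (rule Cauchy_Schwarz_ineq2)
      also have "\<dots> \<le> norm (Q x) * 2" using n2 by (intro mult_left_mono) auto
      finally have "Q x \<bullet> x > - 2 * C" using nQ by linarith
      moreover have "P x \<bullet> x \<ge> 2 * C" using coercive[of x] nx by simp
      moreover have "A x \<bullet> x = P x \<bullet> x + Q x \<bullet> x"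
        by (simp add: decomp blinfun.add_left inner_add_left)
      ultimately show False using \<open>A x \<bullet> x \<le> 0\<close> by linarith
    qed
    then show "card S \<le> card D" using g(1) D(1) by (intro card_inj_on_le[of g]) auto
  qed
qed

text \<open>
  A minimizing sequence of the Rayleigh quotient converges after passing to a subsequence: on it
  \<open>P - l\<close> differs from the compact \<open>- Q\<close> by something tending to 0, and \<open>P - l\<close> is bounded below.
\<close>

lemma negative_eigenvector:
  assumes X: "closed X" "subspace X" "\<And>x. x \<in> X \<Longrightarrow> A x \<in> X" and v0: "v\<^sub>0 \<in> X" "A v\<^sub>0 \<bullet> v\<^sub>0 < 0"
  obtains e l where "e \<in> X" "norm e = 1" "l < 0" "A e = l *\<^sub>R e"
proof -
  define U where "U = {v \<in> X. norm v = 1}"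
  define l where "l = (INF v\<in>U. A v \<bullet> v)"
  have vn0: "v\<^sub>0 \<noteq> 0" using v0(2) by auto
  define w where "w = v\<^sub>0 /\<^sub>R norm v\<^sub>0"
  have wU: "w \<in> U" using vn0 v0 X by (simp add: U_def w_def subspace_scale)
  have "A w \<bullet> w = (A v\<^sub>0 \<bullet> v\<^sub>0) / (norm v\<^sub>0)\<^sup>2"
    by (simp add: w_def blinfun.scaleR_right power2_eq_square divide_inverse)
  then have wneg: "A w \<bullet> w < 0" using v0(2) vn0 by (simp add: divide_less_0_iff)
  have bb: "bdd_below ((\<lambda>v. A v \<bullet> v) ` U)"
  proof (rule bdd_belowI2)
    fix v assume "v \<in> U"
    then have "norm v = 1" by (simp add: U_def)
    have "\<bar>A v \<bullet> v\<bar> \<le> norm (A v) * norm v" by (rule Cauchy_Schwarz_ineq2)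
    also have "\<dots> \<le> norm A" using norm_blinfun[of A v] \<open>norm v = 1\<close> by simp
    finally show "- norm A \<le> A v \<bullet> v" by linarith
  qed
  have lle: "l \<le> A v \<bullet> v" if "v \<in> U" for v
    unfolding l_def by (rule cINF_lower[OF bb that])
  have l: "l < 0" using lle[OF wU] wneg by simp
  \<comment> \<open>Since l is the infimum of the Rayleigh quotient, \<open>T\<close> has a
    nonnegative form on \<open>X\<close> which tends to 0 along a minimizing sequence; by
    \<open>nonneg_form_bound\<close> the vectors \<open>T (v n)\<close> tend to 0.\<close>
  define T where "T = A - l *\<^sub>R id_blinfun"
  have T: "T x = A x - l *\<^sub>R x" for x
    by (simp add: T_def blinfun.diff_left blinfun.scaleR_left)
  have saT: "selfadjoint T"
    using selfadjoint by (simp add: selfadjoint_def T inner_diff_left inner_diff_right)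
  have TX: "T x \<in> X" if "x \<in> X" for x
    using X that by (simp add: T subspace_diff subspace_scale)
  have Tnn: "T x \<bullet> x \<ge> 0" if "x \<in> X" for x
  proof (cases "x = 0")
    case False
    have "x /\<^sub>R norm x \<in> U" using False that X by (simp add: U_def subspace_scale)
    from lle[OF this] have "l \<le> (A x \<bullet> x) / (norm x)\<^sup>2"
      by (simp add: blinfun.scaleR_right power2_eq_square divide_inverse mult_ac)
    then have "l * (norm x)\<^sup>2 \<le> A x \<bullet> x" using False by (simp add: pos_le_divide_eq)
    then show ?thesis by (simp add: T inner_diff_left power2_norm_eq_inner)
  qed simp
  have "\<exists>v\<in>U. A v \<bullet> v < l + inverse (real (Suc n))" for n
    using cINF_less_iff[OF _ bb, of "l + inverse (real (Suc n))"] wU unfolding l_def by auto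
  then obtain v where v: "\<And>n. v n \<in> U" "\<And>n. A (v n) \<bullet> v n < l + inverse (real (Suc n))"
    by metis
  have vX: "v n \<in> X" "norm (v n) = 1" for n using v(1)[of n] by (simp_all add: U_def)
  have Tv: "(norm (T (v n)))\<^sup>2 \<le> (norm T + 1) * inverse (real (Suc n))" for n
  proof -
    have "T (v n) \<bullet> v n \<le> inverse (real (Suc n))"
      using v(2)[of n] vX(2)[of n] by (simp add: T inner_diff_left norm_eq_1)
    then have "(norm T + 1) * (T (v n) \<bullet> v n) \<le> (norm T + 1) * inverse (real (Suc n))"
      by (intro mult_left_mono) auto
    with nonneg_form_bound[OF saT X(2) TX Tnn vX(1), of n] show ?thesis by linarith
  qed
  have lim: "(\<lambda>n. (norm T + 1) * inverse (real (Suc n))) \<longlonglongrightarrow> (norm T + 1) * 0"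
    by (intro tendsto_intros LIMSEQ_inverse_real_of_nat)
  have "(\<lambda>n. (norm (T (v n)))\<^sup>2) \<longlonglongrightarrow> 0"
    by (rule tendsto_sandwich[OF _ _ tendsto_const]) (use lim Tv in \<open>auto intro: always_eventually\<close>)
  then have "(\<lambda>n. norm (T (v n))) \<longlonglongrightarrow> 0"
    using tendsto_real_sqrt by fastforce
  then have T0: "(\<lambda>n. T (v n)) \<longlonglongrightarrow> 0" by (rule tendsto_norm_zero_cancel)
  obtain s q where s: "strict_mono s" and q: "(\<lambda>n. Q (v (s n))) \<longlonglongrightarrow> q"
    using compact_operator_subseq[OF compact, of v 1] vX by auto
  have T0s: "(\<lambda>n. T (v (s n))) \<longlonglongrightarrow> 0"
    using LIMSEQ_subseq_LIMSEQ[OF T0 s] by (simp add: o_def)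
  define R where "R x = T x - Q x" for x
  have Rlin: "R x - R y = R (x - y)" for x y by (simp add: R_def blinfun.diff_right)
  have Rlow: "C * norm x \<le> norm (R x)" for x
  proof (cases "x = 0")
    case False
    have "C * (norm x)\<^sup>2 \<le> P x \<bullet> x" by (rule coercive)
    also have "\<dots> \<le> P x \<bullet> x - l * (x \<bullet> x)" using l by (simp add: mult_nonpos_nonneg)
    also have "\<dots> = R x \<bullet> x"
      by (simp add: R_def T decomp blinfun.add_left inner_diff_left inner_add_left)
    also have "\<dots> \<le> norm (R x) * norm x" by (rule norm_cauchy_schwarz)
    finally show ?thesis using False by (simp add: power2_eq_square)
  qed simp
  have "(\<lambda>n. R (v (s n))) \<longlonglongrightarrow> 0 - q" unfolding R_def by (intro tendsto_diff T0s q)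
  then have RC: "Cauchy (\<lambda>n. R (v (s n)))" by (rule LIMSEQ_imp_Cauchy)
  have "Cauchy (\<lambda>n. v (s n))"
  proof (rule CauchyI)
    fix e :: real assume "e > 0"
    then have "C * e > 0" using C_pos by simp
    from CauchyD[OF RC this] obtain M where M: "\<And>m n. m \<ge> M \<Longrightarrow> n \<ge> M \<Longrightarrow> norm (R (v (s m)) - R (v (s n))) < C * e"
      by blast
    have "norm (v (s m) - v (s n)) < e" if "m \<ge> M" "n \<ge> M" for m n
    proof -
      have "C * norm (v (s m) - v (s n)) < C * e"
        using M[OF that] Rlow[of "v (s m) - v (s n)"] unfolding Rlin by linarith
      then show ?thesis using C_pos by simp
    qed
    then show "\<exists>M. \<forall>m\<ge>M. \<forall>n\<ge>M. norm (v (s m) - v (s n)) < e" by (intro exI[of _ M]) simp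
  qed
  then obtain e where e: "(\<lambda>n. v (s n)) \<longlonglongrightarrow> e" by (auto simp: Cauchy_convergent_iff convergent_def)
  have "(\<lambda>n. T (v (s n))) \<longlonglongrightarrow> T e" by (intro blinfun.tendsto tendsto_const e)
  then have "T e = 0" using T0s LIMSEQ_unique by blast
  then have "A e = l *\<^sub>R e" by (simp add: T)
  moreover have "e \<in> X" by (rule closed_sequentially[OF X(1) _ e]) (rule vX)
  moreover have "norm e = 1"
    using tendsto_norm[OF e] by (simp add: vX(2) LIMSEQ_const_iff)
  ultimately show thesis using l that by blast
qed

text \<open>Take a largest orthonormal system \<open>S\<close> of eigenvectors with negative
  eigenvalues; its size is bounded because the form is nonpositive on its span. A negative value on
  the invariant complement would produce one more eigenvector. So the form is nonnegative there, and
  its zeros lie in the kernel.\<close>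

lemma spectral_frame_exists:
  obtains S T where "spectral_frame A S T"
proof -
  obtain k where k: "\<And>S. orthonormal S \<Longrightarrow> (\<And>x. x \<in> span S \<Longrightarrow> A x \<bullet> x \<le> 0) \<Longrightarrow> card S \<le> k"
    using nonpositive_card_bounded by blast
  define F where "F S \<longleftrightarrow> orthonormal S \<and> (\<forall>e\<in>S. \<exists>l<0. A e = l *\<^sub>R e)" for S
  have negF: "A x \<bullet> x \<le> 0" if S: "F S" and x: "x \<in> span S" for S x
  proof -
    have oS: "orthonormal S" using S by (simp add: F_def)
    obtain l where l: "\<And>e. e \<in> S \<Longrightarrow> l e < 0" "\<And>e. e \<in> S \<Longrightarrow> A e = l e *\<^sub>R e"
      using S unfolding F_def by metis
    have "A x = (\<Sum>e\<in>S. (x \<bullet> e * l e) *\<^sub>R e)"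
    proof -
      have "A x = A (proj S x)" using proj_span[OF oS x] by simp
      also have "\<dots> = (\<Sum>e\<in>S. (x \<bullet> e * l e) *\<^sub>R e)"
        by (simp add: proj_def blinfun.sum_right blinfun.scaleR_right l)
      finally show ?thesis .
    qed
    then have "A x \<bullet> x = (\<Sum>e\<in>S. ((x \<bullet> e * l e) *\<^sub>R e) \<bullet> x)"
      by (simp only: inner_sum_left)
    also have "\<dots> = (\<Sum>e\<in>S. (x \<bullet> e)\<^sup>2 * l e)"
      by (intro sum.cong refl) (simp add: power2_eq_square inner_commute[of x])
    also have "\<dots> \<le> 0" by (intro sum_nonpos mult_nonneg_nonpos zero_le_power2 less_imp_le l(1))
    finally show ?thesis .
  qed
  have "\<exists>S. F S \<and> (\<forall>S'. F S' \<longrightarrow> card S' \<le> card S)"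
    by (rule ex_has_greatest_nat[of F "{}" card "Suc k"])
       (use k negF in \<open>auto simp: F_def less_Suc_eq_le\<close>)
  then obtain S where S: "F S" "\<And>S'. F S' \<Longrightarrow> card S' \<le> card S" by blast
  have oS: "orthonormal S" using S by (simp add: F_def)
  define X where "X = {x. \<forall>e\<in>S. x \<bullet> e = 0}"
  have X: "closed X" "subspace X" unfolding X_def by (rule closed_orthogonal subspace_orthogonal)+
  have AX: "A x \<in> X" if x: "x \<in> X" for x
  proof -
    have "A x \<bullet> e = 0" if e: "e \<in> S" for e
    proof -
      obtain l where "A e = l *\<^sub>R e" using S(1) e unfolding F_def by blast
      then have "A x \<bullet> e = l * (x \<bullet> e)" using selfadjointD[OF selfadjoint, of x e] by simp
      then show ?thesis using x e by (simp add: X_def)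
    qed
    then show ?thesis by (simp add: X_def)
  qed
  have nn: "A x \<bullet> x \<ge> 0" if x: "x \<in> X" for x
  proof (rule ccontr)
    assume "\<not> ?thesis"
    then obtain e l where e: "e \<in> X" "norm e = 1" "l < 0" "A e = l *\<^sub>R e"
      using negative_eigenvector[OF X AX x] by auto
    have ef: "e \<bullet> f = 0" if "f \<in> S" for f using e(1) that by (simp add: X_def)
    note i = orthonormal_insert[OF oS e(2) ef]
    have "F (insert e S)" using S(1) e i unfolding F_def by blast
    from S(2)[OF this] show False using i oS by (simp add: orthonormal_finite)
  qed
  obtain T where T: "orthonormal T" "span T = null_space A"
  proof (rule orthonormal_extension[OF subspace_null_space, of A k "{}"])
    fix T assume "orthonormal T" and TN: "T \<subseteq> null_space A"
    have "A x \<bullet> x \<le> 0" if "x \<in> span T" for x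
      using span_minimal[OF TN subspace_null_space] that by (auto simp: null_space_def)
    then show "card T \<le> k" using k \<open>orthonormal T\<close> by blast
  qed auto
  have ST: "e \<bullet> f = 0" if e: "e \<in> S" and f: "f \<in> T" for e f
  proof -
    obtain l where l: "l < 0" "A e = l *\<^sub>R e" using S(1) e unfolding F_def by blast
    have "A f = 0" using T(2) span_base[OF f] by (auto simp: null_space_def)
    then have "l * (e \<bullet> f) = 0" using selfadjointD[OF selfadjoint, of e f] l by simp
    then show ?thesis using l by simp
  qed
  have pos: "A x \<bullet> x > 0" if x: "\<forall>e\<in>S \<union> T. x \<bullet> e = 0" "x \<noteq> 0" for x
  proof -
    have xX: "x \<in> X" using x by (simp add: X_def)
    have "A x \<bullet> x \<noteq> 0"
    proof
      assume "A x \<bullet> x = 0"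
      with nonneg_form_bound[OF selfadjoint X(2) AX nn xX] have "A x = 0" by simp
      then have "x \<in> span T" using T by (simp add: null_space_def)
      from this have "x \<bullet> x = 0" by (rule span_orthogonal[of T, rotated]) (use x in auto)
      then show False using x by simp
    qed
    then show ?thesis using nn[OF xX] by simp
  qed
  have "spectral_frame A S T"
    unfolding spectral_frame_def using oS T ST pos S(1) by (simp add: F_def)
  then show thesis using that by blast
qed

end

section \<open>Spectral frames realize the definite decomposition\<close>

lemma spectral_frameD:
  assumes "spectral_frame A S T"
  shows "orthonormal S" "orthonormal T" "e \<in> S \<Longrightarrow> f \<in> T \<Longrightarrow> e \<bullet> f = 0"
    "e \<in> S \<Longrightarrow> \<exists>l<0. blinfun_apply A e = l *\<^sub>R e" "span T = null_space A"
    "(\<And>e. e \<in> S \<union> T \<Longrightarrow> x \<bullet> e = 0) \<Longrightarrow> x \<noteq> 0 \<Longrightarrow> blinfun_apply A x \<bullet> x > 0"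
  using assms unfolding spectral_frame_def by simp_all

lemma frame_eigenvector_component:
  assumes "spectral_frame A S T" "selfadjoint A" "e \<in> S" "x \<bullet> e = 0"
  shows "blinfun_apply A x \<bullet> e = 0"
proof -
  obtain l where "A e = l *\<^sub>R e" using spectral_frameD(4)[OF assms(1,3)] by blast
  then have "A x \<bullet> e = l * (x \<bullet> e)" using selfadjointD[OF assms(2), of x e] by simp
  then show ?thesis using assms by simp
qed

lemma frame_negative:
  assumes fr: "spectral_frame A S T" and x: "x \<in> span S" "x \<noteq> 0"
  shows "blinfun_apply A x \<bullet> x < 0" "blinfun_apply A x \<in> span S"
proof -
  have oS: "orthonormal S" using fr by (simp add: spectral_frame_def)
  obtain l where l: "\<And>e. e \<in> S \<Longrightarrow> l e < 0" "\<And>e. e \<in> S \<Longrightarrow> A e = l e *\<^sub>R e"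
    using spectral_frameD(4)[OF fr] by metis
  have "A x = A (proj S x)" using proj_span[OF oS x(1)] by simp
  also have "\<dots> = (\<Sum>e\<in>S. (x \<bullet> e * l e) *\<^sub>R e)"
    by (simp add: proj_def blinfun.sum_right blinfun.scaleR_right l)
  finally have Ax: "A x = (\<Sum>e\<in>S. (x \<bullet> e * l e) *\<^sub>R e)" .
  then show "A x \<in> span S" by (simp add: span_sum span_scale span_base)
  have "proj S x \<noteq> 0" using proj_span[OF oS x(1)] x(2) by simp
  then obtain f where f: "f \<in> S" "x \<bullet> f \<noteq> 0" using proj_eq_0_iff[OF oS] by blast
  have "A x \<bullet> x = (\<Sum>e\<in>S. (x \<bullet> e)\<^sup>2 * l e)"
    unfolding Ax inner_sum_left
    by (intro sum.cong refl) (simp add: power2_eq_square inner_commute[of x])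
  also have "\<dots> < (\<Sum>e\<in>S. 0)"
  proof (rule sum_strict_mono_ex1)
    show "finite S" by (rule orthonormal_finite[OF oS])
    show "\<forall>e\<in>S. (x \<bullet> e)\<^sup>2 * l e \<le> 0"
      by (intro ballI mult_nonneg_nonpos zero_le_power2 less_imp_le l(1))
    have "(x \<bullet> f)\<^sup>2 * l f < 0" using l(1)[OF f(1)] f(2) by (simp add: mult_less_0_iff)
    then show "\<exists>e\<in>S. (x \<bullet> e)\<^sup>2 * l e < 0" using f(1) by blast
  qed
  finally show "A x \<bullet> x < 0" by simp
qed

text \<open>Subtracting the kernel component changes neither the form, by self-adjointness, nor
  orthogonality to \<open>S\<close>; what remains is 0 or lies where the form is positive.\<close>

lemma frame_nonneg:
  assumes fr: "spectral_frame A S T" and A: "selfadjoint A" and x: "\<And>e. e \<in> S \<Longrightarrow> x \<bullet> e = 0"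
  shows "blinfun_apply A x \<bullet> x \<ge> 0"
proof -
  have oT: "orthonormal T" using fr by (simp add: spectral_frame_def)
  define t where "t = proj T x"
  define y where "y = x - t"
  have "t \<in> null_space A" using proj_in_span[of T x] fr by (simp add: t_def spectral_frame_def)
  then have At: "A t = 0" by (simp add: null_space_def)
  have x_eq: "x = y + t" by (simp add: y_def)
  have "A x \<bullet> x = A y \<bullet> y + A y \<bullet> t"
    by (simp add: x_eq blinfun.add_right At inner_add_right)
  also have "A y \<bullet> t = 0" using selfadjointD[OF A, of y t] At by simp
  finally have eq: "A x \<bullet> x = A y \<bullet> y" by simp
  have yT: "y \<bullet> f = 0" if "f \<in> T" for f
    unfolding y_def t_def by (rule diff_proj_orthogonal[OF oT span_base[OF that]])
  have yS: "y \<bullet> e = 0" if "e \<in> S" for e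
  proof -
    have "t \<bullet> e = 0"
    proof -
      have "e \<bullet> t = 0" unfolding t_def
        by (rule span_orthogonal[OF _ proj_in_span]) (use spectral_frameD(3)[OF fr that] in auto)
      then show ?thesis by (simp add: inner_commute)
    qed
    then show ?thesis using x[OF that] by (simp add: y_def inner_diff_left)
  qed
  show ?thesis
  proof (cases "y = 0")
    case False
    have "A y \<bullet> y > 0" by (rule spectral_frameD(6)[OF fr _ False]) (use yT yS in auto)
    then show ?thesis using eq by simp
  qed (use eq in simp)
qed

lemma frame_decomposition:
  assumes fr: "spectral_frame A S T" and A: "selfadjoint A"
  shows "definite_decomposition A (span S) {x. \<forall>e\<in>S \<union> T. x \<bullet> e = 0}"
proof -
  have oS: "orthonormal S" and oT: "orthonormal T" and ST: "\<forall>e\<in>S. \<forall>f\<in>T. e \<bullet> f = 0"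
    and nT: "null_space A = span T" using fr by (auto simp: spectral_frame_def)
  let ?P = "{x. \<forall>e\<in>S \<union> T. x \<bullet> e = 0}"
  have 1: "subspace ?P" by (rule subspace_orthogonal)
  have 2: "A ` span S \<subseteq> span S"
  proof
    fix y assume "y \<in> A ` span S"
    then obtain x where x: "x \<in> span S" "y = A x" by blast
    show "y \<in> span S"
      using frame_negative(2)[OF fr x(1)] x by (cases "x = 0") (auto simp: span_zero)
  qed
  have 3: "A ` ?P \<subseteq> ?P"
  proof -
    have "A x \<bullet> e = 0" if x: "x \<in> ?P" and e: "e \<in> S \<union> T" for x e
    proof (cases "e \<in> S")
      case True
      then show ?thesis using frame_eigenvector_component[OF fr A True] x by simp
    next
      case False
      then have "e \<in> null_space A" using e nT span_base by blast
      then show ?thesis using selfadjointD[OF A, of x e] by (simp add: null_space_def)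
    qed
    then show ?thesis by blast
  qed
  have 4: "orthogonal x z" if "x \<in> span S" "z \<in> null_space A" for x z
  proof -
    have "x \<bullet> f = 0" if "f \<in> T" for f
    proof -
      have "f \<bullet> x = 0" by (rule span_orthogonal[OF _ \<open>x \<in> span S\<close>]) (use ST that in \<open>auto simp: inner_commute\<close>)
      then show ?thesis by (simp add: inner_commute)
    qed
    then show ?thesis unfolding orthogonal_def by (rule span_orthogonal[of T]) (use that nT in auto)
  qed
  have 5: "orthogonal x z" if "x \<in> ?P" "z \<in> null_space A" for x z
    unfolding orthogonal_def by (rule span_orthogonal[of T]) (use that nT in auto)
  have 6: "orthogonal x y" if "x \<in> span S" "y \<in> ?P" for x y
  proof -
    have "y \<bullet> x = 0" by (rule span_orthogonal[of S]) (use that in auto)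
    then show ?thesis by (simp add: orthogonal_def inner_commute)
  qed
  have 7: "\<exists>x\<in>span S. \<exists>z\<in>null_space A. \<exists>y\<in>?P. v = x + z + y" for v
  proof (intro bexI)
    show "v = proj S v + proj T v + (v - proj S v - proj T v)" by simp
    have "proj S v \<bullet> f = 0" if "f \<in> T" for f
      using 4[OF proj_in_span[of S v], of f] that nT span_base by (auto simp: orthogonal_def)
    moreover have "proj T v \<bullet> e = 0" if "e \<in> S" for e
      using 4[OF span_base[OF that], of "proj T v"] proj_in_span[of T v] nT
      by (auto simp: orthogonal_def inner_commute)
    ultimately show "v - proj S v - proj T v \<in> ?P"
      by (auto simp: inner_diff_left proj_inner[OF oS] proj_inner[OF oT])
  qed (use nT proj_in_span in auto)
  show ?thesis unfolding definite_decomposition_def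
    using 1 2 3 4 5 6 7 frame_negative(1)[OF fr] spectral_frameD(6)[OF fr] by simp
qed

text \<open>Split an eigenvector with eigenvalue l < 0 as n + z + p. By invariance the eigenvalue
  equation can be paired with p and with z separately: the first gives a nonpositive form at p,
  hence p = 0, the second z = 0. So \<open>N\<close> contains \<open>S\<close>, and a vector of
  \<open>N\<close> orthogonal to \<open>S\<close> has a nonnegative form, so it vanishes. This makes
  \<open>negative_space\<close> well defined.\<close>

lemma frame_decomposition_unique:
  assumes fr: "spectral_frame A S T" and A: "selfadjoint A" and d: "definite_decomposition A N P"
  shows "N = span S"
proof -
  have d1: "subspace N" "subspace P" "A ` N \<subseteq> N" "A ` P \<subseteq> P"
    "\<And>x. x \<in> N \<Longrightarrow> x \<noteq> 0 \<Longrightarrow> A x \<bullet> x < 0" "\<And>x. x \<in> P \<Longrightarrow> x \<noteq> 0 \<Longrightarrow> A x \<bullet> x > 0"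
    using d unfolding definite_decomposition_def by simp_all
  have d2: "\<And>x z. x \<in> N \<Longrightarrow> z \<in> null_space A \<Longrightarrow> x \<bullet> z = 0"
    "\<And>x z. x \<in> P \<Longrightarrow> z \<in> null_space A \<Longrightarrow> x \<bullet> z = 0"
    "\<And>x y. x \<in> N \<Longrightarrow> y \<in> P \<Longrightarrow> x \<bullet> y = 0"
    "\<And>v. \<exists>x\<in>N. \<exists>z\<in>null_space A. \<exists>y\<in>P. v = x + z + y"
    using d unfolding definite_decomposition_def orthogonal_def by simp_all
  have oS: "orthonormal S" using fr by (simp add: spectral_frame_def)
  have SN: "e \<in> N" if e: "e \<in> S" for e
  proof -
    obtain l where l: "l < 0" "A e = l *\<^sub>R e" using spectral_frameD(4)[OF fr e] by blast
    obtain n z p where nzp: "n \<in> N" "z \<in> null_space A" "p \<in> P" "e = n + z + p" using d2(4) by blast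
    have Az: "A z = 0" using nzp by (simp add: null_space_def)
    have AP: "A n \<in> N" "A p \<in> P" using nzp d1 by auto
    have eq: "A n + A p = l *\<^sub>R n + l *\<^sub>R z + l *\<^sub>R p"
      using l(2) unfolding nzp(4) by (simp add: blinfun.add_right Az scaleR_add_right)
    have "p = 0"
    proof (rule ccontr)
      assume "p \<noteq> 0"
      have "(A n + A p) \<bullet> p = A p \<bullet> p" using d2(3)[OF AP(1) nzp(3)] by (simp add: inner_add_left)
      moreover have "(l *\<^sub>R n + l *\<^sub>R z + l *\<^sub>R p) \<bullet> p = l * (p \<bullet> p)"
        using d2(3)[OF nzp(1,3)] d2(2)[OF nzp(3,2)] by (simp add: inner_add_left inner_commute[of z p])
      ultimately have "A p \<bullet> p = l * (p \<bullet> p)" using eq by simp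
      moreover have "l * (p \<bullet> p) \<le> 0" using l by (simp add: mult_nonpos_nonneg)
      ultimately show False using d1(6)[OF nzp(3) \<open>p \<noteq> 0\<close>] by simp
    qed
    moreover have "z = 0"
    proof -
      have "(A n + A p) \<bullet> z = 0" using d2(1)[OF AP(1) nzp(2)] d2(2)[OF AP(2) nzp(2)] by (simp add: inner_add_left)
      moreover have "(l *\<^sub>R n + l *\<^sub>R z + l *\<^sub>R p) \<bullet> z = l * (z \<bullet> z)"
        using d2(1)[OF nzp(1,2)] d2(2)[OF nzp(3,2)] by (simp add: inner_add_left)
      ultimately have "l * (z \<bullet> z) = 0" using eq by simp
      then show ?thesis using l by simp
    qed
    ultimately show ?thesis using nzp by simp
  qed
  then have sub: "span S \<subseteq> N" using span_minimal d1(1) by blast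
  have "x \<in> span S" if x: "x \<in> N" for x
  proof -
    define y where "y = x - proj S x"
    have "y \<in> N" unfolding y_def using sub proj_in_span[of S x] by (intro subspace_diff d1(1) x) blast
    have "A y \<bullet> y \<ge> 0"
      by (rule frame_nonneg[OF fr A]) (auto simp: y_def intro: diff_proj_orthogonal[OF oS span_base])
    then have "y = 0" using d1(5)[OF \<open>y \<in> N\<close>] by force
    then have "x = proj S x" by (simp add: y_def)
    then show ?thesis using proj_in_span[of S x] by metis
  qed
  with sub show ?thesis by blast
qed

lemma negative_space_frame:
  assumes "spectral_frame A S T" "selfadjoint A"
  shows "negative_space A = span S"
  unfolding negative_space_def
proof (rule the_equality)
  show "\<exists>P. definite_decomposition A (span S) P" using frame_decomposition[OF assms] by blast
qed (use frame_decomposition_unique[OF assms] in blast)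

subsection \<open>Gateaux derivatives and gradients\<close>

lemma gderiv_unique:
  assumes "GDERIV f x :> g" "GDERIV f x :> g'" shows "g = g'"
proof -
  have "(\<lambda>h. h \<bullet> g) = (\<lambda>h. h \<bullet> g')"
    using assms unfolding gderiv_def by (rule has_derivative_unique)
  then have "(g - g') \<bullet> g = (g - g') \<bullet> g'" by (rule fun_cong)
  then have "(g - g') \<bullet> (g - g') = 0" by (simp add: inner_diff_right)
  then show ?thesis by (simp only: inner_eq_zero_iff right_minus_eq)
qed

lemma gradient_eqI: "GDERIV f x :> g \<Longrightarrow> gradient f x = g"
  unfolding gradient_def using gderiv_unique by (intro the_equality)

lemma deriv_at_eqI: "(f has_derivative blinfun_apply D) (at x) \<Longrightarrow> deriv_at f x = D"
  unfolding deriv_at_def by (metis frechet_derivative_at blinfun_apply_inverse)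

lemma blinfun_inner_left_apply: "blinfun_apply (blinfun_inner_left g) = (\<lambda>h. h \<bullet> g)"
  by (rule ext) simp

lemma deriv_at_gderiv: "GDERIV f x :> g \<Longrightarrow> deriv_at f x = blinfun_inner_left g"
  by (rule deriv_at_eqI) (simp add: blinfun_inner_left_apply gderiv_def)

text \<open>The isometry through which smallness and convergence of \<open>deriv_at\<close> are read
  off the gradient.\<close>

lemma norm_blinfun_inner_left: "norm (blinfun_inner_left g) = norm (g :: 'a::real_inner)"
proof (rule antisym)
  show "norm (blinfun_inner_left g) \<le> norm g"
  proof (rule norm_blinfun_bound)
    fix x show "norm (blinfun_apply (blinfun_inner_left g) x) \<le> norm g * norm x"
      using Cauchy_Schwarz_ineq2[of x g] by (simp add: mult.commute)
  qed simp
  show "norm g \<le> norm (blinfun_inner_left g)"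
  proof (cases "g = 0")
    case False
    have "norm g * norm g \<le> norm (blinfun_inner_left g) * norm g"
      using norm_blinfun[of "blinfun_inner_left g" g] by (simp add: norm_eq_sqrt_inner)
    then show ?thesis using False by simp
  qed simp
qed

lemma blinfun_inner_left_diff: "blinfun_inner_left g - blinfun_inner_left g' = blinfun_inner_left (g - g')"
  by (rule blinfun_eqI) (simp add: blinfun.diff_left inner_diff_right)

text \<open>Completeness enters through the Riesz representation of the derivative; its isometry
  carries continuity of the derivative over to the gradient.\<close>

lemma C1_on_gderiv:
  fixes f :: "'a::{real_inner,complete_space} \<Rightarrow> real"
  assumes V: "open V" and f: "C1_on V f"
  shows "u \<in> V \<Longrightarrow> GDERIV f u :> gradient f u" "continuous_on V (gradient f)"
proof -
  obtain D :: "'a \<Rightarrow> 'a \<Rightarrow>\<^sub>L real"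
    where D: "\<And>x. x \<in> V \<Longrightarrow> (f has_derivative blinfun_apply (D x)) (at x within V)" "continuous_on V D"
    using f unfolding C1_on_def by blast
  have Dat: "(f has_derivative blinfun_apply (D x)) (at x)" if "x \<in> V" for x
    using D(1)[OF that] at_within_open[OF that V] by simp
  have ex: "\<exists>g. GDERIV f x :> g" if x: "x \<in> V" for x
  proof -
    obtain g where "\<And>h. D x h = h \<bullet> g"
      using Riesz_representation[OF blinfun.bounded_linear_right[of "D x"]] by blast
    then have "blinfun_apply (D x) = (\<lambda>h. h \<bullet> g)" by (rule ext)
    then show ?thesis using Dat[OF x] unfolding gderiv_def by metis
  qed
  have gd: "GDERIV f x :> gradient f x" if x: "x \<in> V" for x
  proof -
    obtain g where g: "GDERIV f x :> g" using ex[OF x] by blast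
    then show ?thesis using gradient_eqI[OF g] by simp
  qed
  then show "u \<in> V \<Longrightarrow> GDERIV f u :> gradient f u" .
  have "D x = blinfun_inner_left (gradient f x)" if "x \<in> V" for x
    using deriv_at_eqI[OF Dat[OF that]] deriv_at_gderiv[OF gd[OF that]] by simp
  then have dist: "dist (D x) (D y) = dist (gradient f x) (gradient f y)" if "x \<in> V" "y \<in> V" for x y
    using that by (simp add: dist_norm blinfun_inner_left_diff norm_blinfun_inner_left)
  show "continuous_on V (gradient f)"
    using D(2) dist unfolding continuous_on_iff by metis
qed

lemma C1_onI_gderiv:
  assumes "\<And>u. u \<in> V \<Longrightarrow> GDERIV f u :> g u" "continuous_on V g"
  shows "C1_on V f"
  unfolding C1_on_def
proof (intro exI[of _ "\<lambda>x. blinfun_inner_left (g x)"] conjI ballI)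
  show "(f has_derivative blinfun_apply (blinfun_inner_left (g x))) (at x within V)" if "x \<in> V" for x
    using assms(1)[OF that] by (simp add: blinfun_inner_left_apply gderiv_def has_derivative_at_withinI)
  show "continuous_on V (\<lambda>x. blinfun_inner_left (g x))"
    by (intro bounded_linear.continuous_on[OF bounded_linear_blinfun_inner_left] assms)
qed

text \<open>Turns the limit defining a Gateaux derivative into the derivative of a curve, so that
  the usual rules of calculus apply.\<close>

lemma difference_quotient_iff:
  fixes f :: "real \<Rightarrow> 'b::real_normed_vector"
  shows "((\<lambda>t. (f t - f 0) /\<^sub>R t) \<longlongrightarrow> d) (at 0) \<longleftrightarrow> (f has_vector_derivative d) (at 0)"
proof -
  have "(f has_vector_derivative d) (at 0) \<longleftrightarrow> ((\<lambda>h. norm (f h - f 0 - h *\<^sub>R d) / norm h) \<longlongrightarrow> 0) (at 0)"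
    by (simp add: has_vector_derivative_def has_derivative_at bounded_linear_scaleR_left)
  also have "\<dots> \<longleftrightarrow> ((\<lambda>t. norm ((f t - f 0) /\<^sub>R t - d)) \<longlongrightarrow> 0) (at 0)"
  proof (rule filterlim_cong[OF refl refl])
    show "\<forall>\<^sub>F h in at 0. norm (f h - f 0 - h *\<^sub>R d) / norm h = norm ((f h - f 0) /\<^sub>R h - d)"
      unfolding eventually_at_filter
    proof (rule always_eventually, intro allI impI)
      fix h :: real assume "h \<noteq> 0"
      then have "(f h - f 0) /\<^sub>R h - d = (f h - f 0 - h *\<^sub>R d) /\<^sub>R h"
        by (simp add: scaleR_diff_right)
      then show "norm (f h - f 0 - h *\<^sub>R d) / norm h = norm ((f h - f 0) /\<^sub>R h - d)"
        by (simp add: divide_inverse mult.commute)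
    qed
  qed
  also have "\<dots> \<longleftrightarrow> ((\<lambda>t. (f t - f 0) /\<^sub>R t) \<longlongrightarrow> d) (at 0)"
    by (simp add: tendsto_norm_zero_iff LIM_zero_iff)
  finally show ?thesis by simp
qed

section \<open>Rules for Gateaux derivatives and the two forms of the second derivative\<close>

lemma has_gateaux_derivative_iff:
  "has_gateaux_derivative F A u \<longleftrightarrow> (\<forall>v. ((\<lambda>t. F (u + t *\<^sub>R v)) has_vector_derivative blinfun_apply A v) (at 0))"
  unfolding has_gateaux_derivative_def difference_quotient_iff[symmetric] by simp

lemma has_gateaux_derivative_unique:
  assumes "has_gateaux_derivative F A u" "has_gateaux_derivative F A' u"
  shows "A = A'"
  by (rule blinfun_eqI)
     (use assms in \<open>auto simp: has_gateaux_derivative_def intro: tendsto_unique[OF trivial_limit_at]\<close>)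

lemma gateaux_derivative_eqI: "has_gateaux_derivative F A u \<Longrightarrow> gateaux_derivative F u = A"
  unfolding gateaux_derivative_def using has_gateaux_derivative_unique by (intro the_equality)

lemma has_gateaux_derivative_add:
  assumes "has_gateaux_derivative F A u" "has_gateaux_derivative G B u"
  shows "has_gateaux_derivative (\<lambda>x. F x + G x) (A + B) u"
  using assms unfolding has_gateaux_derivative_iff
  by (auto simp: blinfun.add_left intro: has_vector_derivative_add)

lemma has_derivative_imp_gateaux:
  assumes "(F has_derivative blinfun_apply A) (at u)"
  shows "has_gateaux_derivative F A u"
  unfolding has_gateaux_derivative_iff
proof
  fix v
  have "((\<lambda>t. u + t *\<^sub>R v) has_derivative (\<lambda>t. t *\<^sub>R v)) (at (0::real))"
    by (auto intro!: derivative_eq_intros)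
  moreover have "(F has_derivative blinfun_apply A) (at (u + 0 *\<^sub>R v))" using assms by simp
  ultimately have "((\<lambda>t. F (u + t *\<^sub>R v)) has_derivative (\<lambda>t. A (t *\<^sub>R v))) (at (0::real))"
    by (rule has_derivative_compose)
  then show "((\<lambda>t. F (u + t *\<^sub>R v)) has_vector_derivative A v) (at 0)"
    by (simp add: has_vector_derivative_def blinfun.scaleR_right)
qed

lemma eventually_line_in_open:
  fixes u v :: "'a::real_normed_vector"
  assumes "open V" "u \<in> V"
  shows "\<forall>\<^sub>F t in nhds 0. u + t *\<^sub>R v \<in> V"
proof -
  have "((\<lambda>t. u + t *\<^sub>R v) \<longlongrightarrow> u + 0 *\<^sub>R v) (nhds (0::real))"
    by (intro tendsto_intros filterlim_ident)
  then show ?thesis using topological_tendstoD[of _ _ _ V] assms by fastforce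
qed

lemma has_gateaux_derivative_transform:
  assumes "has_gateaux_derivative F A u" "open V" "u \<in> V" "\<And>x. x \<in> V \<Longrightarrow> F x = G x"
  shows "has_gateaux_derivative G A u"
  unfolding has_gateaux_derivative_def
proof
  fix v
  have "((\<lambda>t. (F (u + t *\<^sub>R v) - F u) /\<^sub>R t) \<longlongrightarrow> A v) (at 0)"
    using assms(1) by (simp add: has_gateaux_derivative_def)
  moreover have "\<forall>\<^sub>F t in at 0. (F (u + t *\<^sub>R v) - F u) /\<^sub>R t = (G (u + t *\<^sub>R v) - G u) /\<^sub>R t"
  proof -
    have "\<forall>\<^sub>F t in at 0. u + t *\<^sub>R v \<in> V"
      using eventually_line_in_open[OF assms(2,3), of v] by (simp add: eventually_at_filter eventually_mono)
    then show ?thesis by (rule eventually_mono) (use assms in auto)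
  qed
  ultimately show "((\<lambda>t. (G (u + t *\<^sub>R v) - G u) /\<^sub>R t) \<longlongrightarrow> A v) (at 0)"
    by (rule Lim_transform_eventually)
qed

lemma has_gateaux_derivative_bounded_linear:
  assumes "has_gateaux_derivative F A u"
  shows "has_gateaux_derivative (\<lambda>x. blinfun_apply J (F x)) (J o\<^sub>L A) u"
  unfolding has_gateaux_derivative_def
proof
  fix v
  have "((\<lambda>t. (F (u + t *\<^sub>R v) - F u) /\<^sub>R t) \<longlongrightarrow> A v) (at 0)"
    using assms by (simp add: has_gateaux_derivative_def)
  then have "((\<lambda>t. J ((F (u + t *\<^sub>R v) - F u) /\<^sub>R t)) \<longlongrightarrow> J (A v)) (at 0)"
    by (intro blinfun.tendsto tendsto_const)
  then show "((\<lambda>t. (J (F (u + t *\<^sub>R v)) - J (F u)) /\<^sub>R t) \<longlongrightarrow> (J o\<^sub>L A) v) (at 0)"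
    by (simp add: blinfun.scaleR_right blinfun.diff_right)
qed

text \<open>The Riesz map into the dual space. Composition with it turns the Hessian operator into
  the dual-valued second derivative \<open>deriv2_at\<close>.\<close>

definition dual_embedding :: "'a::real_inner \<Rightarrow>\<^sub>L ('a \<Rightarrow>\<^sub>L real)" where
  "dual_embedding = Blinfun blinfun_inner_left"

lemma dual_embedding_apply: "blinfun_apply dual_embedding = blinfun_inner_left"
  unfolding dual_embedding_def by (rule bounded_linear_Blinfun_apply[OF bounded_linear_blinfun_inner_left])

lemma norm_dual_embedding_compose: "norm (dual_embedding o\<^sub>L A) \<le> norm A"
  by (rule norm_blinfun_bound) (simp_all add: dual_embedding_apply norm_blinfun_inner_left norm_blinfun)

lemma deriv2_at_gateaux:
  assumes "open V" "u \<in> V" "\<And>x. x \<in> V \<Longrightarrow> GDERIV f x :> g x" "has_gateaux_derivative g A u"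
  shows "deriv2_at f u = dual_embedding o\<^sub>L A" "hessian f u = A"
proof -
  have "has_gateaux_derivative (deriv_at f) (dual_embedding o\<^sub>L A) u"
    by (rule has_gateaux_derivative_transform[OF has_gateaux_derivative_bounded_linear[OF assms(4)] assms(1,2)])
       (simp add: dual_embedding_apply deriv_at_gderiv[OF assms(3)])
  then show "deriv2_at f u = dual_embedding o\<^sub>L A" unfolding deriv2_at_def by (rule gateaux_derivative_eqI)
  have "has_gateaux_derivative (gradient f) A u"
    by (rule has_gateaux_derivative_transform[OF assms(4,1,2)]) (simp add: gradient_eqI[OF assms(3)])
  then show "hessian f u = A" unfolding hessian_def by (rule gateaux_derivative_eqI)
qed

text \<open>A mean value equality fails for vector-valued maps, so F is first paired with y; the
  intermediate point depends on y. Gateaux differentiability at each point of the segment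
  differentiates the scalar function, after moving the base point of the line.\<close>

lemma gateaux_mean_value:
  fixes F :: "'a::real_normed_vector \<Rightarrow> 'b::real_inner"
  assumes "\<And>t. 0 \<le> t \<Longrightarrow> t \<le> 1 \<Longrightarrow> has_gateaux_derivative F (B (a + t *\<^sub>R h)) (a + t *\<^sub>R h)"
  obtains t where "0 < t" "t < 1" "(F (a + h) - F a) \<bullet> y = blinfun_apply (B (a + t *\<^sub>R h)) h \<bullet> y"
proof -
  define f where "f t = F (a + t *\<^sub>R h) \<bullet> y" for t :: real
  have der: "(f has_derivative (\<lambda>s. s * (B (a + t *\<^sub>R h) h \<bullet> y))) (at t within {0..1})" if t: "t \<in> {0..1}" for t
  proof -
    have "((\<lambda>s. F (a + t *\<^sub>R h + s *\<^sub>R h)) has_vector_derivative B (a + t *\<^sub>R h) h) (at 0)"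
      using assms[of t] t by (simp add: has_gateaux_derivative_iff)
    then have 1: "((\<lambda>s. F (a + t *\<^sub>R h + s *\<^sub>R h)) has_derivative (\<lambda>s. s *\<^sub>R B (a + t *\<^sub>R h) h)) (at (t - t))"
      by (simp add: has_vector_derivative_def)
    have 2: "((\<lambda>s. s - t) has_derivative (\<lambda>s. s)) (at t)"
      by (auto intro!: derivative_eq_intros)
    have "((\<lambda>s. F (a + t *\<^sub>R h + (s - t) *\<^sub>R h)) has_derivative (\<lambda>s. s *\<^sub>R B (a + t *\<^sub>R h) h)) (at t)"
      by (rule has_derivative_compose[OF 2 1])
    then have "((\<lambda>s. F (a + s *\<^sub>R h)) has_derivative (\<lambda>s. s *\<^sub>R B (a + t *\<^sub>R h) h)) (at t)"
      by (simp add: scaleR_diff_left)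
    then have "((\<lambda>s. F (a + s *\<^sub>R h) \<bullet> y) has_derivative (\<lambda>s. (s *\<^sub>R B (a + t *\<^sub>R h) h) \<bullet> y)) (at t)"
      by (rule has_derivative_inner_left)
    then show ?thesis unfolding f_def by (simp add: has_derivative_at_withinI)
  qed
  obtain t where t: "t \<in> {0<..<1}" "f 1 - f 0 = (1 - 0) * (B (a + t *\<^sub>R h) h \<bullet> y)"
    using mvt_simple[OF zero_less_one der] by auto
  show thesis by (rule that[of t]) (use t in \<open>auto simp: f_def inner_diff_left\<close>)
qed

lemma gateaux_mean_value_ball:
  fixes F :: "'a::real_normed_vector \<Rightarrow> 'b::real_inner"
  assumes "convex W" "\<And>x. x \<in> W \<Longrightarrow> has_gateaux_derivative F (B x) x" "a \<in> W" "b \<in> W"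
  obtains x where "x \<in> W" "norm (x - a) \<le> norm (b - a)" "(F b - F a) \<bullet> y = blinfun_apply (B x) (b - a) \<bullet> y"
proof -
  have seg: "a + t *\<^sub>R (b - a) \<in> W" if "0 \<le> t" "t \<le> 1" for t
  proof -
    have "(1 - t) *\<^sub>R a + t *\<^sub>R b \<in> W" using assms that by (intro convexD) auto
    then show ?thesis by (simp add: algebra_simps)
  qed
  obtain t where t: "0 < t" "t < 1" "(F (a + (b - a)) - F a) \<bullet> y = B (a + t *\<^sub>R (b - a)) (b - a) \<bullet> y"
    by (rule gateaux_mean_value[of F B a "b - a" y]) (use assms seg in auto)
  show thesis
  proof (rule that)
    show "a + t *\<^sub>R (b - a) \<in> W" using seg t by simp
    show "norm (a + t *\<^sub>R (b - a) - a) \<le> norm (b - a)" using t by (simp add: mult_left_le_one_le)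
    show "(F b - F a) \<bullet> y = B (a + t *\<^sub>R (b - a)) (b - a) \<bullet> y" using t by simp
  qed
qed

text \<open>
  Although \<open>F\<close> is only Gateaux differentiable and its derivative only strongly continuous, the
  scalar components of \<open>F\<close> are continuously Frechet differentiable, by self-adjointness.
\<close>

lemma gateaux_component_has_derivative:
  fixes F :: "'a::real_inner \<Rightarrow> 'a"
  assumes V: "open V" "u \<in> V" and F: "\<And>x. x \<in> V \<Longrightarrow> has_gateaux_derivative F (B x) x"
    and B: "\<And>x. x \<in> V \<Longrightarrow> selfadjoint (B x)" "continuous_on V (\<lambda>x. blinfun_apply (B x) e)"
  shows "((\<lambda>x. F x \<bullet> e) has_derivative (\<lambda>h. h \<bullet> blinfun_apply (B u) e)) (at u)"
  unfolding has_derivative_at_alt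
proof (intro conjI allI impI)
  show "bounded_linear (\<lambda>h. h \<bullet> B u e)" by (rule bounded_linear_inner_left)
  fix \<epsilon> :: real assume "\<epsilon> > 0"
  obtain d0 where d0: "d0 > 0" "ball u d0 \<subseteq> V" using V openE by blast
  have "continuous (at u) (\<lambda>x. B x e)" using B(2) V continuous_on_eq_continuous_at by blast
  then obtain d1 where d1: "d1 > 0" "\<And>x. dist x u < d1 \<Longrightarrow> dist (B x e) (B u e) < \<epsilon>"
    using \<open>\<epsilon> > 0\<close> unfolding continuous_at_eps_delta by blast
  show "\<exists>d>0. \<forall>y. norm (y - u) < d \<longrightarrow> norm (F y \<bullet> e - F u \<bullet> e - (y - u) \<bullet> B u e) \<le> \<epsilon> * norm (y - u)"
  proof (intro exI[of _ "min d0 d1"] conjI allI impI)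
    show "min d0 d1 > 0" using d0 d1 by simp
    fix y assume y: "norm (y - u) < min d0 d1"
    obtain x where x: "x \<in> ball u d0" "norm (x - u) \<le> norm (y - u)" "(F y - F u) \<bullet> e = B x (y - u) \<bullet> e"
    proof (rule gateaux_mean_value_ball[of "ball u d0" F B u y e])
      show "y \<in> ball u d0" using y by (simp add: dist_norm norm_minus_commute)
      show "u \<in> ball u d0" using d0 by simp
      show "has_gateaux_derivative F (B x) x" if "x \<in> ball u d0" for x using F d0 that by blast
    qed auto
    have "x \<in> V" using x d0 by blast
    have "F y \<bullet> e - F u \<bullet> e - (y - u) \<bullet> B u e = (y - u) \<bullet> (B x e - B u e)"
      using x(3) selfadjointD[OF B(1)[OF \<open>x \<in> V\<close>], of "y - u" e]
      by (simp only: inner_diff_left[of "F y" "F u" e, symmetric]) (simp add: inner_diff_right)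
    also have "norm \<dots> \<le> norm (y - u) * norm (B x e - B u e)"
      using Cauchy_Schwarz_ineq2 by simp
    also have "\<dots> \<le> norm (y - u) * \<epsilon>"
    proof (rule mult_left_mono)
      have "dist x u < d1" using x(2) y by (simp add: dist_norm)
      from d1(2)[OF this] show "norm (B x e - B u e) \<le> \<epsilon>" by (simp add: dist_norm)
    qed simp
    finally show "norm (F y \<bullet> e - F u \<bullet> e - (y - u) \<bullet> B u e) \<le> \<epsilon> * norm (y - u)"
      by (simp add: mult.commute)
  qed
qed

subsection \<open>The Hessian near a point\<close>

text \<open>Fixes one choice of the operators hidden by the existential quantifier of
  \<open>hypothesis_B\<close>. The locale is instantiated a second time for the perturbed
  functional.\<close>

locale functional_B =
  fixes V :: "'a::{real_inner,complete_space} set" and L :: "'a \<Rightarrow> real"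
    and B P Q :: "'a \<Rightarrow> 'a \<Rightarrow>\<^sub>L 'a"
  assumes open_V: "open V" and C1: "C1_on V L"
    and gateaux: "u \<in> V \<Longrightarrow> has_gateaux_derivative (gradient L) (B u) u"
    and selfadjoint_B: "u \<in> V \<Longrightarrow> selfadjoint (B u)"
    and decomp: "u \<in> V \<Longrightarrow> B u = P u + Q u"
    and selfadjoint_P: "u \<in> V \<Longrightarrow> selfadjoint (P u)"
    and positive_P: "u \<in> V \<Longrightarrow> positive_definite (P u)"
    and selfadjoint_Q: "u \<in> V \<Longrightarrow> selfadjoint (Q u)"
    and compact_Q: "u \<in> V \<Longrightarrow> compact_operator (Q u)"
    and continuous_P: "continuous_on V (\<lambda>u. blinfun_apply (P u) v)"
    and continuous_Q: "continuous_on V Q"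
    and coercive_P: "u \<in> V \<Longrightarrow> \<exists>U C. open U \<and> u \<in> U \<and> U \<subseteq> V \<and> C > 0 \<and>
           (\<forall>x\<in>U. \<forall>v. blinfun_apply (P x) v \<bullet> v \<ge> C * (norm v)\<^sup>2)"

lemma functional_B_I:
  assumes "open V" "C1_on V L" "hypothesis_B V L"
  obtains B P Q where "functional_B V L B P Q"
proof -
  obtain B P Q :: "'a \<Rightarrow> 'a \<Rightarrow>\<^sub>L 'a" where
    1: "\<forall>u\<in>V. has_gateaux_derivative (gradient L) (B u) u \<and> selfadjoint (B u) \<and>
               B u = P u + Q u \<and> selfadjoint (P u) \<and> positive_definite (P u) \<and>
               selfadjoint (Q u) \<and> compact_operator (Q u)"
    and 2: "\<forall>v. continuous_on V (\<lambda>u. blinfun_apply (P u) v)" "continuous_on V Q"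
    and 3: "\<forall>u\<^sub>0\<in>V. \<exists>U C. open U \<and> u\<^sub>0 \<in> U \<and> U \<subseteq> V \<and> C > 0 \<and>
           (\<forall>u\<in>U. \<forall>v. blinfun_apply (P u) v \<bullet> v \<ge> C * (norm v)\<^sup>2)"
    using assms(3) unfolding hypothesis_B_def by (elim exE conjE)
  have "functional_B V L B P Q"
    by (rule functional_B.intro) (use assms(1,2) 1 2 3 in blast)+
  then show thesis by (rule that)
qed

context functional_B
begin

lemma hessian_eq: "u \<in> V \<Longrightarrow> hessian L u = B u"
  unfolding hessian_def by (rule gateaux_derivative_eqI[OF gateaux])

lemma compact_perturbation_B:
  assumes "u \<in> V"
  obtains C where "compact_perturbation (B u) (P u) (Q u) C"
proof -
  obtain U C where "u \<in> U" "C > 0" "\<forall>x\<in>U. \<forall>v. blinfun_apply (P x) v \<bullet> v \<ge> C * (norm v)\<^sup>2"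
    using coercive_P[OF assms] by blast
  then have "compact_perturbation (B u) (P u) (Q u) C"
    using selfadjoint_B[OF assms] decomp[OF assms] compact_Q[OF assms]
    by (intro compact_perturbation.intro) blast+
  then show thesis by (rule that)
qed

lemma spectral_frame_B:
  assumes "u \<in> V"
  obtains S T where "spectral_frame (B u) S T"
  using compact_perturbation_B[OF assms] compact_perturbation.spectral_frame_exists by metis

lemma continuous_B: "continuous_on V (\<lambda>u. blinfun_apply (B u) v)"
proof -
  have "continuous_on V (\<lambda>u. P u v + Q u v)"
    by (intro continuous_intros continuous_P blinfun.continuous_on continuous_Q)
  then show ?thesis
    by (rule continuous_on_eq) (simp add: decomp blinfun.add_left)
qed

text \<open>
  Along a hypothetical sequence violating the bound, the convexity inequality
  \<open>P v v \<ge> 2 P f v - P f f + C |v - f|\<^sup>2\<close> at a weak cluster point \<open>f\<close> replaces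
  the missing norm continuity of \<open>P\<close>.
\<close>

lemma positive_near:
  assumes u0: "u\<^sub>0 \<in> V" and X: "closed X" "subspace X"
    and pos: "\<And>x. x \<in> X \<Longrightarrow> x \<noteq> 0 \<Longrightarrow> blinfun_apply (B u\<^sub>0) x \<bullet> x > 0"
  obtains c where "c > 0" "ball u\<^sub>0 c \<subseteq> V"
    "\<And>u v. u \<in> ball u\<^sub>0 c \<Longrightarrow> v \<in> X \<Longrightarrow> blinfun_apply (B u) v \<bullet> v \<ge> c * (norm v)\<^sup>2"
proof (rule ccontr)
  assume notthesis: "\<not> thesis"
  obtain U C where U: "open U" "u\<^sub>0 \<in> U" "U \<subseteq> V" "C > 0"
    and PC: "\<And>x v. x \<in> U \<Longrightarrow> P x v \<bullet> v \<ge> C * (norm v)\<^sup>2"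
    using coercive_P[OF u0] by blast
  obtain d where d: "d > 0" "ball u\<^sub>0 d \<subseteq> U" using U openE by blast
  \<comment> \<open>One number serves as radius and as constant, like c in the conclusion, so the
    conclusion fails for every n. The cap d keeps the balls inside \<open>U\<close>, where
    \<open>P\<close> is uniformly coercive.\<close>
  define i where "i n = min d (inverse (real (Suc n)))" for n
  have i: "i n > 0" "i n \<le> d" "i n \<le> inverse (real (Suc n))" for n using d by (auto simp: i_def)
  have ballV: "ball u\<^sub>0 (i n) \<subseteq> U" for n
    using subset_ball[OF i(2), of u\<^sub>0 n] d(2) by (rule subset_trans)
  have "\<exists>u v. u \<in> ball u\<^sub>0 (i n) \<and> v \<in> X \<and> B u v \<bullet> v < i n * (norm v)\<^sup>2" for n
  proof (rule ccontr)
    assume "\<not> ?thesis"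
    then have "B u v \<bullet> v \<ge> i n * (norm v)\<^sup>2" if "u \<in> ball u\<^sub>0 (i n)" "v \<in> X" for u v
      using that by (meson not_less)
    then show False using notthesis that[of "i n"] i(1)[of n] ballV[of n] U(3) by blast
  qed
  then obtain u w where uw: "\<And>n. u n \<in> ball u\<^sub>0 (i n)" "\<And>n. w n \<in> X" "\<And>n. B (u n) (w n) \<bullet> w n < i n * (norm (w n))\<^sup>2"
    by metis
  define v where "v n = w n /\<^sub>R norm (w n)" for n
  have w0: "w n \<noteq> 0" for n using uw(3)[of n] by auto
  have vX: "v n \<in> X" for n using uw(2) X(2) by (simp add: v_def subspace_scale)
  have nv: "norm (v n) = 1" for n using w0 by (simp add: v_def)
  have uU: "u n \<in> U" for n using uw(1)[of n] ballV[of n] by blast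
  have uV: "u n \<in> V" for n using uU U(3) by blast
  have Bv: "B (u n) (v n) \<bullet> v n < i n" for n
  proof -
    have "B (u n) (v n) \<bullet> v n = (B (u n) (w n) \<bullet> w n) / (norm (w n))\<^sup>2"
      by (simp add: v_def blinfun.scaleR_right power2_eq_square divide_inverse mult_ac)
    also have "\<dots> < i n" using uw(3)[of n] w0[of n] by (simp add: pos_divide_less_eq)
    finally show ?thesis .
  qed
  have i0: "i \<longlonglongrightarrow> 0"
    by (intro tendsto_sandwich[OF _ _ tendsto_const LIMSEQ_inverse_real_of_nat] always_eventually allI
        i(3) less_imp_le[OF i(1)])
  have "dist (u n) u\<^sub>0 \<le> i n" for n using uw(1)[of n] by (simp add: dist_commute)
  then have "(\<lambda>n. dist (u n) u\<^sub>0) \<longlonglongrightarrow> 0"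
    by (intro tendsto_sandwich[OF _ _ tendsto_const i0] always_eventually) simp_all
  then have u: "u \<longlonglongrightarrow> u\<^sub>0" by (rule tendsto_dist_iff[THEN iffD2])
  obtain s q where s: "strict_mono s" and q: "(\<lambda>n. Q u\<^sub>0 (v (s n))) \<longlonglongrightarrow> q"
    using compact_operator_subseq[OF compact_Q[OF u0], of v 1] nv by auto
  define u' where "u' n = u (s n)" for n
  define v' where "v' n = v (s n)" for n
  have u': "u' \<longlonglongrightarrow> u\<^sub>0" using LIMSEQ_subseq_LIMSEQ[OF u s] by (simp add: u'_def[abs_def] o_def)
  have i0': "(\<lambda>n. i (s n)) \<longlonglongrightarrow> 0" using LIMSEQ_subseq_LIMSEQ[OF i0 s] by (simp add: o_def)
  have nv': "norm (v' n) = 1" for n by (simp add: v'_def nv)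
  have u'V: "u' n \<in> V" for n by (simp add: u'_def uV)
  obtain f where f: "\<And>C n. closed C \<Longrightarrow> convex C \<Longrightarrow> (\<And>m. m \<ge> n \<Longrightarrow> v' m \<in> C) \<Longrightarrow> f \<in> C"
    using weak_cluster_point[of v' 1] nv' by auto
  have fX: "f \<in> X"
    by (rule f[of X 0]) (use X vX in \<open>auto simp: v'_def intro: subspace_imp_convex\<close>)
  have Qf: "Q u\<^sub>0 f = q"
  proof -
    have "norm (Q u\<^sub>0 f - q) \<le> 0 + e" if "e > 0" for e
    proof -
      obtain N where N: "\<And>n. n \<ge> N \<Longrightarrow> norm (Q u\<^sub>0 (v' n) - q) < e"
        using LIMSEQ_D[OF q \<open>e > 0\<close>] by (auto simp: v'_def)
      have "f \<in> Q u\<^sub>0 -` cball q e"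
      proof (rule f[of _ N])
        show "closed (Q u\<^sub>0 -` cball q e)"
          by (intro closed_vimage closed_cball linear_continuous_on blinfun.bounded_linear_right)
        show "convex (Q u\<^sub>0 -` cball q e)"
          by (intro convex_linear_vimage convex_cball bounded_linear.linear blinfun.bounded_linear_right)
        show "v' m \<in> Q u\<^sub>0 -` cball q e" if "m \<ge> N" for m
          using N[OF that] by (simp add: dist_norm norm_minus_commute)
      qed
      then show ?thesis by (simp add: dist_norm norm_minus_commute)
    qed
    then have "norm (Q u\<^sub>0 f - q) \<le> 0" by (rule field_le_epsilon)
    then show ?thesis by simp
  qed
  \<comment> \<open>y collects the limits of the terms linear in v: twice \<open>P f\<close> from
    the convexity inequality, and the limit q of the compact part.\<close>
  define y where "y = 2 *\<^sub>R P u\<^sub>0 f + q"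
  \<comment> \<open>Otherwise a tail lies in a closed half-space that misses f. This holds for
    infinitely many indices only, but one good index beyond each bound suffices below.\<close>
  have freq: "\<exists>n\<ge>N. y \<bullet> v' n > y \<bullet> f - e" if "e > 0" for e N
  proof (rule ccontr)
    assume "\<not> ?thesis"
    then have le: "y \<bullet> v' n \<le> y \<bullet> f - e" if "n \<ge> N" for n using that by (meson not_less)
    have "f \<in> {x. y \<bullet> x \<le> y \<bullet> f - e}"
      by (rule f[of _ N]) (use le in \<open>auto intro: closed_halfspace_le convex_halfspace_le\<close>)
    then show False using \<open>e > 0\<close> by simp
  qed
  define \<eta> where "\<eta> n = 2 * norm (P (u' n) f - P u\<^sub>0 f) + norm (P (u' n) f - P u\<^sub>0 f) * norm f
      + norm (Q (u' n) - Q u\<^sub>0) + norm (Q u\<^sub>0 (v' n) - q) + i (s n)" for n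
  have "\<eta> \<longlonglongrightarrow> 2 * 0 + 0 * norm f + 0 + 0 + 0"
    unfolding \<eta>_def
  proof (intro tendsto_add tendsto_mult tendsto_const i0')
    have "(\<lambda>n. P (u' n) f) \<longlonglongrightarrow> P u\<^sub>0 f"
      using continuous_on_tendsto_compose[OF continuous_P u' u0] u'V by simp
    then show "(\<lambda>n. norm (P (u' n) f - P u\<^sub>0 f)) \<longlonglongrightarrow> 0" by (simp add: tendsto_norm_zero LIM_zero)
    then show "(\<lambda>n. norm (P (u' n) f - P u\<^sub>0 f)) \<longlonglongrightarrow> 0" .
    have "(\<lambda>n. Q (u' n)) \<longlonglongrightarrow> Q u\<^sub>0"
      using continuous_on_tendsto_compose[OF continuous_Q u' u0] u'V by simp
    then show "(\<lambda>n. norm (Q (u' n) - Q u\<^sub>0)) \<longlonglongrightarrow> 0" by (simp add: tendsto_norm_zero LIM_zero)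
    show "(\<lambda>n. norm (Q u\<^sub>0 (v' n) - q)) \<longlonglongrightarrow> 0" using q by (simp add: v'_def tendsto_norm_zero LIM_zero)
  qed
  then have \<eta>0: "\<eta> \<longlonglongrightarrow> 0" by simp
  have main: "y \<bullet> v' n - P u\<^sub>0 f \<bullet> f + C * (norm (v' n - f))\<^sup>2 \<le> \<eta> n" for n
  proof -
    have Pn: "P (u' n) (v' n) \<bullet> v' n \<ge> 2 * (P (u' n) f \<bullet> v' n) - P (u' n) f \<bullet> f + C * (norm (v' n - f))\<^sup>2"
    proof -
      have "C * (norm (v' n - f))\<^sup>2 \<le> P (u' n) (v' n - f) \<bullet> (v' n - f)"
        using PC uU by (simp add: u'_def)
      also have "\<dots> = P (u' n) (v' n) \<bullet> v' n - P (u' n) (v' n) \<bullet> f - P (u' n) f \<bullet> v' n + P (u' n) f \<bullet> f"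
        by (simp add: blinfun.diff_right inner_diff_left inner_diff_right)
      also have "P (u' n) (v' n) \<bullet> f = P (u' n) f \<bullet> v' n"
        using selfadjointD[OF selfadjoint_P[OF u'V], of n "v' n" f] by (simp add: inner_commute)
      finally show ?thesis by simp
    qed
    have a1: "\<bar>(P (u' n) f - P u\<^sub>0 f) \<bullet> v' n\<bar> \<le> norm (P (u' n) f - P u\<^sub>0 f)"
      using Cauchy_Schwarz_ineq2[of "P (u' n) f - P u\<^sub>0 f" "v' n"] nv' by simp
    have a2: "\<bar>(P (u' n) f - P u\<^sub>0 f) \<bullet> f\<bar> \<le> norm (P (u' n) f - P u\<^sub>0 f) * norm f"
      by (rule Cauchy_Schwarz_ineq2)
    have a3: "\<bar>(Q (u' n) - Q u\<^sub>0) (v' n) \<bullet> v' n\<bar> \<le> norm (Q (u' n) - Q u\<^sub>0)"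
    proof -
      have "\<bar>(Q (u' n) - Q u\<^sub>0) (v' n) \<bullet> v' n\<bar> \<le> norm ((Q (u' n) - Q u\<^sub>0) (v' n)) * norm (v' n)"
        by (rule Cauchy_Schwarz_ineq2)
      also have "\<dots> \<le> norm (Q (u' n) - Q u\<^sub>0)" using norm_blinfun[of "Q (u' n) - Q u\<^sub>0" "v' n"] nv' by simp
      finally show ?thesis .
    qed
    have a4: "\<bar>(Q u\<^sub>0 (v' n) - q) \<bullet> v' n\<bar> \<le> norm (Q u\<^sub>0 (v' n) - q)"
      using Cauchy_Schwarz_ineq2[of "Q u\<^sub>0 (v' n) - q" "v' n"] nv' by simp
    have "B (u' n) (v' n) \<bullet> v' n < i (s n)" using Bv by (simp add: u'_def v'_def)
    moreover have "B (u' n) (v' n) \<bullet> v' n = P (u' n) (v' n) \<bullet> v' n + Q (u' n) (v' n) \<bullet> v' n"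
      by (simp add: decomp[OF u'V] blinfun.add_left inner_add_left)
    moreover have "y \<bullet> v' n = 2 * (P u\<^sub>0 f \<bullet> v' n) + q \<bullet> v' n"
      by (simp add: y_def inner_add_left)
    ultimately show ?thesis
      using Pn a1 a2 a3 a4 unfolding \<eta>_def blinfun.diff_left inner_diff_left by linarith
  qed
  have yf: "y \<bullet> f - P u\<^sub>0 f \<bullet> f = B u\<^sub>0 f \<bullet> f"
    by (simp add: y_def Qf[symmetric] decomp[OF u0] blinfun.add_left inner_add_left)
  have small: "\<exists>n. B u\<^sub>0 f \<bullet> f + C * (norm (v' n - f))\<^sup>2 \<le> e" if "e > 0" for e
  proof -
    obtain N where N: "\<And>n. n \<ge> N \<Longrightarrow> \<eta> n < e / 2"
      using order_tendstoD(2)[OF \<eta>0, of "e/2"] \<open>e > 0\<close> unfolding eventually_sequentially by auto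
    obtain n where n: "n \<ge> N" "y \<bullet> v' n > y \<bullet> f - e / 2" using freq[of "e/2" N] \<open>e > 0\<close> by auto
    have "B u\<^sub>0 f \<bullet> f + C * (norm (v' n - f))\<^sup>2 \<le> e"
      using main[of n] N[OF n(1)] n(2) yf by linarith
    then show ?thesis by blast
  qed
  \<comment> \<open>The form at f is at most every positive number, so positivity on
    \<open>X\<close> leaves only f = 0; then \<open>C * (norm (v' n))\<^sup>2\<close> gets below
    \<open>C\<close> although the vectors have norm 1.\<close>
  have "f = 0"
  proof (rule ccontr)
    assume "f \<noteq> 0"
    then have p: "B u\<^sub>0 f \<bullet> f > 0" using pos fX by blast
    obtain n where "B u\<^sub>0 f \<bullet> f + C * (norm (v' n - f))\<^sup>2 \<le> B u\<^sub>0 f \<bullet> f / 2" using small[of "B u\<^sub>0 f \<bullet> f / 2"] p by auto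
    moreover have "C * (norm (v' n - f))\<^sup>2 \<ge> 0" using U(4) by simp
    ultimately show False using p by linarith
  qed
  then obtain n where "C * (norm (v' n))\<^sup>2 \<le> C / 2" using small[of "C/2"] U(4) by auto
  then show False using nv' U(4) by simp
qed

section \<open>Uniform bounds and definiteness of the Hessian near a point\<close>

lemma strict_sublevel_ball:
  assumes "u\<^sub>0 \<in> V" "continuous_on V f" "f u\<^sub>0 < (d::real)"
  obtains r where "r > 0" "ball u\<^sub>0 r \<subseteq> V" "\<And>u. u \<in> ball u\<^sub>0 r \<Longrightarrow> f u < d"
proof -
  have "open (V \<inter> f -` {..<d})" using assms open_V by (intro continuous_open_preimage) auto
  moreover have "u\<^sub>0 \<in> V \<inter> f -` {..<d}" using assms by simp
  ultimately obtain r where "r > 0" "ball u\<^sub>0 r \<subseteq> V \<inter> f -` {..<d}" using openE by blast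
  then show thesis by (intro that[of r]) auto
qed

text \<open>Only the values of \<open>B u\<close> on the finite basis matter, and these depend
  continuously on u.\<close>

lemma bounded_near:
  assumes u0: "u\<^sub>0 \<in> V" and T: "orthonormal T"
  obtains r M where "r > 0" "M \<ge> 0" "ball u\<^sub>0 r \<subseteq> V"
    "\<And>u z. u \<in> ball u\<^sub>0 r \<Longrightarrow> z \<in> span T \<Longrightarrow> norm (blinfun_apply (B u) z) \<le> M * norm z"
proof -
  define f where "f u = (\<Sum>e\<in>T. norm (B u e))" for u
  have "continuous_on V f" unfolding f_def by (intro continuous_intros continuous_B)
  then obtain r where r: "r > 0" "ball u\<^sub>0 r \<subseteq> V" "\<And>u. u \<in> ball u\<^sub>0 r \<Longrightarrow> f u < f u\<^sub>0 + 1"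
    using strict_sublevel_ball[OF u0, of f "f u\<^sub>0 + 1"] by auto
  have "f u\<^sub>0 + 1 \<ge> 0" unfolding f_def by (intro add_nonneg_nonneg sum_nonneg) auto
  moreover have "norm (B u z) \<le> (f u\<^sub>0 + 1) * norm z" if "u \<in> ball u\<^sub>0 r" "z \<in> span T" for u z
  proof -
    have "norm (B u z) \<le> f u * norm z" unfolding f_def by (rule norm_blinfun_span_le[OF T that(2)])
    also have "\<dots> \<le> (f u\<^sub>0 + 1) * norm z" using r(3)[OF that(1)] by (intro mult_right_mono) auto
    finally show ?thesis .
  qed
  ultimately show thesis using that r by blast
qed

text \<open>Compactness of the unit sphere of \<open>span S\<close> gives a uniform constant at the
  center; strong continuity on the basis then costs at most half of it nearby.\<close>

lemma negative_near:
  assumes u0: "u\<^sub>0 \<in> V" and S: "orthonormal S"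
    and neg: "\<And>x. x \<in> span S \<Longrightarrow> x \<noteq> 0 \<Longrightarrow> blinfun_apply (B u\<^sub>0) x \<bullet> x < 0"
  obtains c r where "c > 0" "r > 0" "ball u\<^sub>0 r \<subseteq> V"
    "\<And>u v. u \<in> ball u\<^sub>0 r \<Longrightarrow> v \<in> span S \<Longrightarrow> blinfun_apply (B u) v \<bullet> v \<le> - c * (norm v)\<^sup>2"
proof -
  define K where "K = span S \<inter> sphere 0 1"
  have cK: "compact K"
  proof -
    have "K = (span S \<inter> cball 0 1) \<inter> sphere 0 1" by (auto simp: K_def)
    moreover have "closed (sphere (0::'a) 1)"
      unfolding sphere_def by (intro closed_Collect_eq continuous_intros)
    ultimately show ?thesis using compact_Int_closed[OF compact_span_cball[OF S, of 1]] by simp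
  qed
  have contq: "continuous_on K (\<lambda>v. B u\<^sub>0 v \<bullet> v)"
    by (intro continuous_intros linear_continuous_on blinfun.bounded_linear_right)
  obtain c where c: "c > 0" "\<And>v. v \<in> K \<Longrightarrow> B u\<^sub>0 v \<bullet> v \<le> - c"
  proof (cases "K = {}")
    case True
    then show ?thesis using that[of 1] by auto
  next
    case False
    obtain x where x: "x \<in> K" "\<And>v. v \<in> K \<Longrightarrow> B u\<^sub>0 v \<bullet> v \<le> B u\<^sub>0 x \<bullet> x"
      using continuous_attains_sup[OF cK False contq] by auto
    have "B u\<^sub>0 x \<bullet> x < 0" using x(1) by (intro neg) (auto simp: K_def)
    then show ?thesis using that[of "- (B u\<^sub>0 x \<bullet> x)"] x by auto
  qed
  have neg0: "B u\<^sub>0 v \<bullet> v \<le> - c * (norm v)\<^sup>2" if v: "v \<in> span S" for v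
  proof (cases "v = 0")
    case False
    have "v /\<^sub>R norm v \<in> K" using False v by (simp add: K_def span_scale)
    from c(2)[OF this] have "(B u\<^sub>0 v \<bullet> v) / (norm v)\<^sup>2 \<le> - c"
      by (simp add: blinfun.scaleR_right power2_eq_square divide_inverse mult_ac)
    then show ?thesis using False by (simp add: pos_divide_le_eq)
  qed simp
  define f where "f u = (\<Sum>e\<in>S. norm (B u e - B u\<^sub>0 e))" for u
  have "continuous_on V f" unfolding f_def by (intro continuous_intros continuous_B)
  moreover have "f u\<^sub>0 < c / 2" using c by (simp add: f_def)
  ultimately obtain r where r: "r > 0" "ball u\<^sub>0 r \<subseteq> V" "\<And>u. u \<in> ball u\<^sub>0 r \<Longrightarrow> f u < c / 2"
    using strict_sublevel_ball[OF u0, of f "c/2"] by auto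
  have "B u v \<bullet> v \<le> - (c / 2) * (norm v)\<^sup>2" if "u \<in> ball u\<^sub>0 r" "v \<in> span S" for u v
  proof -
    have "norm ((B u - B u\<^sub>0) v) \<le> f u * norm v"
      using norm_blinfun_span_le[OF S that(2), of "B u - B u\<^sub>0"] by (simp add: f_def blinfun.diff_left)
    also have "\<dots> \<le> (c / 2) * norm v" using r(3)[OF that(1)] by (intro mult_right_mono) auto
    finally have n: "norm ((B u - B u\<^sub>0) v) \<le> (c / 2) * norm v" .
    have "(B u - B u\<^sub>0) v \<bullet> v \<le> norm ((B u - B u\<^sub>0) v) * norm v" by (rule norm_cauchy_schwarz)
    also have "\<dots> \<le> (c / 2) * norm v * norm v" using n by (intro mult_right_mono) auto
    finally have "B u v \<bullet> v - B u\<^sub>0 v \<bullet> v \<le> (c / 2) * (norm v)\<^sup>2"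
      by (simp add: blinfun.diff_left inner_diff_left power2_eq_square)
    with neg0[OF that(2)] show ?thesis by simp
  qed
  then show thesis using that[of "c/2" r] c r by auto
qed

text \<open>
  Splitting \<open>h\<close> into its components \<open>n + z + p\<close> along the negative space, the kernel and the
  positive space at \<open>u\<^sub>0\<close>, the test vector is \<open>y = p - n\<close>: the mixed terms cancel.
\<close>

lemma reflected_test_vector:
  assumes u0: "u\<^sub>0 \<in> V" and fr: "spectral_frame (B u\<^sub>0) S T"
  obtains c M r where "c > 0" "M \<ge> 0" "r > 0" "ball u\<^sub>0 r \<subseteq> V"
    "\<And>h. \<exists>y. (\<forall>f\<in>T. y \<bullet> f = 0) \<and> norm y = norm (h - proj T h) \<and>
       (\<forall>u\<in>ball u\<^sub>0 r. blinfun_apply (B u) h \<bullet> y \<ge> c * (norm y)\<^sup>2 - M * norm (proj T h) * norm y)"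
    "\<And>u v. u \<in> ball u\<^sub>0 r \<Longrightarrow> v \<noteq> 0 \<Longrightarrow> (\<And>e. e \<in> S \<union> T \<Longrightarrow> v \<bullet> e = 0) \<Longrightarrow> blinfun_apply (B u) v \<bullet> v > 0"
    "\<And>u v. u \<in> ball u\<^sub>0 r \<Longrightarrow> v \<noteq> 0 \<Longrightarrow> v \<in> span S \<Longrightarrow> blinfun_apply (B u) v \<bullet> v < 0"
proof -
  note oS = spectral_frameD(1)[OF fr] and oT = spectral_frameD(2)[OF fr]
  define X where "X = {x. \<forall>e\<in>S \<union> T. x \<bullet> e = 0}"
  have X: "closed X" "subspace X" unfolding X_def by (rule closed_orthogonal subspace_orthogonal)+
  obtain c1 where c1: "c1 > 0" "ball u\<^sub>0 c1 \<subseteq> V"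
    "\<And>u v. u \<in> ball u\<^sub>0 c1 \<Longrightarrow> v \<in> X \<Longrightarrow> B u v \<bullet> v \<ge> c1 * (norm v)\<^sup>2"
    by (rule positive_near[OF u0 X]) (use spectral_frameD(6)[OF fr] in \<open>auto simp: X_def\<close>)
  obtain c2 r2 where c2: "c2 > 0" "r2 > 0" "ball u\<^sub>0 r2 \<subseteq> V"
    "\<And>u v. u \<in> ball u\<^sub>0 r2 \<Longrightarrow> v \<in> span S \<Longrightarrow> B u v \<bullet> v \<le> - c2 * (norm v)\<^sup>2"
    using negative_near[OF u0 oS frame_negative(1)[OF fr]] by blast
  obtain r3 M where M: "r3 > 0" "M \<ge> 0" "ball u\<^sub>0 r3 \<subseteq> V"
    "\<And>u z. u \<in> ball u\<^sub>0 r3 \<Longrightarrow> z \<in> span T \<Longrightarrow> norm (B u z) \<le> M * norm z"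
    using bounded_near[OF u0 oT] by blast
  define c where "c = min c1 c2"
  define r where "r = min c1 (min r2 r3)"
  have c: "c > 0" "c \<le> c1" "c \<le> c2" using c1 c2 by (auto simp: c_def)
  have r: "r > 0" "ball u\<^sub>0 r \<subseteq> ball u\<^sub>0 c1" "ball u\<^sub>0 r \<subseteq> ball u\<^sub>0 r2" "ball u\<^sub>0 r \<subseteq> ball u\<^sub>0 r3"
    using c1 c2 M by (auto simp: r_def intro!: subset_ball)
  have TS: "f \<bullet> e = 0" if "e \<in> S" "f \<in> T" for e f
    using spectral_frameD(3)[OF fr that] by (simp add: inner_commute)
  have test: "\<exists>y. (\<forall>f\<in>T. y \<bullet> f = 0) \<and> norm y = norm (h - proj T h) \<and>
       (\<forall>u\<in>ball u\<^sub>0 r. B u h \<bullet> y \<ge> c * (norm y)\<^sup>2 - M * norm (proj T h) * norm y)" for h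
  proof -
    define z where "z = proj T h"
    define n where "n = proj S h"
    define p where "p = h - z - n"
    have zT: "z \<in> span T" and nS: "n \<in> span S" by (simp_all add: z_def n_def proj_in_span)
    have nT: "n \<bullet> f = 0" if f: "f \<in> T" for f
    proof -
      have "f \<bullet> n = 0" by (rule span_orthogonal[OF _ nS]) (use TS f in auto)
      then show ?thesis by (simp add: inner_commute)
    qed
    have zS: "z \<bullet> e = 0" if e: "e \<in> S" for e
    proof -
      have "e \<bullet> z = 0" by (rule span_orthogonal[OF _ zT]) (use spectral_frameD(3)[OF fr e] in auto)
      then show ?thesis by (simp add: inner_commute)
    qed
    have pT: "p \<bullet> f = 0" if "f \<in> T" for f
      using nT[OF that] proj_inner[OF oT that, of h] by (simp add: p_def z_def inner_diff_left)
    have pS: "p \<bullet> e = 0" if "e \<in> S" for e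
      using zS[OF that] proj_inner[OF oS that, of h] by (simp add: p_def n_def inner_diff_left)
    have pX: "p \<in> X" using pT pS by (auto simp: X_def)
    have pn: "p \<bullet> n = 0" by (rule span_orthogonal[OF pS nS])
    define y where "y = p - n"
    have ny: "(norm y)\<^sup>2 = (norm p)\<^sup>2 + (norm n)\<^sup>2"
      using pn by (simp add: y_def power2_norm_eq_inner inner_diff_left inner_diff_right inner_commute[of n p])
    have "(norm (h - z))\<^sup>2 = (norm p)\<^sup>2 + (norm n)\<^sup>2"
    proof -
      have "h - z = p + n" by (simp add: p_def)
      then show ?thesis using pn
        by (simp add: power2_norm_eq_inner inner_add_left inner_add_right inner_commute[of n p])
    qed
    then have "(norm y)\<^sup>2 = (norm (h - z))\<^sup>2" using ny by (simp only:)
    then have nyh: "norm y = norm (h - z)" by (rule power2_eq_imp_eq) simp_all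
    have "B u h \<bullet> y \<ge> c * (norm y)\<^sup>2 - M * norm z * norm y" if u: "u \<in> ball u\<^sub>0 r" for u
    proof -
      have uV: "u \<in> V" using u r c1(2) by blast
      have h: "h = z + n + p" by (simp add: p_def)
      have "B u h \<bullet> y = B u z \<bullet> y + (B u p \<bullet> p - B u n \<bullet> n) + (B u n \<bullet> p - B u p \<bullet> n)"
        by (simp add: h blinfun.add_right inner_add_left y_def inner_diff_right)
      \<comment> \<open>By self-adjointness the mixed terms of the negative and positive components
        cancel for the reflected vector y, at every u of the ball, although the splitting is
        invariant only under \<open>B u\<^sub>0\<close>.\<close>
      also have "B u n \<bullet> p = B u p \<bullet> n"
        using selfadjointD[OF selfadjoint_B[OF uV], of n p] by (simp add: inner_commute)
      finally have eq: "B u h \<bullet> y = B u z \<bullet> y + (B u p \<bullet> p - B u n \<bullet> n)" by simp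
      have "\<bar>B u z \<bullet> y\<bar> \<le> norm (B u z) * norm y" by (rule Cauchy_Schwarz_ineq2)
      also have "\<dots> \<le> M * norm z * norm y" using M(4)[of u z] u r zT by (intro mult_right_mono) auto
      finally have 1: "B u z \<bullet> y \<ge> - (M * norm z * norm y)" by linarith
      have "c * (norm p)\<^sup>2 \<le> c1 * (norm p)\<^sup>2" using c by (intro mult_right_mono) auto
      also have "\<dots> \<le> B u p \<bullet> p" using c1(3)[of u p] u r pX by blast
      finally have 2: "B u p \<bullet> p \<ge> c * (norm p)\<^sup>2" .
      have "c * (norm n)\<^sup>2 \<le> c2 * (norm n)\<^sup>2" using c by (intro mult_right_mono) auto
      also have "\<dots> \<le> - (B u n \<bullet> n)" using c2(4)[of u n] u r nS by force
      finally have 3: "- (B u n \<bullet> n) \<ge> c * (norm n)\<^sup>2" .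
      have "c * (norm y)\<^sup>2 = c * (norm p)\<^sup>2 + c * (norm n)\<^sup>2" by (simp add: ny distrib_left)
      with eq 1 2 3 show ?thesis by linarith
    qed
    moreover have "\<forall>f\<in>T. y \<bullet> f = 0" using pT nT by (simp add: y_def inner_diff_left)
    ultimately show ?thesis using nyh unfolding z_def by blast
  qed
  show thesis
  proof (rule that[OF c(1) M(2) r(1) _ test])
    show "ball u\<^sub>0 r \<subseteq> V" using r c1 by blast
    show "B u v \<bullet> v > 0" if "u \<in> ball u\<^sub>0 r" "v \<noteq> 0" "\<And>e. e \<in> S \<union> T \<Longrightarrow> v \<bullet> e = 0" for u v
    proof -
      have "c1 * (norm v)\<^sup>2 \<le> B u v \<bullet> v" by (rule c1(3)) (use that r in \<open>auto simp: X_def\<close>)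
      moreover have "c1 * (norm v)\<^sup>2 > 0" using c1 that(2) by simp
      ultimately show ?thesis by linarith
    qed
    show "B u v \<bullet> v < 0" if "u \<in> ball u\<^sub>0 r" "v \<noteq> 0" "v \<in> span S" for u v
    proof -
      have "B u v \<bullet> v \<le> - c2 * (norm v)\<^sup>2" by (rule c2(4)) (use that r in auto)
      moreover have "c2 * (norm v)\<^sup>2 > 0" using c2 that(2) by simp
      ultimately show ?thesis by linarith
    qed
  qed
qed

end

subsection \<open>Critical values in finite dimension\<close>

text \<open>The integer label of the half-open cube of side t containing x, in the coordinates of
  \<open>S\<close>. Restricting it to \<open>S\<close> makes labels elements of a product set
  \<open>PiE\<close>, whose cardinality is known.\<close>

definition cell :: "'a::real_inner set \<Rightarrow> real \<Rightarrow> 'a \<Rightarrow> 'a \<Rightarrow> int" where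
  "cell S t x = restrict (\<lambda>e. \<lfloor>(x \<bullet> e) / t\<rfloor>) S"

lemma norm_le_coordinates:
  assumes S: "orthonormal S" and x: "x \<in> span S" and le: "\<And>e. e \<in> S \<Longrightarrow> \<bar>x \<bullet> e\<bar> \<le> t"
  shows "norm x \<le> real (card S) * t"
proof -
  have "norm (\<Sum>e\<in>S. (x \<bullet> e) *\<^sub>R e) \<le> (\<Sum>e\<in>S. t)"
    by (rule sum_norm_le) (use le orthonormal_norm[OF S] in simp)
  then show ?thesis using proj_span[OF S x] by (simp add: proj_def)
qed

lemma norm_coordinate_le: "orthonormal S \<Longrightarrow> e \<in> S \<Longrightarrow> \<bar>x \<bullet> e\<bar> \<le> norm x"
  using Cauchy_Schwarz_ineq2[of x e] orthonormal_norm[of S e] by simp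

lemma cell_eq_imp_close:
  assumes S: "orthonormal S" and xy: "x \<in> span S" "y \<in> span S" and t: "t > 0"
    and eq: "cell S t x = cell S t y"
  shows "norm (x - y) \<le> real (card S) * t"
proof (rule norm_le_coordinates[OF S span_diff[OF xy]])
  fix e assume e: "e \<in> S"
  have "\<lfloor>(x \<bullet> e) / t\<rfloor> = \<lfloor>(y \<bullet> e) / t\<rfloor>" using fun_cong[OF eq, of e] e by (simp add: cell_def)
  then have "\<bar>(x \<bullet> e) / t - (y \<bullet> e) / t\<bar> \<le> 1" by linarith
  then have "\<bar>(x \<bullet> e - y \<bullet> e) / t\<bar> \<le> 1" by (simp add: diff_divide_distrib)
  then show "\<bar>(x - y) \<bullet> e\<bar> \<le> t" using t by (simp add: inner_diff_left abs_divide)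
qed

lemma cell_mem:
  assumes "\<And>e. e \<in> S \<Longrightarrow> \<bar>x \<bullet> e\<bar> \<le> of_int (m e) * t" "t > 0"
  shows "cell S t x \<in> PiE S (\<lambda>e. {- m e..m e})"
proof (rule PiE_I)
  fix e assume e: "e \<in> S"
  have "\<bar>x \<bullet> e\<bar> / t \<le> of_int (m e)" using assms(1)[OF e] assms(2) by (simp add: pos_divide_le_eq)
  then have "\<bar>(x \<bullet> e) / t\<bar> \<le> of_int (m e)" using assms(2) by (simp add: abs_divide)
  then have "\<lfloor>(x \<bullet> e) / t\<rfloor> \<le> m e" "- m e \<le> \<lfloor>(x \<bullet> e) / t\<rfloor>" by linarith+
  then show "cell S t x e \<in> {- m e..m e}" using e by (simp add: cell_def)
qed (simp add: cell_def)

lemma card_le_fibers: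
  assumes "finite A" "finite C" "f ` A \<subseteq> C" "\<And>c. c \<in> C \<Longrightarrow> card {a \<in> A. f a = c} \<le> k"
  shows "card A \<le> card C * k"
proof -
  have "card A = card (\<Union>c\<in>C. {a \<in> A. f a = c})" using assms(3) by (intro arg_cong[of _ _ card]) auto
  also have "\<dots> \<le> (\<Sum>c\<in>C. card {a \<in> A. f a = c})" by (rule card_UN_le[OF assms(2)])
  also have "\<dots> \<le> card C * k" using sum_bounded_above[of C "\<lambda>c. card {a \<in> A. f a = c}" k] assms(4) by simp
  finally show ?thesis .
qed

text \<open>The separation exceeds what two points of one cell of side \<tau> allow, so points have
  distinct labels. Across the slab only the labels -1, 0, 1 occur, along each other axis at most 2m
  + 1; hence the exponent is one less than the dimension.\<close>

lemma slab_card_le: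
  assumes T: "orthonormal T" "\<nu> \<in> T" and \<tau>: "\<tau> > 0" and m: "m \<ge> 0"
    and W: "finite W" "W \<subseteq> span T"
    and slab: "\<And>w. w \<in> W \<Longrightarrow> \<bar>w \<bullet> \<nu>\<bar> \<le> \<tau>" "\<And>w. w \<in> W \<Longrightarrow> norm w \<le> of_int m * \<tau>"
    and sep: "\<And>w w'. w \<in> W \<Longrightarrow> w' \<in> W \<Longrightarrow> w \<noteq> w' \<Longrightarrow> norm (w - w') > real (card T) * \<tau>"
  shows "card W \<le> 3 * (2 * nat m + 1) ^ (card T - 1)"
proof -
  define k where "k e = (if e = \<nu> then 1 else m)" for e
  define C where "C = PiE T (\<lambda>e. {- k e..k e})"
  have fT: "finite T" by (rule orthonormal_finite[OF T(1)])
  have "inj_on (cell T \<tau>) W"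
  proof (rule inj_onI, rule ccontr)
    fix w w' assume w: "w \<in> W" "w' \<in> W" "cell T \<tau> w = cell T \<tau> w'" "w \<noteq> w'"
    have "norm (w - w') \<le> real (card T) * \<tau>"
      by (rule cell_eq_imp_close[OF T(1) _ _ \<tau> w(3)]) (use w W in auto)
    then show False using sep[OF w(1,2,4)] by simp
  qed
  moreover have "cell T \<tau> ` W \<subseteq> C"
  proof
    fix c assume "c \<in> cell T \<tau> ` W"
    then obtain w where w: "w \<in> W" "c = cell T \<tau> w" by blast
    have "\<bar>w \<bullet> e\<bar> \<le> of_int (k e) * \<tau>" if "e \<in> T" for e
      using slab[OF w(1)] norm_coordinate_le[OF T(1) that, of w] by (simp add: k_def)
    then show "c \<in> C" unfolding w(2) C_def using \<tau> by (rule cell_mem)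
  qed
  moreover have "finite C" unfolding C_def by (intro finite_PiE fT) auto
  ultimately have "card W \<le> card C" by (intro card_inj_on_le)
  also have "card C = (\<Prod>e\<in>T. card {- k e..k e})" unfolding C_def by (rule card_PiE[OF fT])
  also have "\<dots> = card {- k \<nu>..k \<nu>} * (\<Prod>e\<in>T - {\<nu>}. card {- k e..k e})"
    by (rule prod.remove[OF fT T(2)])
  also have "(\<Prod>e\<in>T - {\<nu>}. card {- k e..k e}) = (\<Prod>e\<in>T - {\<nu>}. 2 * nat m + 1)"
    by (rule prod.cong) (use m in \<open>auto simp: k_def nat_add_distrib\<close>)
  also have "\<dots> = (2 * nat m + 1) ^ (card T - 1)" using T(2) fT by (simp add: card_Diff_singleton)
  also have "card {- k \<nu>..k \<nu>} = 3" by (simp add: k_def)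
  finally show ?thesis by simp
qed

lemma separated_grid:
  assumes S: "orthonormal S" and d: "d > 0"
  obtains A where "finite A" "A \<subseteq> span S" "card A = N ^ card S"
    "\<And>a. a \<in> A \<Longrightarrow> norm a \<le> real (card S) * (real N * d)"
    "\<And>a b. a \<in> A \<Longrightarrow> b \<in> A \<Longrightarrow> a \<noteq> b \<Longrightarrow> norm (a - b) \<ge> d"
proof -
  define K where "K = PiE S (\<lambda>_. {..<N})"
  define g where "g k = (\<Sum>e\<in>S. (real (k e) * d) *\<^sub>R e)" for k :: "'a \<Rightarrow> nat"
  have fS: "finite S" by (rule orthonormal_finite[OF S])
  have fK: "finite K" unfolding K_def by (intro finite_PiE fS) auto
  have ge: "g k \<bullet> e = real (k e) * d" if "e \<in> S" for k e
    unfolding g_def by (rule inner_sum_orthonormal[OF S that])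
  have gS: "g k \<in> span S" for k unfolding g_def by (intro span_sum span_scale span_base)
  have sep: "norm (g k - g k') \<ge> d" if k: "k \<in> K" "k' \<in> K" "k \<noteq> k'" for k k'
  proof -
    obtain e where e: "e \<in> S" "k e \<noteq> k' e" using k PiE_ext unfolding K_def by metis
    have "1 \<le> \<bar>real (k e) - real (k' e)\<bar>" using e(2) by linarith
    then have "d \<le> \<bar>real (k e) - real (k' e)\<bar> * d" using d by simp
    also have "\<dots> = \<bar>(g k - g k') \<bullet> e\<bar>" using d by (simp add: inner_diff_left ge[OF e(1)] left_diff_distrib[symmetric] abs_mult)
    also have "\<dots> \<le> norm (g k - g k')" by (rule norm_coordinate_le[OF S e(1)])
    finally show ?thesis .
  qed
  have inj: "inj_on g K"
  proof (rule inj_onI, rule ccontr)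
    fix k k' assume "k \<in> K" "k' \<in> K" "g k = g k'" "k \<noteq> k'"
    then show False using sep[of k k'] d by simp
  qed
  show thesis
  proof (rule that[of "g ` K"])
    show "finite (g ` K)" using fK by simp
    show "g ` K \<subseteq> span S" using gS by blast
    show "card (g ` K) = N ^ card S"
      unfolding card_image[OF inj] unfolding K_def by (simp add: card_PiE[OF fS])
    show "norm a \<le> real (card S) * (real N * d)" if "a \<in> g ` K" for a
    proof -
      obtain k where k: "k \<in> K" "a = g k" using \<open>a \<in> g ` K\<close> by blast
      show ?thesis unfolding k(2)
      proof (rule norm_le_coordinates[OF S gS])
        fix e assume e: "e \<in> S"
        have "k e < N" using k(1) e by (auto simp: K_def)
        then show "\<bar>g k \<bullet> e\<bar> \<le> real N * d" using d by (simp add: ge[OF e])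
      qed
    qed
    show "norm (a - b) \<ge> d" if "a \<in> g ` K" "b \<in> g ` K" "a \<noteq> b" for a b
      using that sep by blast
  qed
qed

text \<open>Complete the kernel vector to an orthonormal basis: the image of the span is generated
  by one vector fewer than the dimension, so a unit vector of the span is orthogonal to it.\<close>

lemma singular_normal_vector:
  fixes A :: "'a::real_inner \<Rightarrow>\<^sub>L 'a"
  assumes S: "orthonormal S" and v: "v \<in> span S" "v \<noteq> 0" "blinfun_apply A v = 0"
  obtains \<nu> where "\<nu> \<in> span S" "norm \<nu> = 1" "\<And>w. w \<in> span S \<Longrightarrow> blinfun_apply A w \<bullet> \<nu> = 0"
proof -
  define e0 where "e0 = v /\<^sub>R norm v"
  have e0: "norm e0 = 1" "e0 \<in> span S" "A e0 = 0"
    using v by (auto simp: e0_def span_scale blinfun.scaleR_right)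
  have oe0: "orthonormal {e0}" by (rule orthonormal_insert(1)) (use e0 in auto)
  obtain S' where S': "orthonormal S'" "{e0} \<subseteq> S'" "span S' = span S"
    by (rule orthonormal_basis_extension[OF orthonormal_finite[OF S] oe0]) (use e0(2) in auto)
  have fS': "finite S'" by (rule orthonormal_finite[OF S'(1)])
  have cS': "card S' = card S" by (rule orthonormal_card_unique[OF S'(1) S S'(3)])
  have "card (A ` (S' - {e0})) \<le> card (S' - {e0})" by (rule card_image_le) (use fS' in simp)
  also have "\<dots> < card S'" using S'(2) fS' by (intro card_Diff1_less) auto
  finally have "card (A ` (S' - {e0})) < card S" using cS' by simp
  then obtain x where x: "x \<in> span S" "x \<noteq> 0" "\<And>t. t \<in> A ` (S' - {e0}) \<Longrightarrow> x \<bullet> t = 0"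
    using exists_orthogonal_in_span[OF S, of "A ` (S' - {e0})"] fS' by auto
  have xA: "A w \<bullet> x = 0" if w: "w \<in> span S" for w
  proof -
    have "A w = A (proj S' w)" using proj_span[OF S'(1)] w S'(3) by simp
    also have "\<dots> = (\<Sum>e\<in>S'. (w \<bullet> e) *\<^sub>R A e)"
      by (simp add: proj_def blinfun.sum_right blinfun.scaleR_right)
    finally have "A w \<bullet> x = (\<Sum>e\<in>S'. (w \<bullet> e) * (A e \<bullet> x))" by (simp add: inner_sum_left)
    also have "\<dots> = 0"
    proof (rule sum.neutral, rule ballI)
      fix e assume e: "e \<in> S'"
      show "(w \<bullet> e) * (A e \<bullet> x) = 0"
      proof (cases "e = e0")
        case False
        then have "x \<bullet> A e = 0" using x(3) e by blast
        then show ?thesis by (simp add: inner_commute[of "A e" x])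
      qed (simp add: e0)
    qed
    finally show ?thesis .
  qed
  show thesis
    by (rule that[of "x /\<^sub>R norm x"]) (use x xA in \<open>auto simp: span_scale\<close>)
qed

text \<open>Uniform continuity of the derivative on the compact set, combined with the mean value
  inequality on the convex part of K near x, gives one radius for all base points.\<close>

lemma uniform_linearization:
  fixes G :: "'a::real_normed_vector \<Rightarrow> 'b::real_normed_vector"
  assumes K: "compact K" "convex K"
    and D: "\<And>z. z \<in> K \<Longrightarrow> (G has_derivative blinfun_apply (D z)) (at z within K)" "continuous_on K D"
    and \<epsilon>: "\<epsilon> > 0"
  obtains s where "s > 0" "\<And>x y. x \<in> K \<Longrightarrow> y \<in> K \<Longrightarrow> norm (y - x) \<le> s \<Longrightarrow>
      norm (G y - G x - blinfun_apply (D x) (y - x)) \<le> \<epsilon> * norm (y - x)"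
proof -
  have "uniformly_continuous_on K D" by (rule compact_uniformly_continuous[OF D(2) K(1)])
  then obtain d where d: "d > 0" "\<And>x y. x \<in> K \<Longrightarrow> y \<in> K \<Longrightarrow> dist y x < d \<Longrightarrow> dist (D y) (D x) < \<epsilon>"
    unfolding uniformly_continuous_on_def using \<epsilon> by metis
  show thesis
  proof (rule that[of "d/2"])
    fix x y assume x: "x \<in> K" and y: "y \<in> K" and xy: "norm (y - x) \<le> d/2"
    define S where "S = K \<inter> cball x (d/2)"
    have cS: "convex S" unfolding S_def by (intro convex_Int K convex_cball)
    have xS: "x \<in> S" and yS: "y \<in> S" using x y xy d by (auto simp: S_def dist_norm norm_minus_commute)
    have "norm (G y - G x - D x (y - x)) \<le> norm (y - x) * \<epsilon>"
    proof (rule differentiable_bound_linearization[where S=S])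
      show "x + t *\<^sub>R (y - x) \<in> S" if "t \<in> {0..1}" for t
      proof -
        have "(1 - t) *\<^sub>R x + t *\<^sub>R y \<in> S" using that by (intro convexD[OF cS xS yS]) auto
        then show ?thesis by (simp add: algebra_simps)
      qed
      show "(G has_derivative blinfun_apply (D z)) (at z within S)" if "z \<in> S" for z
        by (rule has_derivative_subset[OF D(1)]) (use that in \<open>auto simp: S_def\<close>)
      show "onorm (blinfun_apply (D z) - blinfun_apply (D x)) \<le> \<epsilon>" if "z \<in> S" for z
      proof -
        have "dist (D z) (D x) < \<epsilon>" using that d x by (intro d(2)) (auto simp: S_def dist_commute)
        then have "norm (D z - D x) \<le> \<epsilon>" by (simp add: dist_norm)
        then show ?thesis by (simp add: norm_blinfun.rep_eq minus_blinfun.rep_eq fun_diff_def)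
      qed
    qed (rule xS)
    then show "norm (G y - G x - D x (y - x)) \<le> \<epsilon> * norm (y - x)" by (simp add: mult.commute)
  qed (use d in simp)
qed

text \<open>
  If \<open>G\<close> is almost linear with singular derivative at \<open>x\<close> on a cell of size \<open>s\<close>, then the image
  of the cell lies in a slab of thickness \<open>\<epsilon> s\<close>, whence the gain of a factor \<open>\<epsilon>\<close> in the count.
\<close>

lemma critical_values_card_le:
  fixes G :: "'a::real_inner \<Rightarrow> 'a"
  assumes S: "orthonormal S" "S \<noteq> {}" and K: "K \<subseteq> span S" "K \<subseteq> cball 0 R"
    and D: "\<And>z. z \<in> K \<Longrightarrow> norm (D z) \<le> M"
    and lin: "\<And>x y. x \<in> K \<Longrightarrow> y \<in> K \<Longrightarrow> norm (y - x) \<le> s \<Longrightarrow>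
      norm (G y - G x - blinfun_apply (D x) (y - x)) \<le> \<epsilon> * norm (y - x)"
    and \<epsilon>: "0 < \<epsilon>" "\<epsilon> \<le> 1" and s: "0 < s"
    and A: "finite A" "A \<subseteq> span S"
      "\<And>a b. a \<in> A \<Longrightarrow> b \<in> A \<Longrightarrow> a \<noteq> b \<Longrightarrow> norm (a - b) \<ge> 2 * real (card S) * (\<epsilon> * s)"
    and crit: "\<And>a. a \<in> A \<Longrightarrow> \<exists>z\<in>K. G z = a \<and> (\<exists>v\<in>span S. v \<noteq> 0 \<and> blinfun_apply (D z) v = 0)"
  shows "card A \<le> (2 * nat \<lceil>R * card S / s\<rceil> + 1) ^ card S *
     (3 * (2 * nat \<lceil>(M + 1) / \<epsilon>\<rceil> + 1) ^ (card S - 1))"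
proof (cases "A = {}")
  case False
  define n where "n = card S"
  have fS: "finite S" by (rule orthonormal_finite[OF S(1)])
  have n: "n > 0" using S fS by (simp add: n_def card_gt_0_iff)
  obtain z where z: "\<And>a. a \<in> A \<Longrightarrow> z a \<in> K" "\<And>a. a \<in> A \<Longrightarrow> G (z a) = a"
    "\<And>a. a \<in> A \<Longrightarrow> \<exists>v\<in>span S. v \<noteq> 0 \<and> D (z a) v = 0"
    using crit by metis
  obtain a0 where "a0 \<in> A" using False by blast
  have "norm (z a0) \<le> R" using K(2) z(1)[OF \<open>a0 \<in> A\<close>] by auto
  then have R: "R \<ge> 0" by (rule order_trans[OF norm_ge_zero])
  have M: "M \<ge> 0" by (rule order_trans[OF norm_ge_zero D[OF z(1)[OF \<open>a0 \<in> A\<close>]]])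
  \<comment> \<open>Two points of \<open>span S\<close> in one cell of side s/n are at distance at
    most s, the range in which the linearization is valid.\<close>
  define t where "t = s / real n"
  have t: "t > 0" "real n * t = s" using s n by (simp_all add: t_def)
  define m where "m = \<lceil>R * real n / s\<rceil>"
  define m' where "m' = \<lceil>(M + 1) / \<epsilon>\<rceil>"
  have m: "R \<le> of_int m * t" "m \<ge> 0"
  proof -
    have le: "R * real n / s \<le> of_int m" unfolding m_def by (rule le_of_int_ceiling)
    then have "R * real n / s * t \<le> of_int m * t" using t by (intro mult_right_mono) auto
    then show "R \<le> of_int m * t" using s n by (simp add: t_def)
    have "0 \<le> R * real n / s" using R s by simp
    then show "m \<ge> 0" using le by linarith
  qed
  have m': "(M + 1) * s \<le> of_int m' * (\<epsilon> * s)" "m' \<ge> 0"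
  proof -
    have le: "(M + 1) / \<epsilon> \<le> of_int m'" unfolding m'_def by (rule le_of_int_ceiling)
    then have "(M + 1) / \<epsilon> * (\<epsilon> * s) \<le> of_int m' * (\<epsilon> * s)" using \<epsilon> s by (intro mult_right_mono) auto
    then show "(M + 1) * s \<le> of_int m' * (\<epsilon> * s)" using \<epsilon> by simp
    have "0 \<le> (M + 1) / \<epsilon>" using M \<epsilon> by simp
    then show "m' \<ge> 0" using le by linarith
  qed
  define C where "C = PiE S (\<lambda>e. {- m..m})"
  have fC: "finite C" unfolding C_def by (intro finite_PiE fS) auto
  have cC: "card C = (2 * nat m + 1) ^ n"
  proof -
    have "card {- m..m} = 2 * nat m + 1" using m(2) by (simp add: nat_add_distrib)
    then show ?thesis unfolding C_def by (simp add: card_PiE[OF fS] n_def)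
  qed
  have "card A \<le> card C * (3 * (2 * nat m' + 1) ^ (n - 1))"
  proof (rule card_le_fibers[OF A(1) fC, of "\<lambda>a. cell S t (z a)"])
    show "(\<lambda>a. cell S t (z a)) ` A \<subseteq> C"
    proof
      fix c assume "c \<in> (\<lambda>a. cell S t (z a)) ` A"
      then obtain a where a: "a \<in> A" "c = cell S t (z a)" by blast
      have "norm (z a) \<le> R" using z(1)[OF a(1)] K(2) by auto
      have "\<bar>z a \<bullet> e\<bar> \<le> of_int m * t" if "e \<in> S" for e
        using norm_coordinate_le[OF S(1) that, of "z a"] \<open>norm (z a) \<le> R\<close> m(1) by linarith
      then show "c \<in> C" unfolding a(2) C_def using t(1) by (rule cell_mem)
    qed
    fix c
    define F where "F = {a \<in> A. cell S t (z a) = c}"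
    show "card {a \<in> A. cell S t (z a) = c} \<le> 3 * (2 * nat m' + 1) ^ (n - 1)"
    proof (cases "F = {}")
      case True
      then have "card {a \<in> A. cell S t (z a) = c} = 0" unfolding F_def by (simp only: card.empty)
      then show ?thesis by simp
    next
      case False
      then obtain g0 where g0: "g0 \<in> F" by blast
      \<comment> \<open>The base point of the fiber: the slab is orthogonal to the normal of the
        singular derivative at x, and all values of the cell are compared with g0.\<close>
      define x where "x = z g0"
      have g0A: "g0 \<in> A" using g0 by (simp add: F_def)
      have xK: "x \<in> K" unfolding x_def by (rule z(1)[OF g0A])
      obtain v where v: "v \<in> span S" "v \<noteq> 0" "D x v = 0" using z(3)[OF g0A] by (auto simp: x_def)
      obtain \<nu> where \<nu>: "\<nu> \<in> span S" "norm \<nu> = 1" "\<And>w. w \<in> span S \<Longrightarrow> D x w \<bullet> \<nu> = 0"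
        using singular_normal_vector[OF S(1) v] by blast
      have o\<nu>: "orthonormal {\<nu>}" by (rule orthonormal_insert(1)) (use \<nu> in auto)
      obtain T where T: "orthonormal T" "{\<nu>} \<subseteq> T" "span T = span S"
        by (rule orthonormal_basis_extension[OF fS o\<nu>]) (use \<nu>(1) in auto)
      have cT: "card T = n" unfolding n_def by (rule orthonormal_card_unique[OF T(1) S(1) T(3)])
      define W where "W = (\<lambda>g. g - g0) ` F"
      have fF: "finite F" using A(1) by (simp add: F_def)
      have cW: "card W = card F" unfolding W_def by (rule card_image) (auto intro: inj_onI)
      \<comment> \<open>The linear part has no component along \<nu>, so only the error, at most
        \<epsilon> s, is left there. In all directions the length is at most M s plus this error,
        hence at most (M + 1) s, which m' measures in units of \<epsilon> s.\<close>
      have est: "\<bar>(g - g0) \<bullet> \<nu>\<bar> \<le> \<epsilon> * s \<and> norm (g - g0) \<le> of_int m' * (\<epsilon> * s)" if g: "g \<in> F" for g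
      proof -
        have gA: "g \<in> A" using g by (simp add: F_def)
        define y where "y = z g"
        have yK: "y \<in> K" unfolding y_def by (rule z(1)[OF gA])
        have "norm (y - x) \<le> real (card S) * t"
          by (rule cell_eq_imp_close[OF S(1) _ _ t(1)]) (use g g0 xK yK K(1) in \<open>auto simp: F_def x_def y_def\<close>)
        then have yx: "norm (y - x) \<le> s" using t(2) by (simp add: n_def)
        define r where "r = G y - G x - D x (y - x)"
        have "norm r \<le> \<epsilon> * norm (y - x)" unfolding r_def by (rule lin[OF xK yK yx])
        also have "\<dots> \<le> \<epsilon> * s" using yx \<epsilon> by (intro mult_left_mono) auto
        finally have nr: "norm r \<le> \<epsilon> * s" .
        have gg: "g - g0 = D x (y - x) + r"
          using z(2)[OF gA] z(2)[OF g0A] by (simp add: r_def x_def y_def)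
        have "D x (y - x) \<bullet> \<nu> = 0" by (rule \<nu>(3)) (use xK yK K(1) in \<open>auto intro: span_diff\<close>)
        then have "(g - g0) \<bullet> \<nu> = r \<bullet> \<nu>" by (simp add: gg inner_add_left)
        moreover have "\<bar>r \<bullet> \<nu>\<bar> \<le> norm r" using Cauchy_Schwarz_ineq2[of r \<nu>] \<nu>(2) by simp
        ultimately have 1: "\<bar>(g - g0) \<bullet> \<nu>\<bar> \<le> \<epsilon> * s" using nr by simp
        have "norm (D x (y - x)) \<le> norm (D x) * norm (y - x)" by (rule norm_blinfun)
        also have "\<dots> \<le> M * s" by (rule mult_mono[OF D[OF xK] yx M]) simp
        finally have "norm (D x (y - x)) \<le> M * s" .
        moreover have "\<epsilon> * s \<le> 1 * s" using \<epsilon> s by (intro mult_right_mono) auto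
        ultimately have "norm (g - g0) \<le> (M + 1) * s"
          unfolding gg using nr norm_triangle_ineq[of "D x (y - x)" r] by (simp add: distrib_right)
        then show ?thesis using 1 m'(1) by simp
      qed
      have "card W \<le> 3 * (2 * nat m' + 1) ^ (card T - 1)"
      proof (rule slab_card_le[OF T(1), of \<nu> "\<epsilon> * s"])
        show "\<nu> \<in> T" using T by simp
        show "\<epsilon> * s > 0" using \<epsilon> s by simp
        show "m' \<ge> 0" by (rule m'(2))
        show "finite W" using fF by (simp add: W_def)
        show "W \<subseteq> span T" unfolding W_def T(3) using A(2) g0A by (auto simp: F_def intro: span_diff)
        show "\<bar>w \<bullet> \<nu>\<bar> \<le> \<epsilon> * s" if "w \<in> W" for w using est \<open>w \<in> W\<close> by (auto simp: W_def)
        show "norm w \<le> of_int m' * (\<epsilon> * s)" if "w \<in> W" for w using est \<open>w \<in> W\<close> by (auto simp: W_def)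
        show "real (card T) * (\<epsilon> * s) < norm (w - w')" if "w \<in> W" "w' \<in> W" "w \<noteq> w'" for w w'
        proof -
          obtain g g' where g: "g \<in> F" "g' \<in> F" "w = g - g0" "w' = g' - g0"
            using \<open>w \<in> W\<close> \<open>w' \<in> W\<close> by (auto simp: W_def)
          have "2 * real n * (\<epsilon> * s) \<le> norm (g - g')"
            unfolding n_def by (rule A(3)) (use g that in \<open>auto simp: F_def\<close>)
          moreover have "real n * (\<epsilon> * s) > 0" using n \<epsilon> s by simp
          ultimately show ?thesis by (simp add: cT g)
        qed
      qed
      then show ?thesis unfolding cW cT F_def .
    qed
  qed
  then show ?thesis unfolding cC by (simp add: m_def m'_def n_def)
qed simp

text \<open>If all b of norm below \<delta> were critical values, a grid of them with spacing
  proportional to \<epsilon> s would have about \<open>(\<epsilon> * s)\<close> to the power -n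
  points. The cells admit only a constant times \<open>s\<close> to the power -n times
  \<open>\<epsilon>\<close> to the power 1 - n. The quotient is of order \<epsilon>, a contradiction
  for small \<epsilon>.\<close>

theorem Sard_finite_dim:
  fixes G :: "'a::real_inner \<Rightarrow> 'a"
  assumes S: "orthonormal S" and K: "compact K" "convex K" "K \<subseteq> span S"
    and D: "\<And>z. z \<in> K \<Longrightarrow> (G has_derivative blinfun_apply (D z)) (at z within K)" "continuous_on K D"
    and \<delta>: "\<delta> > 0"
  obtains b where "b \<in> span S" "norm b < \<delta>"
    "\<And>z v. z \<in> K \<Longrightarrow> G z = b \<Longrightarrow> v \<in> span S \<Longrightarrow> v \<noteq> 0 \<Longrightarrow> blinfun_apply (D z) v \<noteq> 0"
proof (cases "S = {}")
  case True
  then show thesis using that[of 0] \<delta> by auto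
next
  case False
  note regular = that
  show thesis
  proof (rule ccontr)
    assume nthesis: "\<not> thesis"
    have crit: "\<exists>z\<in>K. G z = b \<and> (\<exists>v\<in>span S. v \<noteq> 0 \<and> D z v = 0)" if b: "b \<in> span S" "norm b < \<delta>" for b
      using nthesis regular[OF b] by blast
    define n where "n = card S"
    have n: "n > 0" using False orthonormal_finite[OF S] by (simp add: n_def card_gt_0_iff)
    obtain R where R: "R > 0" "\<And>z. z \<in> K \<Longrightarrow> norm z \<le> R"
      using compact_imp_bounded[OF K(1)] bounded_pos by metis
    obtain M where M: "M > 0" "\<And>z. z \<in> K \<Longrightarrow> norm (D z) \<le> M"
    proof -
      have "bounded (D ` K)" by (intro compact_imp_bounded compact_continuous_image D(2) K(1))
      then show ?thesis using that unfolding bounded_pos by blast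
    qed
    \<comment> \<open>After multiplication by the n-th power of \<epsilon> s, X is a lower bound for
      the number of grid points and Y \<epsilon> an upper bound for the count over cells. The
      summands 5 and 7 in Y absorb the rounding, as 3 is at most 5/s and 5/\<epsilon>. Then
      \<epsilon> is taken so small that Y \<epsilon> < X.\<close>
    define X where "X = (\<delta> / (8 * (real n)\<^sup>2)) ^ n"
    define Y where "Y = (2 * R * real n + 5) ^ n * (3 * (2 * M + 7) ^ (n - 1))"
    have X: "X > 0" using \<delta> n by (simp add: X_def)
    have Y: "Y > 0" using R(1) M(1) by (simp add: Y_def add_nonneg_pos)
    define \<epsilon> where "\<epsilon> = min 1 (X / (2 * Y))"
    have \<epsilon>: "0 < \<epsilon>" "\<epsilon> \<le> 1" "\<epsilon> \<le> X / (2 * Y)" using X Y by (auto simp: \<epsilon>_def)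
    have \<epsilon>Y: "Y * \<epsilon> < X"
    proof -
      have "Y * \<epsilon> \<le> Y * (X / (2 * Y))" using \<epsilon>(3) Y by (intro mult_left_mono) auto
      also have "\<dots> < X" using X Y by simp
      finally show ?thesis .
    qed
    obtain s0 where s0: "s0 > 0" "\<And>x y. x \<in> K \<Longrightarrow> y \<in> K \<Longrightarrow> norm (y - x) \<le> s0 \<Longrightarrow>
        norm (G y - G x - D x (y - x)) \<le> \<epsilon> * norm (y - x)"
      using uniform_linearization[OF K(1,2) D \<epsilon>(1)] by blast
    \<comment> \<open>The last bound makes q at least 1, so that an integer N lies between q and 2q;
      the bound 1 is used for rounding.\<close>
    define s where "s = min s0 (min 1 (\<delta> / (8 * (real n)\<^sup>2 * \<epsilon>)))"
    have s: "s > 0" "s \<le> s0" "s \<le> 1" "s \<le> \<delta> / (8 * (real n)\<^sup>2 * \<epsilon>)"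
      using s0 \<delta> n \<epsilon> by (auto simp: s_def)
    \<comment> \<open>With N at most 2q and spacing 2n \<epsilon> s the grid has radius at most
      \<delta>/2, so all its points are critical values.\<close>
    define q where "q = \<delta> / (8 * (real n)\<^sup>2 * (\<epsilon> * s))"
    have q1: "q \<ge> 1"
      using s(4) n \<epsilon> s(1) by (simp add: q_def field_simps)
    define N where "N = nat \<lfloor>2 * q\<rfloor>"
    have N: "q \<le> real N" "real N \<le> 2 * q" using q1 by (auto simp: N_def) linarith+
    have d: "2 * real n * (\<epsilon> * s) > 0" using n \<epsilon> s by simp
    obtain A where A: "finite A" "A \<subseteq> span S" "card A = N ^ n"
      "\<And>a. a \<in> A \<Longrightarrow> norm a \<le> real n * (real N * (2 * real n * (\<epsilon> * s)))"
      "\<And>a b. a \<in> A \<Longrightarrow> b \<in> A \<Longrightarrow> a \<noteq> b \<Longrightarrow> norm (a - b) \<ge> 2 * real n * (\<epsilon> * s)"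
      using separated_grid[OF S d, of N] unfolding n_def by blast
    have nA: "norm a < \<delta>" if "a \<in> A" for a
    proof -
      have "norm a \<le> real n * (real N * (2 * real n * (\<epsilon> * s)))" by (rule A(4)[OF that])
      also have "\<dots> \<le> real n * ((2 * q) * (2 * real n * (\<epsilon> * s)))"
        using N(2) d by (intro mult_left_mono mult_right_mono) auto
      also have "\<dots> = \<delta> / 2" using n \<epsilon> s by (simp add: q_def field_simps power2_eq_square)
      finally show ?thesis using \<delta> by simp
    qed
    have "card A \<le> (2 * nat \<lceil>R * card S / s\<rceil> + 1) ^ card S *
       (3 * (2 * nat \<lceil>(M + 1) / \<epsilon>\<rceil> + 1) ^ (card S - 1))"
    proof (rule critical_values_card_le[OF S False K(3), of R D M s G \<epsilon>])
      show "K \<subseteq> cball 0 R" using R by auto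
      show "norm (G y - G x - D x (y - x)) \<le> \<epsilon> * norm (y - x)" if "x \<in> K" "y \<in> K" "norm (y - x) \<le> s" for x y
        using s0(2)[OF that(1,2)] that(3) s(2) by simp
      show "\<exists>z\<in>K. G z = a \<and> (\<exists>v\<in>span S. v \<noteq> 0 \<and> D z v = 0)" if "a \<in> A" for a
        by (rule crit[OF subsetD[OF A(2) \<open>a \<in> A\<close>] nA[OF \<open>a \<in> A\<close>]])
      show "norm (a - b) \<ge> 2 * real (card S) * (\<epsilon> * s)" if "a \<in> A" "b \<in> A" "a \<noteq> b" for a b
        using A(5)[OF that] by (simp only: n_def)
    qed (fact M(2) \<epsilon> s(1) A(1,2))+
    then have card: "real N ^ n \<le> real (2 * nat \<lceil>R * real n / s\<rceil> + 1) ^ n *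
       (3 * real (2 * nat \<lceil>(M + 1) / \<epsilon>\<rceil> + 1) ^ (n - 1))"
      unfolding A(3) n_def[symmetric] of_nat_le_iff[where 'a=real, symmetric]
      by (simp only: of_nat_mult of_nat_power of_nat_numeral)
    have ceil: "real (2 * nat \<lceil>x\<rceil> + 1) \<le> 2 * x + 3" if "x \<ge> 0" for x :: real
    proof -
      have "real (nat \<lceil>x\<rceil>) \<le> x + 1" using that by linarith
      then show ?thesis unfolding of_nat_add of_nat_mult by simp
    qed
    have c1: "real (2 * nat \<lceil>R * real n / s\<rceil> + 1) \<le> (2 * R * real n + 5) / s"
    proof -
      have "real (2 * nat \<lceil>R * real n / s\<rceil> + 1) \<le> 2 * (R * real n / s) + 3"
        using R s by (intro ceil) simp
      moreover have "3 \<le> 5 / s" using s by (simp add: pos_le_divide_eq)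
      moreover have "2 * (R * real n / s) + 5 / s = (2 * R * real n + 5) / s"
        by (simp add: add_divide_distrib)
      ultimately show ?thesis by linarith
    qed
    have c2: "real (2 * nat \<lceil>(M + 1) / \<epsilon>\<rceil> + 1) \<le> (2 * M + 7) / \<epsilon>"
    proof -
      have "real (2 * nat \<lceil>(M + 1) / \<epsilon>\<rceil> + 1) \<le> 2 * ((M + 1) / \<epsilon>) + 3"
        using M \<epsilon> by (intro ceil) simp
      moreover have "3 \<le> 5 / \<epsilon>" using \<epsilon> by (simp add: pos_le_divide_eq)
      moreover have "2 * ((M + 1) / \<epsilon>) + 5 / \<epsilon> = (2 * M + 7) / \<epsilon>"
        by (simp add: add_divide_distrib[symmetric])
      ultimately show ?thesis by linarith
    qed
    have "q ^ n \<le> real N ^ n" using N(1) q1 by (intro power_mono) auto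
    also note card
    also have "real (2 * nat \<lceil>R * real n / s\<rceil> + 1) ^ n *
       (3 * real (2 * nat \<lceil>(M + 1) / \<epsilon>\<rceil> + 1) ^ (n - 1)) \<le>
       ((2 * R * real n + 5) / s) ^ n * (3 * ((2 * M + 7) / \<epsilon>) ^ (n - 1))"
      by (intro mult_mono power_mono c1 c2 of_nat_0_le_iff mult_nonneg_nonneg zero_le_power
          divide_nonneg_pos order_refl) (use R M s \<epsilon> in simp_all)
    finally have fin: "q ^ n \<le> ((2 * R * real n + 5) / s) ^ n * (3 * ((2 * M + 7) / \<epsilon>) ^ (n - 1))" .
    \<comment> \<open>Multiplying the count by the n-th power of \<epsilon> s cancels all powers of
      s and leaves exactly one factor \<epsilon>.\<close>
    have "X = q ^ n * (\<epsilon> * s) ^ n"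
      using n \<epsilon> s by (simp add: X_def q_def power_mult_distrib[symmetric])
    also have "\<dots> \<le> ((2 * R * real n + 5) / s) ^ n * (3 * ((2 * M + 7) / \<epsilon>) ^ (n - 1)) * (\<epsilon> * s) ^ n"
      using fin \<epsilon> s by (intro mult_right_mono) auto
    also have "\<dots> = Y * (\<epsilon> ^ n / \<epsilon> ^ (n - 1))"
      using s \<epsilon> by (simp add: Y_def power_mult_distrib power_divide)
    also have "\<epsilon> ^ n / \<epsilon> ^ (n - 1) = \<epsilon>"
      using n \<epsilon> by (cases n) auto
    finally show False using \<epsilon>Y by simp
  qed
qed

subsection \<open>Localized linear perturbations\<close>

text \<open>At 0 the difference quotient is at most the power n - 1 of |h|, which tends to 0 as n is
  at least 2. Cubes of the positive part are therefore twice continuously differentiable.\<close>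

lemma DERIV_max_power:
  fixes x :: real
  assumes "n \<ge> 2"
  shows "((\<lambda>x. max 0 x ^ n) has_real_derivative real n * max 0 x ^ (n - 1)) (at x)"
proof -
  consider "x < 0" | "x = 0" | "x > 0" by linarith
  then show ?thesis
  proof cases
    case 1
    have "((\<lambda>x. 0 :: real) has_real_derivative real n * max 0 x ^ (n - 1)) (at x)"
      using 1 assms by (simp add: power_0_left)
    then show ?thesis
      by (rule has_field_derivative_transform_within_open[where S="{..<0}"])
         (use 1 assms in \<open>auto simp: power_0_left max_def\<close>)
  next
    case 2
    have "((\<lambda>h. (max 0 (0 + h) ^ n - max 0 0 ^ n) / h) \<longlongrightarrow> 0) (at (0::real))"
    proof (rule Lim_null_comparison)
      show "\<forall>\<^sub>F h in at 0. norm ((max 0 (0 + h) ^ n - max 0 0 ^ n) / h) \<le> \<bar>h\<bar> ^ (n - 1)"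
      proof (rule always_eventually, rule allI)
        fix h :: real
        obtain k where k: "n = Suc (Suc k)" using assms by (metis add_2_eq_Suc le_Suc_ex)
        show "norm ((max 0 (0 + h) ^ n - max 0 0 ^ n) / h) \<le> \<bar>h\<bar> ^ (n - 1)"
        proof (cases "h > 0")
          case True
          then show ?thesis by (simp add: k max_def)
        next
          case False
          then have "max 0 (0 + h) = 0" by simp
          then show ?thesis by simp
        qed
      qed
      have "((\<lambda>h. \<bar>h\<bar> ^ (n - 1)) \<longlongrightarrow> \<bar>0\<bar> ^ (n - 1)) (at (0::real))"
        by (intro tendsto_intros)
      then show "((\<lambda>h. \<bar>h\<bar> ^ (n - 1)) \<longlongrightarrow> 0) (at (0::real))" using assms by (simp add: power_0_left)
    qed
    then show ?thesis using 2 assms unfolding DERIV_def by (simp add: power_0_left)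
  next
    case 3
    have "((\<lambda>x. x ^ n) has_real_derivative real n * max 0 x ^ (n - 1)) (at x)"
      using 3 by (auto intro!: derivative_eq_intros simp: max_def)
    then show ?thesis
      by (rule has_field_derivative_transform_within_open[where S="{0<..}"])
         (use 3 in \<open>auto simp: max_def\<close>)
  qed
qed

lemma bounded_if_eventually_constant:
  fixes f :: "real \<Rightarrow> real"
  assumes "continuous_on UNIV f" "\<And>s. s \<le> a \<Longrightarrow> f s = f a" "\<And>s. s \<ge> c \<Longrightarrow> f s = f c"
  obtains M where "\<And>s. \<bar>f s\<bar> \<le> M"
proof -
  have "bounded (f ` {a..c})"
    by (intro compact_imp_bounded compact_continuous_image continuous_on_subset[OF assms(1)]) auto
  then obtain M where "\<forall>y\<in>f ` {a..c}. norm y \<le> M" unfolding bounded_iff by blast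
  then have M: "\<bar>f s\<bar> \<le> M" if "s \<in> {a..c}" for s using that by simp
  have "\<bar>f s\<bar> \<le> max M (max \<bar>f a\<bar> \<bar>f c\<bar>)" for s
  proof -
    consider "s \<le> a" | "s \<ge> c" | "s \<in> {a..c}" by fastforce
    then show ?thesis
    proof cases
      case 1 then show ?thesis using assms(2)[of s] by simp
    next
      case 2 then show ?thesis using assms(3)[of s] by simp
    next
      case 3 then show ?thesis using M[of s] by simp
    qed
  qed
  then show thesis by (rule that)
qed

text \<open>With p the cube of the positive part and \<sigma> the affine map sending a to 0 and c to
  1, take p (1 - p (\<sigma> s)). Left of a the inner p is 0 and the value is p 1 = 1; right of c
  the inner p is at least 1 and the outer argument is nonpositive.\<close>

lemma cutoff_function:
  fixes a c :: real
  assumes ac: "a < c"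
  obtains \<tau> \<tau>' \<tau>'' :: "real \<Rightarrow> real" and M where
    "\<And>s. (\<tau> has_real_derivative \<tau>' s) (at s)" "\<And>s. (\<tau>' has_real_derivative \<tau>'' s) (at s)"
    "continuous_on UNIV \<tau>''"
    "\<And>s. s \<le> a \<Longrightarrow> \<tau> s = 1 \<and> \<tau>' s = 0 \<and> \<tau>'' s = 0"
    "\<And>s. s \<ge> c \<Longrightarrow> \<tau> s = 0 \<and> \<tau>' s = 0 \<and> \<tau>'' s = 0"
    "M > 0" "\<And>s. \<bar>\<tau> s\<bar> \<le> M \<and> \<bar>\<tau>' s\<bar> \<le> M \<and> \<bar>\<tau>'' s\<bar> \<le> M"
proof -
  define p p' p'' :: "real \<Rightarrow> real"
    where "p = (\<lambda>x. max 0 x ^ 3)" and "p' = (\<lambda>x. 3 * max 0 x ^ 2)" and "p'' = (\<lambda>x. 6 * max 0 x)"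
  have dp: "(p has_real_derivative p' x) (at x)" for x
    using DERIV_max_power[of 3 x] by (simp add: p_def p'_def)
  have dp': "(p' has_real_derivative p'' x) (at x)" for x
    using DERIV_cmult[OF DERIV_max_power[of 2 x], of 3] by (simp add: p'_def p''_def)
  have p0: "p x = 0" "p' x = 0" "p'' x = 0" if "x \<le> 0" for x
    using that by (simp_all add: p_def p'_def p''_def max_def)
  have p1: "p x \<ge> 1" if "x \<ge> 1" for x
    using that by (simp add: p_def max_def one_le_power)
  define j where "j = 1 / (c - a)"
  define \<sigma> where "\<sigma> s = (s - a) * j" for s
  define \<tau> where "\<tau> s = p (1 - p (\<sigma> s))" for s
  define \<tau>' where "\<tau>' s = p' (1 - p (\<sigma> s)) * (- (p' (\<sigma> s) * j))" for s
  define \<tau>'' where "\<tau>'' s = p'' (1 - p (\<sigma> s)) * (- (p' (\<sigma> s) * j)) * (- (p' (\<sigma> s) * j))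
      + - (p'' (\<sigma> s) * j * j) * p' (1 - p (\<sigma> s))" for s
  have j: "j > 0" using ac by (simp add: j_def)
  have d\<sigma>: "(\<sigma> has_real_derivative j) (at s)" for s
    unfolding \<sigma>_def by (auto intro!: derivative_eq_intros)
  have dp\<sigma>: "((\<lambda>s. p (\<sigma> s)) has_real_derivative p' (\<sigma> s) * j) (at s)" for s
    by (rule DERIV_chain2[OF dp d\<sigma>])
  have dp'\<sigma>: "((\<lambda>s. p' (\<sigma> s)) has_real_derivative p'' (\<sigma> s) * j) (at s)" for s
    by (rule DERIV_chain2[OF dp' d\<sigma>])
  have din: "((\<lambda>s. 1 - p (\<sigma> s)) has_real_derivative - (p' (\<sigma> s) * j)) (at s)" for s
    using DERIV_diff[OF DERIV_const dp\<sigma>, of 1 s] by simp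
  have d1: "(\<tau> has_real_derivative \<tau>' s) (at s)" for s
    unfolding \<tau>_def \<tau>'_def by (rule DERIV_chain2[OF dp din])
  have d2: "(\<tau>' has_real_derivative \<tau>'' s) (at s)" for s
    unfolding \<tau>'_def \<tau>''_def
    by (rule DERIV_mult[OF DERIV_chain2[OF dp' din] DERIV_minus[OF DERIV_cmult_right[OF dp'\<sigma>]]])
  have cp: "continuous_on UNIV p" "continuous_on UNIV p'" "continuous_on UNIV p''"
    unfolding p_def p'_def p''_def by (intro continuous_intros)+
  have c\<sigma>: "continuous_on UNIV \<sigma>" unfolding \<sigma>_def by (intro continuous_intros)
  have cc: "continuous_on UNIV (\<lambda>s. f (\<sigma> s))" "continuous_on UNIV (\<lambda>s. f (1 - p (\<sigma> s)))"
    if "continuous_on UNIV f" for f :: "real \<Rightarrow> real"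
  proof -
    show 1: "continuous_on UNIV (\<lambda>s. f (\<sigma> s))"
      by (rule continuous_on_compose2[OF that c\<sigma>]) simp
    have "continuous_on UNIV (\<lambda>s. 1 - p (\<sigma> s))"
      by (intro continuous_intros continuous_on_compose2[OF cp(1) c\<sigma>]) simp
    then show "continuous_on UNIV (\<lambda>s. f (1 - p (\<sigma> s)))"
      by (rule continuous_on_compose2[OF that]) simp
  qed
  have cont: "continuous_on UNIV \<tau>" "continuous_on UNIV \<tau>'" "continuous_on UNIV \<tau>''"
    unfolding \<tau>_def[abs_def] \<tau>'_def[abs_def] \<tau>''_def[abs_def]
    by (intro continuous_intros cc(1)[OF cp(2)] cc(1)[OF cp(3)] cc(2)[OF cp(1)] cc(2)[OF cp(2)] cc(2)[OF cp(3)])+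
  have low: "\<tau> s = 1 \<and> \<tau>' s = 0 \<and> \<tau>'' s = 0" if "s \<le> a" for s
  proof -
    have "\<sigma> s \<le> 0" using that j by (simp add: \<sigma>_def mult_nonpos_nonneg)
    then have "p (\<sigma> s) = 0" "p' (\<sigma> s) = 0" "p'' (\<sigma> s) = 0" by (rule p0)+
    moreover have "p 1 = 1" by (simp add: p_def)
    ultimately show ?thesis by (simp add: \<tau>_def \<tau>'_def \<tau>''_def)
  qed
  have high: "\<tau> s = 0 \<and> \<tau>' s = 0 \<and> \<tau>'' s = 0" if "s \<ge> c" for s
  proof -
    have "1 = (c - a) * j" using ac by (simp add: j_def)
    also have "\<dots> \<le> \<sigma> s" unfolding \<sigma>_def using that j by (intro mult_right_mono) auto
    finally have "1 - p (\<sigma> s) \<le> 0" using p1[of "\<sigma> s"] by simp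
    then have "p (1 - p (\<sigma> s)) = 0" "p' (1 - p (\<sigma> s)) = 0" "p'' (1 - p (\<sigma> s)) = 0" by (rule p0)+
    then show ?thesis by (simp add: \<tau>_def \<tau>'_def \<tau>''_def)
  qed
  obtain M0 where M0: "\<And>s. \<bar>\<tau> s\<bar> \<le> M0"
    using bounded_if_eventually_constant[OF cont(1), of a c] low high by (metis order_refl)
  obtain M1 where M1: "\<And>s. \<bar>\<tau>' s\<bar> \<le> M1"
    using bounded_if_eventually_constant[OF cont(2), of a c] low high by (metis order_refl)
  obtain M2 where M2: "\<And>s. \<bar>\<tau>'' s\<bar> \<le> M2"
    using bounded_if_eventually_constant[OF cont(3), of a c] low high by (metis order_refl)
  define M where "M = max 1 (max M0 (max M1 M2))"
  have "\<bar>\<tau> s\<bar> \<le> M \<and> \<bar>\<tau>' s\<bar> \<le> M \<and> \<bar>\<tau>'' s\<bar> \<le> M" for s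
    using M0[of s] M1[of s] M2[of s] by (auto simp: M_def)
  then show thesis using that[OF d1 d2 cont(3) low high, of M] by (auto simp: M_def)
qed

section \<open>The cut-off linear functional with its gradient and Hessian\<close>

definition rank_one :: "'a::real_inner \<Rightarrow> 'a \<Rightarrow> 'a \<Rightarrow>\<^sub>L 'a" where
  "rank_one x y = blinfun_scaleR_left x o\<^sub>L blinfun_inner_left y"

lemma rank_one_apply [simp]: "blinfun_apply (rank_one x y) v = (v \<bullet> y) *\<^sub>R x"
  by (simp add: rank_one_def)

lemma continuous_on_rank_one:
  assumes "continuous_on A f" "continuous_on A g"
  shows "continuous_on A (\<lambda>u. rank_one (f u) (g u))"
  unfolding rank_one_def
  by (intro bounded_bilinear.continuous_on[OF bounded_bilinear_blinfun_compose]
      bounded_linear.continuous_on[OF bounded_linear_blinfun_scaleR_left]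
      bounded_linear.continuous_on[OF bounded_linear_blinfun_inner_left] assms)

lemma norm_rank_one_le: "norm (rank_one x y) \<le> norm x * norm y"
proof (rule norm_blinfun_bound)
  fix v
  have "\<bar>v \<bullet> y\<bar> * norm x \<le> (norm v * norm y) * norm x"
    by (intro mult_right_mono Cauchy_Schwarz_ineq2) simp
  then show "norm (rank_one x y v) \<le> norm x * norm y * norm v" by (simp add: mult_ac)
qed simp

definition localized_perturbation ::
  "'a::real_inner \<Rightarrow> real \<Rightarrow> 'a \<Rightarrow> real \<Rightarrow> ('a \<Rightarrow> real) \<Rightarrow> ('a \<Rightarrow> 'a) \<Rightarrow> ('a \<Rightarrow> 'a \<Rightarrow>\<^sub>L 'a) \<Rightarrow> bool" where
  "localized_perturbation u\<^sub>0 \<rho> b \<beta> \<eta> k K \<longleftrightarrow>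
     (\<forall>u. GDERIV \<eta> u :> k u) \<and> (\<forall>u. (k has_derivative blinfun_apply (K u)) (at u)) \<and>
     continuous_on UNIV K \<and> (\<forall>u. selfadjoint (K u)) \<and>
     (\<forall>u. norm (u - u\<^sub>0) \<le> \<rho> / 2 \<longrightarrow> k u = b \<and> K u = 0) \<and>
     (\<forall>u. norm (u - u\<^sub>0) \<ge> \<rho> \<longrightarrow> \<eta> u = 0 \<and> k u = 0 \<and> K u = 0) \<and>
     (\<forall>u. \<bar>\<eta> u\<bar> \<le> \<beta> \<and> norm (k u) \<le> \<beta> \<and> norm (K u) \<le> \<beta>)"

text \<open>The factor M depends on \<rho> but not on b. This order of quantifiers allows b to be
  picked by Sard's theorem after all bounds are fixed.\<close>

lemma localized_linear_functional:
  fixes u\<^sub>0 :: "'a::{real_inner,complete_space}"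
  assumes \<rho>: "\<rho> > 0"
  obtains M where "M > 0"
    "\<And>b. \<exists>\<eta> k K. localized_perturbation u\<^sub>0 \<rho> b (M * norm b) \<eta> k K"
proof -
  have "(\<rho> / 2)\<^sup>2 < \<rho>\<^sup>2" using \<rho> by (intro power_strict_mono) auto
  then obtain \<tau> \<tau>' \<tau>'' :: "real \<Rightarrow> real" and N where
    d: "\<And>s. (\<tau> has_real_derivative \<tau>' s) (at s)" "\<And>s. (\<tau>' has_real_derivative \<tau>'' s) (at s)"
    and cont: "continuous_on UNIV \<tau>''"
    and low: "\<And>s. s \<le> (\<rho> / 2)\<^sup>2 \<Longrightarrow> \<tau> s = 1 \<and> \<tau>' s = 0 \<and> \<tau>'' s = 0"
    and high: "\<And>s. s \<ge> \<rho>\<^sup>2 \<Longrightarrow> \<tau> s = 0 \<and> \<tau>' s = 0 \<and> \<tau>'' s = 0"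
    and N: "N > 0" "\<And>s. \<bar>\<tau> s\<bar> \<le> N \<and> \<bar>\<tau>' s\<bar> \<le> N \<and> \<bar>\<tau>'' s\<bar> \<le> N"
    by (rule cutoff_function) blast
  have cont': "continuous_on UNIV \<tau>" "continuous_on UNIV \<tau>'"
    by (intro continuous_at_imp_continuous_on ballI DERIV_isCont[OF d(1)] DERIV_isCont[OF d(2)])+
  \<comment> \<open>The squared distance is smooth also at the center, so the cutoff is applied to
    it, with the squares of \<rho>/2 and \<rho> as thresholds.\<close>
  define q where "q u = (u - u\<^sub>0) \<bullet> (u - u\<^sub>0)" for u
  have dq: "(q has_derivative (\<lambda>v. 2 * ((u - u\<^sub>0) \<bullet> v))) (at u)" for u
    unfolding q_def
    by (rule has_derivative_eq_rhs, (rule derivative_intros)+) (auto simp: inner_commute fun_eq_iff)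
  have dcomp: "((\<lambda>u. f (q u)) has_derivative (\<lambda>v. 2 * ((u - u\<^sub>0) \<bullet> v) * f')) (at u)"
    if "(f has_real_derivative f') (at (q u))" for f f' u
    by (rule has_derivative_eq_rhs[OF has_derivative_compose[OF dq that[unfolded has_field_derivative_def]]])
       (simp add: fun_eq_iff)
  have dlin: "((\<lambda>u. b \<bullet> (u - u\<^sub>0)) has_derivative (\<lambda>v. b \<bullet> v)) (at u)" for b u
    by (rule has_derivative_eq_rhs, (rule derivative_intros)+) (auto simp: fun_eq_iff)
  \<comment> \<open>Dominates the three factors found below: \<rho> for \<eta>,
    \<open>1 + 2 * \<rho>\<^sup>2\<close> for its gradient and
    \<open>6 * \<rho> + 4 * \<rho> ^ 3\<close> for its Hessian.\<close>
  define C where "C = 1 + 7 * \<rho> + 2 * \<rho>\<^sup>2 + 4 * \<rho> ^ 3"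
  have C: "C > 0" using \<rho> by (simp add: C_def add_pos_nonneg add_pos_pos)
  show thesis
  proof (rule that[of "N * C"])
    show "N * C > 0" using N(1) C by simp
    fix b :: 'a
    define \<eta> where "\<eta> u = \<tau> (q u) * (b \<bullet> (u - u\<^sub>0))" for u
    define k where "k u = \<tau> (q u) *\<^sub>R b + (\<tau>' (q u) * (b \<bullet> (u - u\<^sub>0))) *\<^sub>R (2 *\<^sub>R (u - u\<^sub>0))" for u
    \<comment> \<open>The first and third terms are adjoint to each other, the other two are
      self-adjoint. The multiple of the identity is not compact in infinite dimension, so
      \<open>K\<close> will be added to \<open>P\<close> and not to \<open>Q\<close>.\<close>
    define K where "K u = (2 * \<tau>' (q u)) *\<^sub>R rank_one b (u - u\<^sub>0)
      + (4 * \<tau>'' (q u) * (b \<bullet> (u - u\<^sub>0))) *\<^sub>R rank_one (u - u\<^sub>0) (u - u\<^sub>0)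
      + (2 * \<tau>' (q u)) *\<^sub>R rank_one (u - u\<^sub>0) b
      + (2 * \<tau>' (q u) * (b \<bullet> (u - u\<^sub>0))) *\<^sub>R id_blinfun" for u
    have 1: "GDERIV \<eta> u :> k u" for u
      unfolding gderiv_def \<eta>_def
      by (rule has_derivative_eq_rhs[OF has_derivative_mult[OF dcomp[OF d(1)] dlin]])
         (simp add: fun_eq_iff k_def inner_add_right inner_commute mult_ac)
    have dsub: "((\<lambda>u. 2 *\<^sub>R (u - u\<^sub>0)) has_derivative (\<lambda>v. 2 *\<^sub>R v)) (at u)" for u :: 'a
      by (auto intro!: derivative_eq_intros)
    have 2: "(k has_derivative blinfun_apply (K u)) (at u)" for u
      unfolding k_def
      by (rule has_derivative_eq_rhs[OF has_derivative_add[OF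
            has_derivative_scaleR_left[OF dcomp[OF d(1)]]
            has_derivative_scaleR[OF has_derivative_mult[OF dcomp[OF d(2)] dlin] dsub]]])
         (simp add: fun_eq_iff K_def blinfun.add_left blinfun.scaleR_left inner_commute scaleR_add_left mult_ac)
    have cq: "continuous_on UNIV q" unfolding q_def by (intro continuous_intros)
    have 3: "continuous_on UNIV K"
      unfolding K_def
      by (intro continuous_intros continuous_on_rank_one continuous_on_compose2[OF cont'(2) cq]
          continuous_on_compose2[OF cont cq]) auto
    have 4: "selfadjoint (K u)" for u
    proof -
      have Kvw: "K u v \<bullet> w = 2 * \<tau>' (q u) * ((v \<bullet> (u - u\<^sub>0)) * (b \<bullet> w))
          + 4 * \<tau>'' (q u) * (b \<bullet> (u - u\<^sub>0)) * ((v \<bullet> (u - u\<^sub>0)) * ((u - u\<^sub>0) \<bullet> w))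
          + 2 * \<tau>' (q u) * ((v \<bullet> b) * ((u - u\<^sub>0) \<bullet> w))
          + 2 * \<tau>' (q u) * (b \<bullet> (u - u\<^sub>0)) * (v \<bullet> w)" for v w
        by (simp add: K_def blinfun.add_left blinfun.scaleR_left inner_add_left)
      show ?thesis
        unfolding selfadjoint_def inner_commute[of _ "blinfun_apply (K u) _"] Kvw
        by (simp add: inner_commute mult_ac)
    qed
    have 5: "k u = b \<and> K u = 0" if "norm (u - u\<^sub>0) \<le> \<rho> / 2" for u
    proof -
      have "q u \<le> (\<rho> / 2)\<^sup>2" unfolding q_def power2_norm_eq_inner[symmetric] using that by (intro power_mono) auto
      from low[OF this] show ?thesis by (simp add: k_def K_def)
    qed
    have 6: "\<eta> u = 0 \<and> k u = 0 \<and> K u = 0" if "norm (u - u\<^sub>0) \<ge> \<rho>" for u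
    proof -
      have "\<rho>\<^sup>2 \<le> q u" unfolding q_def power2_norm_eq_inner[symmetric] using that \<rho> by (intro power_mono) auto
      from high[OF this] show ?thesis by (simp add: \<eta>_def k_def K_def)
    qed
    have 7: "\<bar>\<eta> u\<bar> \<le> N * C * norm b \<and> norm (k u) \<le> N * C * norm b \<and> norm (K u) \<le> N * C * norm b" for u
    proof (cases "norm (u - u\<^sub>0) \<ge> \<rho>")
      case True
      from 6[OF this] show ?thesis using N(1) C by simp
    next
      case False
      define h where "h = u - u\<^sub>0"
      have h: "norm h \<le> \<rho>" using False by (simp add: h_def)
      define t t' t'' where "t = \<tau> (q u)" and "t' = \<tau>' (q u)" and "t'' = \<tau>'' (q u)"
      have t: "\<bar>t\<bar> \<le> N" "\<bar>t'\<bar> \<le> N" "\<bar>t''\<bar> \<le> N" using N(2) by (auto simp: t_def t'_def t''_def)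
      have bh: "\<bar>b \<bullet> h\<bar> \<le> norm b * \<rho>"
        using Cauchy_Schwarz_ineq2[of b h] mult_left_mono[OF h norm_ge_zero[of b]] by linarith
      have Nb: "0 \<le> N * norm b" using N(1) by simp
      have tb: "\<bar>s\<bar> * \<bar>b \<bullet> h\<bar> \<le> N * (norm b * \<rho>)" if "\<bar>s\<bar> \<le> N" for s
        using that bh N(1) by (intro mult_mono) auto
      have "\<bar>\<eta> u\<bar> = \<bar>t\<bar> * \<bar>b \<bullet> h\<bar>" by (simp add: \<eta>_def t_def h_def abs_mult)
      also have "\<dots> \<le> N * norm b * \<rho>" using tb[OF t(1)] by (simp add: mult_ac)
      also have "\<dots> \<le> N * norm b * C" using Nb \<rho> by (intro mult_left_mono) (auto simp: C_def)
      finally have a: "\<bar>\<eta> u\<bar> \<le> N * C * norm b" by (simp add: mult_ac)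
      have "norm (k u) \<le> norm (t *\<^sub>R b) + norm ((t' * (b \<bullet> h)) *\<^sub>R (2 *\<^sub>R h))"
        unfolding k_def t_def t'_def h_def by (rule norm_triangle_ineq)
      also have "\<dots> = \<bar>t\<bar> * norm b + (\<bar>t'\<bar> * \<bar>b \<bullet> h\<bar>) * (2 * norm h)"
        by (simp add: abs_mult)
      also have "\<dots> \<le> N * norm b + (N * (norm b * \<rho>)) * (2 * \<rho>)"
        using t h N(1) \<rho> by (intro add_mono mult_mono tb) auto
      also have "\<dots> = N * norm b * (1 + 2 * \<rho>\<^sup>2)" by (simp add: algebra_simps power2_eq_square)
      also have "\<dots> \<le> N * norm b * C" using Nb \<rho> by (intro mult_left_mono) (auto simp: C_def)
      finally have b: "norm (k u) \<le> N * C * norm b" by (simp add: mult_ac)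
      have r1: "norm (rank_one b h) \<le> norm b * \<rho>" "norm (rank_one h b) \<le> norm b * \<rho>"
        using norm_rank_one_le[of b h] norm_rank_one_le[of h b] mult_left_mono[OF h norm_ge_zero[of b]]
        by (simp_all add: mult.commute)
      have r2: "norm (rank_one h h) \<le> \<rho> * \<rho>"
        using norm_rank_one_le[of h h] mult_mono[OF h h] \<rho> by (auto intro: order_trans)
      have "norm (K u) \<le> norm ((2 * t') *\<^sub>R rank_one b h) + norm ((4 * t'' * (b \<bullet> h)) *\<^sub>R rank_one h h)
          + norm ((2 * t') *\<^sub>R rank_one h b) + norm ((2 * t' * (b \<bullet> h)) *\<^sub>R (id_blinfun :: 'a \<Rightarrow>\<^sub>L 'a))"
        unfolding K_def t'_def t''_def h_def by (intro norm_triangle_mono order_refl)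
      also have "\<dots> = 2 * \<bar>t'\<bar> * norm (rank_one b h) + 4 * (\<bar>t''\<bar> * \<bar>b \<bullet> h\<bar>) * norm (rank_one h h)
          + 2 * \<bar>t'\<bar> * norm (rank_one h b) + 2 * (\<bar>t'\<bar> * \<bar>b \<bullet> h\<bar>) * norm (id_blinfun :: 'a \<Rightarrow>\<^sub>L 'a)"
        by (simp add: abs_mult)
      also have "\<dots> \<le> 2 * N * (norm b * \<rho>) + 4 * (N * (norm b * \<rho>)) * (\<rho> * \<rho>)
          + 2 * N * (norm b * \<rho>) + 2 * (N * (norm b * \<rho>)) * 1"
        using t N(1) \<rho> by (intro add_mono mult_mono tb r1 r2 norm_blinfun_id_le) auto
      also have "\<dots> = N * norm b * (6 * \<rho> + 4 * \<rho> ^ 3)" by (simp add: algebra_simps power3_eq_cube)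
      also have "\<dots> \<le> N * norm b * C" using Nb \<rho> by (intro mult_left_mono) (auto simp: C_def)
      finally have "norm (K u) \<le> N * C * norm b" by (simp add: mult_ac)
      with a b show ?thesis by simp
    qed
    show "\<exists>\<eta> k K. localized_perturbation u\<^sub>0 \<rho> b (N * C * norm b) \<eta> k K"
      unfolding localized_perturbation_def using 1 2 3 4 5 6 7
      by (intro exI[of _ \<eta>] exI[of _ k] exI[of _ K] conjI allI impI) simp_all
  qed
qed

subsection \<open>Perturbed functionals\<close>

text \<open>At an accumulation point x of the fiber, the normalized differences subconverge to a
  unit vector of the span, by compactness. The derivative at x kills it, contrary to
  regularity.\<close>

lemma finite_regular_fiber:
  fixes G :: "'a::real_inner \<Rightarrow> 'b::real_normed_vector"
  assumes S: "orthonormal S" and K: "compact K" "K \<subseteq> span S"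
    and D: "\<And>z. z \<in> K \<Longrightarrow> (G has_derivative blinfun_apply (D z)) (at z within K)"
    and reg: "\<And>z v. z \<in> K \<Longrightarrow> G z = b \<Longrightarrow> v \<in> span S \<Longrightarrow> v \<noteq> 0 \<Longrightarrow> blinfun_apply (D z) v \<noteq> 0"
  shows "finite {z \<in> K. G z = b}"
proof (rule ccontr)
  define Z where "Z = {z \<in> K. G z = b}"
  assume "infinite {z \<in> K. G z = b}"
  then obtain x where x: "x \<in> K" "x islimpt Z"
    using K(1) unfolding compact_eq_Bolzano_Weierstrass Z_def by (metis (no_types, lifting) mem_Collect_eq subsetI)
  then obtain z where z: "\<And>n. z n \<in> Z - {x}" "z \<longlonglongrightarrow> x" unfolding islimpt_sequential by blast
  have zK: "z n \<in> K" "G (z n) = b" "z n \<noteq> x" for n using z(1)[of n] by (auto simp: Z_def)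
  have flt: "filterlim z (at x within K) sequentially"
    unfolding filterlim_at using z(2) zK by (auto intro: always_eventually)
  have "(G \<longlongrightarrow> G x) (at x within K)"
    using has_derivative_continuous[OF D[OF x(1)]] by (simp add: continuous_within)
  then have "(\<lambda>n. G (z n)) \<longlonglongrightarrow> G x" using flt by (rule filterlim_compose)
  then have Gx: "G x = b" unfolding zK(2) by (simp add: LIMSEQ_const_iff)
  define v where "v n = (z n - x) /\<^sub>R norm (z n - x)" for n
  have v: "v n \<in> span S \<inter> cball 0 1" "norm (v n) = 1" for n
    using zK(1,3)[of n] x(1) K(2) by (auto simp: v_def intro!: span_scale span_diff)
  obtain w s where w: "w \<in> span S \<inter> cball 0 1" "strict_mono s" "(v \<circ> s) \<longlonglongrightarrow> w"
    using seq_compactE[OF compact_imp_seq_compact[OF compact_span_cball[OF S, of 1]], of v] v(1) by blast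
  have nw: "norm w = 1" using tendsto_norm[OF w(3)] by (simp add: v(2) LIMSEQ_const_iff)
  have "((\<lambda>y. (1 / norm (y - x)) *\<^sub>R (G y - (G x + D x (y - x)))) \<longlongrightarrow> 0) (at x within K)"
    using D[OF x(1)] unfolding has_derivative_within by blast
  then have "(\<lambda>n. (1 / norm (z n - x)) *\<^sub>R (G (z n) - (G x + D x (z n - x)))) \<longlonglongrightarrow> 0"
    using flt by (rule filterlim_compose)
  moreover have "(1 / norm (z n - x)) *\<^sub>R (G (z n) - (G x + D x (z n - x))) = - D x (v n)" for n
    by (simp add: zK(2) Gx v_def blinfun.scaleR_right divide_inverse)
  ultimately have "(\<lambda>n. - D x (v n)) \<longlonglongrightarrow> 0" by simp
  then have "(\<lambda>n. - D x ((v \<circ> s) n)) \<longlonglongrightarrow> 0"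
    using LIMSEQ_subseq_LIMSEQ[OF _ w(2)] by (fastforce simp: o_def)
  moreover have "(\<lambda>n. - D x ((v \<circ> s) n)) \<longlonglongrightarrow> - D x w"
    by (intro tendsto_minus blinfun.tendsto tendsto_const w(3))
  ultimately have "D x w = 0" using LIMSEQ_unique by fastforce
  moreover have "w \<noteq> 0" using nw by auto
  ultimately show False using reg[OF x(1) Gx, of w] w(1) by blast
qed

text \<open>A derivative within a relatively open part of a subspace is determined only in
  directions of the subspace; restricting to a line in such a direction reduces the claim to one
  variable.\<close>

lemma has_derivative_zero_along_subspace:
  fixes f :: "'a::real_inner \<Rightarrow> real"
  assumes f: "(f has_derivative f') (at z within E \<inter> ball 0 e)"
    and E: "subspace E" "v \<in> E" "z \<in> E \<inter> ball 0 e"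
    and zero: "\<And>x. x \<in> E \<inter> ball 0 e \<Longrightarrow> f x = 0"
  shows "f' v = 0"
proof -
  define g where "g t = z + t *\<^sub>R v" for t :: real
  define s where "s = g -` ball 0 e"
  have os: "open s" unfolding s_def g_def by (intro open_vimage open_ball continuous_intros)
  have 0: "0 \<in> s" using E by (simp add: s_def g_def)
  have gs: "g ` s \<subseteq> E \<inter> ball 0 e"
    using E by (auto simp: s_def g_def subspace_add subspace_scale)
  have "(g has_derivative (\<lambda>t. t *\<^sub>R v)) (at 0 within s)"
    unfolding g_def by (auto intro!: derivative_eq_intros)
  moreover have "(f has_derivative f') (at (g 0) within g ` s)"
    using has_derivative_subset[OF f gs] by (simp add: g_def)
  ultimately have "((\<lambda>t. f (g t)) has_derivative (\<lambda>t. f' (t *\<^sub>R v))) (at 0 within s)"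
    by (rule has_derivative_in_compose)
  then have "((\<lambda>t. f (g t)) has_derivative (\<lambda>t. f' (t *\<^sub>R v))) (at 0)"
    by (simp add: at_within_open[OF 0 os])
  then have "((\<lambda>t. 0) has_derivative (\<lambda>t. f' (t *\<^sub>R v))) (at (0::real))"
    by (rule has_derivative_transform_within_open[OF _ os 0]) (use gs zero in blast)
  then have "(\<lambda>t::real. f' (t *\<^sub>R v)) = (\<lambda>t. 0)"
    using has_derivative_const has_derivative_unique by blast
  from fun_cong[OF this, of 1] show ?thesis by simp
qed

section \<open>Criticality and the Palais-Smale condition in terms of gradients\<close>

lemma orth_proj_span:
  assumes T: "orthonormal T"
  shows "orth_proj (span T) x = proj T x"
  unfolding orth_proj_def
proof (rule the_equality)
  show "proj T x \<in> span T \<and> x - proj T x \<in> orthogonal_comp (span T)"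
    using diff_proj_orthogonal[OF T, of _ x] proj_in_span
    by (auto simp: orthogonal_comp_def orthogonal_def inner_commute)
  fix y assume y: "y \<in> span T \<and> x - y \<in> orthogonal_comp (span T)"
  define d where "d = y - proj T x"
  have dT: "d \<in> span T" unfolding d_def using y proj_in_span by (intro span_diff) auto
  have 1: "(x - proj T x) \<bullet> d = 0" by (rule diff_proj_orthogonal[OF T dT])
  have 2: "d \<bullet> (x - y) = 0" using y dT by (auto simp: orthogonal_comp_def orthogonal_def)
  have "d \<bullet> d = (x - proj T x) \<bullet> d - d \<bullet> (x - y)"
    by (simp add: d_def inner_diff_left inner_diff_right inner_commute)
  then have "d = 0" using 1 2 by simp
  then show "y = proj T x" by (simp add: d_def)
qed

lemma orthogonal_comp_span: "w \<in> orthogonal_comp (span T) \<Longrightarrow> f \<in> T \<Longrightarrow> w \<bullet> f = 0"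
  using span_base[of f T] by (auto simp: orthogonal_comp_def orthogonal_def inner_commute)

lemma deriv_at_zero_iff: "GDERIV f u :> g \<Longrightarrow> deriv_at f u = 0 \<longleftrightarrow> g = 0"
  by (metis deriv_at_gderiv norm_blinfun_inner_left norm_eq_zero)

lemma critical_points_gderiv:
  assumes "\<And>u. u \<in> V \<Longrightarrow> GDERIV f u :> g u"
  shows "critical_points V f = {u \<in> V. g u = 0}"
  using deriv_at_zero_iff[OF assms] by (auto simp: critical_points_def)

lemma palais_smale_gderiv:
  assumes gd: "\<And>u. u \<in> V \<Longrightarrow> GDERIV f u :> g u"
  shows "palais_smale V f \<longleftrightarrow> (\<forall>u :: nat \<Rightarrow> 'a::real_inner. range u \<subseteq> V \<longrightarrow> bounded (range (\<lambda>k. f (u k))) \<longrightarrow>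
          (\<lambda>k. g (u k)) \<longlonglongrightarrow> 0 \<longrightarrow> (\<exists>s. strict_mono s \<and> convergent (u \<circ> s)))"
proof -
  have "(\<lambda>k. deriv_at f (u k)) \<longlonglongrightarrow> 0 \<longleftrightarrow> (\<lambda>k. g (u k)) \<longlonglongrightarrow> 0" if "range u \<subseteq> V" for u :: "nat \<Rightarrow> 'a"
  proof -
    have "norm (deriv_at f (u k)) = norm (g (u k))" for k
      using deriv_at_gderiv[OF gd[of "u k"]] that by (simp add: norm_blinfun_inner_left range_subsetD)
    then show ?thesis
      by (subst (1 2) tendsto_norm_zero_iff[symmetric]) simp
  qed
  then show ?thesis unfolding palais_smale_def by blast
qed

lemma palais_smale_gderivD:
  assumes PS: "palais_smale V f" and gd: "\<And>u. u \<in> V \<Longrightarrow> GDERIV f u :> g u"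
    and u: "range u \<subseteq> V" "bounded (range (\<lambda>k. f (u k)))" "(\<lambda>k. g (u k)) \<longlonglongrightarrow> 0"
  shows "\<exists>s. strict_mono s \<and> convergent (u \<circ> s)"
proof -
  have "palais_smale V f \<longleftrightarrow> (\<forall>u :: nat \<Rightarrow> 'a. range u \<subseteq> V \<longrightarrow> bounded (range (\<lambda>k. f (u k))) \<longrightarrow>
          (\<lambda>k. g (u k)) \<longlonglongrightarrow> 0 \<longrightarrow> (\<exists>s. strict_mono s \<and> convergent (u \<circ> s)))"
    by (rule palais_smale_gderiv) (rule gd)
  from this[THEN iffD1, OF PS, rule_format, OF u] show ?thesis .
qed

context functional_B
begin

lemma gderiv: "u \<in> V \<Longrightarrow> GDERIV L u :> gradient L u"
  by (rule C1_on_gderiv[OF open_V C1])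

lemma continuous_gradient: "continuous_on V (gradient L)"
  by (rule C1_on_gderiv[OF open_V C1])

lemma hypothesis_B: "hypothesis_B V L"
  unfolding hypothesis_B_def
  using gateaux selfadjoint_B decomp selfadjoint_P positive_P selfadjoint_Q compact_Q
    continuous_P continuous_Q coercive_P
  by (intro exI[of _ B] exI[of _ P] exI[of _ Q] conjI allI ballI) simp_all

text \<open>These are consequences of the reflected test vector. The first bounds the part of a - a'
  off the kernel by gradients and the kernel part. The second is the uniqueness half of an implicit
  function theorem, the third its infinitesimal version.\<close>

lemma local_estimates:
  assumes u0: "u\<^sub>0 \<in> V" and fr: "spectral_frame (B u\<^sub>0) S T"
  obtains c M r where "c > 0" "M \<ge> 0" "r > 0" "ball u\<^sub>0 r \<subseteq> V"
    "\<And>a a'. a \<in> ball u\<^sub>0 r \<Longrightarrow> a' \<in> ball u\<^sub>0 r \<Longrightarrow>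
       c * norm (a - a' - proj T (a - a')) \<le> norm (gradient L a - gradient L a') + M * norm (proj T (a - a'))"
    "\<And>a a'. a \<in> ball u\<^sub>0 r \<Longrightarrow> a' \<in> ball u\<^sub>0 r \<Longrightarrow> proj T (a - a') = 0 \<Longrightarrow>
       gradient L a - gradient L a' \<in> span T \<Longrightarrow> a = a'"
    "\<And>u k. u \<in> ball u\<^sub>0 r \<Longrightarrow> proj T k = 0 \<Longrightarrow> (\<And>y. (\<And>f. f \<in> T \<Longrightarrow> y \<bullet> f = 0) \<Longrightarrow> blinfun_apply (B u) k \<bullet> y = 0) \<Longrightarrow> k = 0"
    "\<And>u v. u \<in> ball u\<^sub>0 r \<Longrightarrow> v \<noteq> 0 \<Longrightarrow> (\<And>e. e \<in> S \<union> T \<Longrightarrow> v \<bullet> e = 0) \<Longrightarrow> blinfun_apply (B u) v \<bullet> v > 0"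
    "\<And>u v. u \<in> ball u\<^sub>0 r \<Longrightarrow> v \<noteq> 0 \<Longrightarrow> v \<in> span S \<Longrightarrow> blinfun_apply (B u) v \<bullet> v < 0"
proof (rule reflected_test_vector[OF u0 fr])
  fix c M r
  assume c: "c > 0" "M \<ge> 0" "r > 0" "ball u\<^sub>0 r \<subseteq> V"
    and test: "\<And>h. \<exists>y. (\<forall>f\<in>T. y \<bullet> f = 0) \<and> norm y = norm (h - proj T h) \<and>
       (\<forall>u\<in>ball u\<^sub>0 r. B u h \<bullet> y \<ge> c * (norm y)\<^sup>2 - M * norm (proj T h) * norm y)"
    and pos: "\<And>u v. u \<in> ball u\<^sub>0 r \<Longrightarrow> v \<noteq> 0 \<Longrightarrow> (\<And>e. e \<in> S \<union> T \<Longrightarrow> v \<bullet> e = 0) \<Longrightarrow> B u v \<bullet> v > 0"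
    and neg: "\<And>u v. u \<in> ball u\<^sub>0 r \<Longrightarrow> v \<noteq> 0 \<Longrightarrow> v \<in> span S \<Longrightarrow> B u v \<bullet> v < 0"
  \<comment> \<open>The test vector depends only on a - a', and its bound holds at every point of
    the ball. So it can be fixed before the mean value theorem selects the point of the
    segment.\<close>
  have diff: "\<exists>y. (\<forall>f\<in>T. y \<bullet> f = 0) \<and> norm y = norm (a - a' - proj T (a - a')) \<and>
      (gradient L a - gradient L a') \<bullet> y \<ge> c * (norm y)\<^sup>2 - M * norm (proj T (a - a')) * norm y"
    if a: "a \<in> ball u\<^sub>0 r" "a' \<in> ball u\<^sub>0 r" for a a'
  proof -
    obtain y where y: "\<forall>f\<in>T. y \<bullet> f = 0" "norm y = norm (a - a' - proj T (a - a'))"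
      "\<And>u. u \<in> ball u\<^sub>0 r \<Longrightarrow> B u (a - a') \<bullet> y \<ge> c * (norm y)\<^sup>2 - M * norm (proj T (a - a')) * norm y"
      using test[of "a - a'"] by blast
    obtain x where x: "x \<in> ball u\<^sub>0 r" "(gradient L a - gradient L a') \<bullet> y = B x (a - a') \<bullet> y"
    proof (rule gateaux_mean_value_ball[of "ball u\<^sub>0 r" "gradient L" B a' a y])
      show "has_gateaux_derivative (gradient L) (B x) x" if "x \<in> ball u\<^sub>0 r" for x
        by (rule gateaux) (use that c(4) in blast)
    qed (use a in auto)
    show ?thesis using y(1,2) y(3)[OF x(1)] x(2) by (intro exI[of _ y]) simp
  qed
  show thesis
  proof (rule that[OF c _ _ _ pos neg])
    fix a a' assume a: "a \<in> ball u\<^sub>0 r" "a' \<in> ball u\<^sub>0 r"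
    obtain y where y: "\<forall>f\<in>T. y \<bullet> f = 0" "norm y = norm (a - a' - proj T (a - a'))"
      "(gradient L a - gradient L a') \<bullet> y \<ge> c * (norm y)\<^sup>2 - M * norm (proj T (a - a')) * norm y"
      using diff[OF a] by blast
    show "c * norm (a - a' - proj T (a - a')) \<le> norm (gradient L a - gradient L a') + M * norm (proj T (a - a'))"
    proof (cases "norm y = 0")
      case True
      have "0 \<le> norm (gradient L a - gradient L a') + M * norm (proj T (a - a'))" using c(2) by simp
      then show ?thesis unfolding y(2)[symmetric] True by simp
    next
      case False
      have "c * norm y * norm y - M * norm (proj T (a - a')) * norm y \<le> norm (gradient L a - gradient L a') * norm y"
        using y(3) norm_cauchy_schwarz[of "gradient L a - gradient L a'" y] by (simp add: power2_eq_square)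
      then have "c * norm y * norm y \<le> (norm (gradient L a - gradient L a') + M * norm (proj T (a - a'))) * norm y"
        by (simp add: distrib_right)
      then have "c * norm y \<le> norm (gradient L a - gradient L a') + M * norm (proj T (a - a'))"
        using False by simp
      then show ?thesis by (simp add: y(2))
    qed
    assume p: "proj T (a - a') = 0" and g: "gradient L a - gradient L a' \<in> span T"
    have "y \<bullet> (gradient L a - gradient L a') = 0" by (rule span_orthogonal[OF _ g]) (use y(1) in blast)
    then have "c * (norm y)\<^sup>2 \<le> 0" using y(3) p by (simp add: inner_commute)
    then have "norm y = 0" using c(1) by (simp add: mult_le_0_iff)
    then show "a = a'" using y(2) p by simp
  next
    fix u k assume u: "u \<in> ball u\<^sub>0 r" and p: "proj T k = 0"
      and B0: "\<And>y. (\<And>f. f \<in> T \<Longrightarrow> y \<bullet> f = 0) \<Longrightarrow> B u k \<bullet> y = 0"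
    obtain y where y: "\<forall>f\<in>T. y \<bullet> f = 0" "norm y = norm (k - proj T k)"
      "B u k \<bullet> y \<ge> c * (norm y)\<^sup>2 - M * norm (proj T k) * norm y"
      using test[of k] u by blast
    have "B u k \<bullet> y = 0" by (rule B0) (use y(1) in blast)
    then have "c * (norm y)\<^sup>2 \<le> 0" using y(3) p by simp
    then have "norm y = 0" using c(1) by (simp add: mult_le_0_iff)
    then show "k = 0" using y(2) p by simp
  qed
qed

text \<open>A sequence in the closed annulus with gradients tending to 0 would subconverge, by (PS),
  to a critical point at distance at least \<rho>/2 from the only one.\<close>

lemma gradient_bounded_below_annulus:
  assumes PS: "palais_smale V L" and crit: "critical_points V L = {u\<^sub>0}"
    and \<rho>: "\<rho> > 0" "cball u\<^sub>0 \<rho> \<subseteq> V" and bd: "\<And>u. u \<in> cball u\<^sub>0 \<rho> \<Longrightarrow> \<bar>L u\<bar> \<le> R"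
  obtains m where "m > 0" "\<And>u. \<rho> / 2 \<le> norm (u - u\<^sub>0) \<Longrightarrow> norm (u - u\<^sub>0) \<le> \<rho> \<Longrightarrow> m \<le> norm (gradient L u)"
proof (rule ccontr)
  assume n: "\<not> thesis"
  have "\<exists>u. \<rho> / 2 \<le> norm (u - u\<^sub>0) \<and> norm (u - u\<^sub>0) \<le> \<rho> \<and> norm (gradient L u) < inverse (real (Suc j))" for j
  proof (rule ccontr)
    assume "\<not> ?thesis"
    then have "inverse (real (Suc j)) \<le> norm (gradient L u)"
      if "\<rho> / 2 \<le> norm (u - u\<^sub>0)" "norm (u - u\<^sub>0) \<le> \<rho>" for u using that by (meson not_less)
    then show False using n that[of "inverse (real (Suc j))"] by simp
  qed
  then obtain x where x: "\<And>j. \<rho> / 2 \<le> norm (x j - u\<^sub>0)" "\<And>j. norm (x j - u\<^sub>0) \<le> \<rho>"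
    "\<And>j. norm (gradient L (x j)) < inverse (real (Suc j))" by metis
  have xc: "x j \<in> cball u\<^sub>0 \<rho>" for j using x(2)[of j] by (simp add: dist_norm norm_minus_commute)
  have g0: "(\<lambda>j. gradient L (x j)) \<longlonglongrightarrow> 0"
    by (rule Lim_null_comparison[OF always_eventually LIMSEQ_inverse_real_of_nat])
       (use x(3) in \<open>simp add: less_imp_le\<close>)
  have "range x \<subseteq> V" using xc \<rho>(2) by blast
  moreover have "bounded (range (\<lambda>j. L (x j)))" using bd[OF xc] by (auto simp: bounded_iff)
  ultimately have "\<exists>s. strict_mono s \<and> convergent (x \<circ> s)"
    using g0 by (intro palais_smale_gderivD[OF PS gderiv])
  then obtain s where s: "strict_mono s" "convergent (x \<circ> s)" by blast
  then obtain y where y: "(\<lambda>j. x (s j)) \<longlonglongrightarrow> y" by (auto simp: convergent_def o_def)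
  have ny: "(\<lambda>j. norm (x (s j) - u\<^sub>0)) \<longlonglongrightarrow> norm (y - u\<^sub>0)" by (intro tendsto_intros y)
  have y1: "norm (y - u\<^sub>0) \<ge> \<rho> / 2" by (rule LIMSEQ_le_const[OF ny]) (use x(1) in blast)
  have y2: "norm (y - u\<^sub>0) \<le> \<rho>" by (rule LIMSEQ_le_const2[OF ny]) (use x(2) in blast)
  have "y \<in> cball u\<^sub>0 \<rho>" using y2 by (simp add: dist_norm norm_minus_commute)
  then have yV: "y \<in> V" using \<rho>(2) by blast
  have "(\<lambda>j. gradient L (x (s j))) \<longlonglongrightarrow> gradient L y"
    by (rule continuous_on_tendsto_compose[OF continuous_gradient y yV])
       (intro always_eventually allI subsetD[OF \<rho>(2)] xc)
  moreover have "(\<lambda>j. gradient L (x (s j))) \<longlonglongrightarrow> 0"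
    using LIMSEQ_subseq_LIMSEQ[OF g0 s(1)] by (simp add: o_def)
  ultimately have "gradient L y = 0" by (rule LIMSEQ_unique)
  then have "y \<in> critical_points V L" using yV critical_points_gderiv[OF gderiv] by blast
  then have "y = u\<^sub>0" using crit by blast
  then show False using y1 \<rho>(1) by simp
qed

text \<open>Adding an operator of norm at most C/2 leaves \<open>P\<close> coercive with constant
  C/2 on the ball of radius d. Since \<open>K\<close> vanishes from distance \<rho> < d on, nothing
  changes outside that ball.\<close>

lemma perturbed_functional_B:
  assumes \<eta>: "\<And>u. GDERIV \<eta> u :> k u" "\<And>u. (k has_derivative blinfun_apply (K u)) (at u)"
    and K: "continuous_on UNIV K" "\<And>u. selfadjoint (K u)"
      "\<And>u. norm (u - u\<^sub>0) \<ge> \<rho> \<Longrightarrow> K u = 0" "\<And>u. norm (K u) \<le> C / 2"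
    and d: "\<rho> < d" "ball u\<^sub>0 d \<subseteq> V" and C: "C > 0"
      "\<And>u v. u \<in> ball u\<^sub>0 d \<Longrightarrow> blinfun_apply (P u) v \<bullet> v \<ge> C * (norm v)\<^sup>2"
  shows "functional_B V (\<lambda>u. L u + \<eta> u) (\<lambda>u. B u + K u) (\<lambda>u. P u + K u) Q"
    "\<And>u. u \<in> V \<Longrightarrow> GDERIV (\<lambda>u. L u + \<eta> u) u :> gradient L u + k u"
    "\<And>u. u \<in> V \<Longrightarrow> has_gateaux_derivative (\<lambda>u. gradient L u + k u) (B u + K u) u"
proof -
  show gd: "GDERIV (\<lambda>u. L u + \<eta> u) u :> gradient L u + k u" if "u \<in> V" for u
    by (rule GDERIV_add[OF gderiv[OF that] \<eta>(1)])
  show gt: "has_gateaux_derivative (\<lambda>u. gradient L u + k u) (B u + K u) u" if "u \<in> V" for u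
    by (intro has_gateaux_derivative_add gateaux that has_derivative_imp_gateaux \<eta>(2))
  have ck: "continuous_on V k"
    by (intro continuous_at_imp_continuous_on ballI has_derivative_continuous[OF \<eta>(2)])
  have sa_add: "selfadjoint (A + K u)" if "selfadjoint A" for A u
    using that K(2)[of u] by (simp add: selfadjoint_def blinfun.add_left inner_add_left inner_add_right)
  have coer: "(P u + K u) v \<bullet> v \<ge> C / 2 * (norm v)\<^sup>2" if u: "u \<in> ball u\<^sub>0 d" for u v
  proof -
    have "\<bar>K u v \<bullet> v\<bar> \<le> norm (K u v) * norm v" by (rule Cauchy_Schwarz_ineq2)
    also have "\<dots> \<le> (norm (K u) * norm v) * norm v" by (intro mult_right_mono norm_blinfun) simp
    also have "\<dots> \<le> (C / 2 * norm v) * norm v" by (intro mult_right_mono K(4)) simp_all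
    finally have "K u v \<bullet> v \<ge> - (C / 2 * (norm v)\<^sup>2)" by (simp add: power2_eq_square abs_le_iff mult_ac)
    with C(2)[OF u, of v] show ?thesis by (simp add: blinfun.add_left inner_add_left)
  qed
  have K0: "K u = 0" if "u \<notin> ball u\<^sub>0 d" for u
    by (rule K(3)) (use that d(1) in \<open>simp add: dist_norm norm_minus_commute\<close>)
  show "functional_B V (\<lambda>u. L u + \<eta> u) (\<lambda>u. B u + K u) (\<lambda>u. P u + K u) Q"
  proof (rule functional_B.intro)
    show "C1_on V (\<lambda>u. L u + \<eta> u)"
      by (rule C1_onI_gderiv, erule gd) (intro continuous_on_add continuous_gradient ck)
    show "has_gateaux_derivative (gradient (\<lambda>u. L u + \<eta> u)) (B u + K u) u" if "u \<in> V" for u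
      by (rule has_gateaux_derivative_transform[OF gt[OF that] open_V that]) (simp add: gradient_eqI[OF gd])
    show "positive_definite (P u + K u)" if u: "u \<in> V" for u
    proof (cases "u \<in> ball u\<^sub>0 d")
      case True
      show ?thesis unfolding positive_definite_def
      proof (intro allI impI)
        fix v :: 'a assume "v \<noteq> 0"
        then have "C / 2 * (norm v)\<^sup>2 > 0" using C(1) by simp
        then show "(P u + K u) v \<bullet> v > 0" using coer[OF True, of v] by linarith
      qed
    next
      case False
      then show ?thesis using positive_P[OF u] K0[OF False] by simp
    qed
    show "continuous_on V (\<lambda>u. (P u + K u) v)" for v
      unfolding blinfun.add_left
      by (intro continuous_intros continuous_P blinfun.continuous_on continuous_on_subset[OF K(1)]) auto
    show "\<exists>U C. open U \<and> u \<in> U \<and> U \<subseteq> V \<and> C > 0 \<and> (\<forall>x\<in>U. \<forall>v. (P x + K x) v \<bullet> v \<ge> C * (norm v)\<^sup>2)"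
      if u: "u \<in> V" for u
    proof (cases "u \<in> ball u\<^sub>0 d")
      case True
      then show ?thesis using coer d(2) C(1) by (intro exI[of _ "ball u\<^sub>0 d"] exI[of _ "C / 2"]) auto
    next
      case False
      obtain U C' where U: "open U" "u \<in> U" "U \<subseteq> V" "C' > 0" "\<forall>x\<in>U. \<forall>v. P x v \<bullet> v \<ge> C' * (norm v)\<^sup>2"
        using coercive_P[OF u] by blast
      show ?thesis
      \<comment> \<open>As \<rho> < d, the point is off the closed ball of radius \<rho>, so
        removing that ball leaves a neighborhood on which \<open>K\<close> vanishes.\<close>
      proof (intro exI[of _ "U - cball u\<^sub>0 \<rho>"] exI[of _ C'] conjI ballI allI)
        show "open (U - cball u\<^sub>0 \<rho>)" using U by (intro open_Diff closed_cball)
        show "u \<in> U - cball u\<^sub>0 \<rho>" using U False d(1) by auto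
        show "(P x + K x) v \<bullet> v \<ge> C' * (norm v)\<^sup>2" if "x \<in> U - cball u\<^sub>0 \<rho>" for x v
        proof -
          have "K x = 0" by (rule K(3)) (use that in \<open>simp add: dist_norm norm_minus_commute\<close>)
          then show ?thesis using U(5) that by simp
        qed
      qed (use U in auto)
    qed
  qed (use open_V selfadjoint_B decomp selfadjoint_P selfadjoint_Q compact_Q continuous_Q sa_add in simp_all)
qed

text \<open>
  A Palais-Smale sequence of the perturbed functional either leaves the support of the perturbation
  infinitely often, or is finally in the inner ball, where \<open>\<nabla>L\<close> converges along it.
\<close>

lemma perturbed_palais_smale:
  assumes PS: "palais_smale V L"
    and gd: "\<And>u. u \<in> V \<Longrightarrow> GDERIV (\<lambda>u. L u + \<eta> u) u :> gradient L u + k u"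
    and inner: "\<And>u. norm (u - u\<^sub>0) \<le> \<rho> / 2 \<Longrightarrow> k u = b"
    and outer: "\<And>u. norm (u - u\<^sub>0) \<ge> \<rho> \<Longrightarrow> \<eta> u = 0 \<and> k u = 0"
    and m: "m > 0" "\<And>u. norm (k u) \<le> m / 2"
      "\<And>u. \<rho> / 2 \<le> norm (u - u\<^sub>0) \<Longrightarrow> norm (u - u\<^sub>0) \<le> \<rho> \<Longrightarrow> m \<le> norm (gradient L u)"
    and T: "orthonormal T" and \<rho>: "0 < \<rho>" "\<rho> < r" and c: "c > 0" "M \<ge> 0"
      "\<And>a a'. a \<in> ball u\<^sub>0 r \<Longrightarrow> a' \<in> ball u\<^sub>0 r \<Longrightarrow>
       c * norm (a - a' - proj T (a - a')) \<le> norm (gradient L a - gradient L a') + M * norm (proj T (a - a'))"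
  shows "palais_smale V (\<lambda>u. L u + \<eta> u)"
proof (rule iffD2[OF palais_smale_gderiv], erule gd, intro allI impI)
  fix x :: "nat \<Rightarrow> 'a"
  assume xV: "range x \<subseteq> V" and bd: "bounded (range (\<lambda>j. L (x j) + \<eta> (x j)))"
    and lim: "(\<lambda>j. gradient L (x j) + k (x j)) \<longlonglongrightarrow> 0"
  define I where "I = {j. norm (x j - u\<^sub>0) \<ge> \<rho>}"
  show "\<exists>s. strict_mono s \<and> convergent (x \<circ> s)"
  proof (cases "infinite I")
    case True
    define s where "s = enumerate I"
    have s: "strict_mono s" unfolding s_def by (rule strict_mono_enumerate[OF True])
    have sI: "norm (x (s j) - u\<^sub>0) \<ge> \<rho>" for j
      using enumerate_in_set[OF True, of j] by (simp add: s_def I_def)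
    have "range (\<lambda>j. L (x (s j))) \<subseteq> range (\<lambda>j. L (x j) + \<eta> (x j))"
    proof
      fix y assume "y \<in> range (\<lambda>j. L (x (s j)))"
      then obtain j where "y = L (x (s j)) + \<eta> (x (s j))" using outer[OF sI] by auto
      then show "y \<in> range (\<lambda>j. L (x j) + \<eta> (x j))" by blast
    qed
    then have "bounded (range (\<lambda>j. L (x (s j))))" by (rule bounded_subset[OF bd])
    moreover have "(\<lambda>j. gradient L (x (s j))) \<longlonglongrightarrow> 0"
      using LIMSEQ_subseq_LIMSEQ[OF lim s] outer[OF sI] by (simp add: o_def)
    moreover have "range (\<lambda>j. x (s j)) \<subseteq> V" using xV by blast
    ultimately have "\<exists>s'. strict_mono s' \<and> convergent ((\<lambda>j. x (s j)) \<circ> s')"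
      by (intro palais_smale_gderivD[OF PS gderiv])
    then obtain s' where s': "strict_mono s'" "convergent ((\<lambda>j. x (s j)) \<circ> s')" by blast
    have "strict_mono (s \<circ> s')" using s s'(1) by (rule strict_mono_o)
    moreover have "convergent (x \<circ> (s \<circ> s'))" using s'(2) by (simp add: o_def)
    ultimately show ?thesis by blast
  next
    case False
    have "\<forall>\<^sub>F j in sequentially. norm (gradient L (x j) + k (x j)) < m / 2"
      using tendsto_norm_zero[OF lim] m(1) by (intro order_tendstoD(2)[where y=0]) auto
    then obtain N1 where N1: "\<And>j. j \<ge> N1 \<Longrightarrow> norm (gradient L (x j) + k (x j)) < m / 2"
      unfolding eventually_sequentially by blast
    obtain N2 where N2: "\<And>j. j \<in> I \<Longrightarrow> j < N2"
      using False finite_nat_bounded[of I] by (auto simp: lessThan_def)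
    define N where "N = max N1 N2"
    \<comment> \<open>On the annulus the gradient of \<open>L\<close> has norm at least m, but here
      it is below m/2 + m/2: one half from the convergence, one from the perturbation.\<close>
    have near: "norm (x (j + N) - u\<^sub>0) < \<rho> / 2" for j
    proof (rule ccontr)
      assume far: "\<not> ?thesis"
      have "j + N \<notin> I" using N2[of "j + N"] by (auto simp: N_def)
      then have "norm (x (j + N) - u\<^sub>0) \<le> \<rho>" by (simp add: I_def)
      then have "m \<le> norm (gradient L (x (j + N)))" using far by (intro m(3)) auto
      also have "\<dots> \<le> norm (gradient L (x (j + N)) + k (x (j + N))) + norm (k (x (j + N)))"
        using norm_triangle_ineq4[of "gradient L (x (j + N)) + k (x (j + N))" "k (x (j + N))"] by simp
      also have "\<dots> < m / 2 + m / 2" by (intro add_less_le_mono N1 m(2)) (simp add: N_def)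
      finally show False by simp
    qed
    \<comment> \<open>The kernel components lie in a compact ball and so subconverge, and the
      gradients converge to -b. The remaining component is then Cauchy by the local
      estimate.\<close>
    define p where "p j = proj T (x (j + N) - u\<^sub>0)" for j
    define g where "g j = gradient L (x (j + N))" for j
    have pK: "p j \<in> span T \<inter> cball 0 \<rho>" for j
      using near[of j] norm_proj_le[OF T, of "x (j + N) - u\<^sub>0"] \<rho>(1) by (simp add: p_def proj_in_span)
    obtain l s where s: "strict_mono s" and l: "(p \<circ> s) \<longlonglongrightarrow> l"
      using seq_compactE[OF compact_imp_seq_compact[OF compact_span_cball[OF T, of \<rho>]], of p] pK by blast
    have "(\<lambda>j. gradient L (x (j + N)) + k (x (j + N))) \<longlonglongrightarrow> 0" by (rule LIMSEQ_ignore_initial_segment[OF lim])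
    then have "(\<lambda>j. g j + b) \<longlonglongrightarrow> 0" using inner near by (simp add: g_def less_imp_le)
    then have "(\<lambda>j. g j + b - b) \<longlonglongrightarrow> 0 - b" by (intro tendsto_diff tendsto_const)
    then have "g \<longlonglongrightarrow> - b" by simp
    then have "(\<lambda>j. g (s j)) \<longlonglongrightarrow> - b" using LIMSEQ_subseq_LIMSEQ[OF _ s] by (fastforce simp: o_def)
    then have gC: "Cauchy (\<lambda>j. g (s j))" by (rule LIMSEQ_imp_Cauchy)
    have pC: "Cauchy (\<lambda>j. p (s j))" using LIMSEQ_imp_Cauchy[OF l] by (simp add: o_def)
    define y where "y j = x (s j + N)" for j
    \<comment> \<open>The local estimate concerns the part off the kernel; adding the kernel part
      back costs the extra summand c.\<close>
    define A where "A = M + c"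
    have A: "A > 0" using c by (simp add: A_def)
    have est: "c * norm (y i - y j) \<le> norm (g (s i) - g (s j)) + A * norm (p (s i) - p (s j))" for i j
    proof -
      have yb: "y i \<in> ball u\<^sub>0 r" for i
        using near[of "s i"] \<rho> by (simp add: y_def dist_norm norm_minus_commute)
      have pp: "proj T (y i - y j) = p (s i) - p (s j)"
        by (simp add: y_def p_def proj_diff[symmetric])
      have "norm (y i - y j) \<le> norm (y i - y j - proj T (y i - y j)) + norm (proj T (y i - y j))"
        using norm_triangle_ineq[of "y i - y j - proj T (y i - y j)" "proj T (y i - y j)"] by simp
      then have "c * norm (y i - y j) \<le> c * norm (y i - y j - proj T (y i - y j)) + c * norm (proj T (y i - y j))"
        using c(1) by (simp add: distrib_left[symmetric])
      also have "\<dots> \<le> norm (g (s i) - g (s j)) + M * norm (proj T (y i - y j)) + c * norm (proj T (y i - y j))"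
        using c(3)[OF yb yb, of i j] by (simp add: g_def y_def)
      finally show ?thesis unfolding pp by (simp add: A_def distrib_right)
    qed
    have "Cauchy y"
    proof (rule CauchyI)
      fix e :: real assume e: "e > 0"
      have "c * e / 2 > 0" "c * e / (2 * A) > 0" using c e A by simp_all
      then obtain N3 N4 where N3: "\<And>i j. i \<ge> N3 \<Longrightarrow> j \<ge> N3 \<Longrightarrow> norm (g (s i) - g (s j)) < c * e / 2"
        and N4: "\<And>i j. i \<ge> N4 \<Longrightarrow> j \<ge> N4 \<Longrightarrow> norm (p (s i) - p (s j)) < c * e / (2 * A)"
        using CauchyD[OF gC] CauchyD[OF pC] by metis
      have "norm (y i - y j) < e" if "i \<ge> max N3 N4" "j \<ge> max N3 N4" for i j
      proof -
        have "A * norm (p (s i) - p (s j)) < A * (c * e / (2 * A))"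
          using N4[of i j] that A by (intro mult_strict_left_mono) auto
        also have "\<dots> = c * e / 2" using A by simp
        finally have "c * norm (y i - y j) < c * e" using est[of i j] N3[of i j] that by simp
        then show ?thesis using c(1) by simp
      qed
      then show "\<exists>M. \<forall>m\<ge>M. \<forall>n\<ge>M. norm (y m - y n) < e" by blast
    qed
    then have "convergent y" by (simp add: Cauchy_convergent_iff)
    then have "convergent (x \<circ> (\<lambda>j. s j + N))" by (simp add: y_def[abs_def] o_def)
    moreover have "strict_mono (\<lambda>j. s j + N)" using s by (simp add: strict_mono_def)
    ultimately show ?thesis by blast
  qed
qed

end

section \<open>Comparison of Morse indices\<close>

lemma morse_index_frame:
  assumes "spectral_frame (hessian f u) S T" "selfadjoint (hessian f u)"
  shows "morse_index f u = enat (card S)" "nullity f u = enat (card T)"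
  unfolding morse_index_def nullity_def negative_space_frame[OF assms]
    spectral_frameD(5)[OF assms(1), symmetric]
  by (intro edim_span_orthonormal spectral_frameD(1,2)[OF assms(1)])+

text \<open>Otherwise some nonzero vector of \<open>span S\<close> is orthogonal to
  \<open>S'\<close>, and there the form is nonnegative. This gives the lower bound of the
  index.\<close>

lemma card_le_negative_frame:
  assumes S: "orthonormal S" and fr: "spectral_frame A S' T'" and A: "selfadjoint A"
    and neg: "\<And>v. v \<in> span S \<Longrightarrow> v \<noteq> 0 \<Longrightarrow> blinfun_apply A v \<bullet> v < 0"
  shows "card S \<le> card S'"
proof (rule ccontr)
  assume "\<not> ?thesis"
  then obtain x where x: "x \<in> span S" "x \<noteq> 0" "\<And>t. t \<in> S' \<Longrightarrow> x \<bullet> t = 0"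
    using exists_orthogonal_in_span[OF S orthonormal_finite[OF spectral_frameD(1)[OF fr]]] by (metis not_le)
  have "A x \<bullet> x \<ge> 0" by (rule frame_nonneg[OF fr A]) (rule x(3))
  then show False using neg[OF x(1,2)] by simp
qed

text \<open>Otherwise some nonzero vector of \<open>span S'\<close> is orthogonal to
  \<open>X\<close>, and the form would be negative and positive at it. With \<open>X\<close> made of
  the negative and kernel bases at the center this gives the upper bound of the index.\<close>

lemma negative_frame_card_le:
  assumes fr: "spectral_frame A S' T'" and X: "finite X"
    and pos: "\<And>v. v \<noteq> 0 \<Longrightarrow> (\<And>e. e \<in> X \<Longrightarrow> v \<bullet> e = 0) \<Longrightarrow> blinfun_apply A v \<bullet> v > 0"
  shows "card S' \<le> card X"
proof (rule ccontr)
  assume "\<not> ?thesis"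
  then obtain x where x: "x \<in> span S'" "x \<noteq> 0" "\<And>t. t \<in> X \<Longrightarrow> x \<bullet> t = 0"
    using exists_orthogonal_in_span[OF spectral_frameD(1)[OF fr] X] by (metis not_le)
  have "A x \<bullet> x > 0" by (rule pos[OF x(2)]) (rule x(3))
  then show False using frame_negative(1)[OF fr x(1,2)] by simp
qed

section \<open>The reduced gradient and the choice of the perturbation\<close>

context functional_B
begin

text \<open>
  The vector \<open>y\<close> is \<open>v\<close> plus the derivative of \<open>\<phi>\<close> along \<open>v\<close>, tangent to the graph of \<open>\<phi>\<close>.
\<close>

lemma reduced_gradient_C1:
  fixes \<phi> :: "'a \<Rightarrow> 'a"
  assumes T: "orthonormal T" and W: "W = span T \<inter> ball 0 e"
    and \<phi>: "C1_on W \<phi>" "\<And>z f. z \<in> W \<Longrightarrow> f \<in> T \<Longrightarrow> \<phi> z \<bullet> f = 0"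
      "\<And>z. z \<in> W \<Longrightarrow> u\<^sub>0 + z + \<phi> z \<in> V"
      "\<And>z. z \<in> W \<Longrightarrow> gradient L (u\<^sub>0 + z + \<phi> z) \<in> span T"
  obtains D :: "'a \<Rightarrow> 'a \<Rightarrow>\<^sub>L 'a" where
    "\<And>z. z \<in> W \<Longrightarrow> ((\<lambda>z. proj T (gradient L (u\<^sub>0 + z + \<phi> z))) has_derivative blinfun_apply (D z)) (at z within W)"
    "continuous_on W D"
    "\<And>z v. z \<in> W \<Longrightarrow> v \<in> span T \<Longrightarrow> \<exists>y. proj T y = v \<and>
       (\<forall>e. (\<forall>f\<in>T. e \<bullet> f = 0) \<longrightarrow> blinfun_apply (B (u\<^sub>0 + z + \<phi> z)) y \<bullet> e = 0) \<and>
       blinfun_apply (D z) v = proj T (blinfun_apply (B (u\<^sub>0 + z + \<phi> z)) y)"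
proof -
  obtain D\<phi> :: "'a \<Rightarrow> 'a \<Rightarrow>\<^sub>L 'a" where
    D\<phi>: "\<And>z. z \<in> W \<Longrightarrow> (\<phi> has_derivative blinfun_apply (D\<phi> z)) (at z within W)" "continuous_on W D\<phi>"
    using \<phi>(1) unfolding C1_on_def by blast
  define U where "U z = u\<^sub>0 + z + \<phi> z" for z
  have UV: "U z \<in> V" if "z \<in> W" for z unfolding U_def by (rule \<phi>(3)[OF that])
  have dU: "(U has_derivative (\<lambda>v. v + D\<phi> z v)) (at z within W)" if "z \<in> W" for z
  proof -
    have "((\<lambda>z. u\<^sub>0 + z + \<phi> z) has_derivative (\<lambda>v. 0 + v + D\<phi> z v)) (at z within W)"
      by (intro has_derivative_add has_derivative_const has_derivative_ident D\<phi>(1)[OF that])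
    then show ?thesis by (simp add: U_def[abs_def])
  qed
  have cU: "continuous_on W U"
    by (rule has_derivative_continuous_on) (rule dU)
  have dg: "((\<lambda>z. gradient L (U z) \<bullet> f) has_derivative (\<lambda>v. (v + D\<phi> z v) \<bullet> B (U z) f)) (at z within W)"
    if "z \<in> W" for z f
    by (rule has_derivative_compose[OF dU[OF that]
          gateaux_component_has_derivative[OF open_V UV[OF that] gateaux selfadjoint_B continuous_B]])
  \<comment> \<open>Self-adjointness moves the Hessian onto the basis vectors f. Only the maps
    \<open>B (U z) f\<close> enter, and their continuity makes \<open>D\<close> continuous in
    operator norm although \<open>B\<close> need not be.\<close>
  define D where "D z = (\<Sum>f\<in>T. blinfun_scaleR_left f o\<^sub>L (blinfun_inner_left (B (U z) f) o\<^sub>L (id_blinfun + D\<phi> z)))" for z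
  have D: "D z v = (\<Sum>f\<in>T. ((v + D\<phi> z v) \<bullet> B (U z) f) *\<^sub>R f)" for z v
    by (simp add: D_def blinfun.sum_left blinfun.add_left)
  have 1: "((\<lambda>z. proj T (gradient L (U z))) has_derivative blinfun_apply (D z)) (at z within W)" if "z \<in> W" for z
  proof -
    have "((\<lambda>z. \<Sum>f\<in>T. (gradient L (U z) \<bullet> f) *\<^sub>R f) has_derivative
        (\<lambda>v. \<Sum>f\<in>T. ((v + D\<phi> z v) \<bullet> B (U z) f) *\<^sub>R f)) (at z within W)"
      by (intro has_derivative_sum has_derivative_scaleR_left dg[OF that])
    then show ?thesis by (simp add: proj_def D[abs_def])
  qed
  have cB: "continuous_on W (\<lambda>z. B (U z) f)" for f
    by (rule continuous_on_compose2[OF continuous_B cU]) (use UV in blast)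
  have 2: "continuous_on W D"
    unfolding D_def
    by (intro continuous_on_sum bounded_bilinear.continuous_on[OF bounded_bilinear_blinfun_compose]
        continuous_on_const bounded_linear.continuous_on[OF bounded_linear_blinfun_inner_left] cB
        continuous_on_add D\<phi>(2))
  have 3: "\<exists>y. proj T y = v \<and> (\<forall>e. (\<forall>f\<in>T. e \<bullet> f = 0) \<longrightarrow> B (U z) y \<bullet> e = 0) \<and> D z v = proj T (B (U z) y)"
    if z: "z \<in> W" and v: "v \<in> span T" for z v
  proof (intro exI[of _ "v + D\<phi> z v"] conjI allI impI)
    \<comment> \<open>Two functions vanish identically on \<open>W\<close>: the components of \<phi>
      in the kernel and those of the gradient off the kernel. Differentiating them along v yields
      the first two properties of y.\<close>
    note along = has_derivative_zero_along_subspace[OF _ subspace_span v z[unfolded W]]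
    note sa = selfadjointD[OF selfadjoint_B[OF UV[OF z]]]
    have "D\<phi> z v \<bullet> f = 0" if f: "f \<in> T" for f
    proof (rule along)
      show "((\<lambda>z. \<phi> z \<bullet> f) has_derivative (\<lambda>v. D\<phi> z v \<bullet> f)) (at z within span T \<inter> ball 0 e)"
        by (rule has_derivative_inner_left) (use D\<phi>(1)[OF z] W in simp)
      show "\<phi> x \<bullet> f = 0" if "x \<in> span T \<inter> ball 0 e" for x using \<phi>(2)[of x f] f that W by simp
    qed
    then have "proj T (D\<phi> z v) = 0" by (simp add: proj_eq_0_iff[OF T])
    then show "proj T (v + D\<phi> z v) = v" by (simp add: proj_add proj_span[OF T v])
    fix e' assume e': "\<forall>f\<in>T. e' \<bullet> f = 0"
    have "(v + D\<phi> z v) \<bullet> B (U z) e' = 0"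
    proof (rule along)
      show "((\<lambda>z. gradient L (U z) \<bullet> e') has_derivative (\<lambda>v. (v + D\<phi> z v) \<bullet> B (U z) e')) (at z within span T \<inter> ball 0 e)"
        using dg[OF z, of e'] W by simp
      show "gradient L (U x) \<bullet> e' = 0" if x: "x \<in> span T \<inter> ball 0 e" for x
      proof -
        have "e' \<bullet> gradient L (U x) = 0"
          by (rule span_orthogonal[of T]) (use e' \<phi>(4)[of x] x W in \<open>auto simp: U_def\<close>)
        then show ?thesis by (simp add: inner_commute)
      qed
    qed
    then show "B (U z) (v + D\<phi> z v) \<bullet> e' = 0" by (simp add: sa)
  next
    show "D z v = proj T (B (U z) (v + D\<phi> z v))"
      by (simp add: D proj_def selfadjointD[OF selfadjoint_B[OF UV[OF z]]])
  qed
  show thesis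
    by (rule that[OF 1[unfolded U_def] 2 3[unfolded U_def]])
qed

text \<open>The radius \<rho> comes first, then the constants m, C and M1 belonging to it, and the
  small vector b last. The bounds obtained are pointwise and not strict.\<close>

lemma nondegenerate_perturbation:
  assumes crit: "critical_points V L = {u\<^sub>0}"
    and red: "reduction_map V L u\<^sub>0 \<epsilon>\<^sub>0 \<phi>"
    and C1\<phi>: "C1_on (null_space (hessian L u\<^sub>0) \<inter> ball 0 \<epsilon>\<^sub>0) \<phi>"
    and PS: "palais_smale V L"
    and \<epsilon>: "\<epsilon> > 0" and r: "r > 0" "cball u\<^sub>0 r \<subseteq> V"
    and bd: "\<And>u. u \<in> cball u\<^sub>0 r \<Longrightarrow> \<bar>L u\<bar> \<le> R"
  obtains Lt :: "'a \<Rightarrow> real" where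
    "C1_on V Lt" "hypothesis_B V Lt" "palais_smale V Lt"
    "\<And>u. u \<in> V \<Longrightarrow> \<bar>L u - Lt u\<bar> \<le> \<epsilon>"
    "\<And>u. u \<in> V \<Longrightarrow> norm (deriv_at L u - deriv_at Lt u) \<le> \<epsilon>"
    "\<And>u. u \<in> V \<Longrightarrow> norm (deriv2_at L u - deriv2_at Lt u) \<le> \<epsilon>"
    "\<And>u. norm (u - u\<^sub>0) \<ge> r \<Longrightarrow> L u = Lt u"
    "critical_points V Lt \<subseteq> ball u\<^sub>0 r" "finite (critical_points V Lt)"
    "\<And>u. u \<in> critical_points V Lt \<Longrightarrow> nondegenerate Lt u \<and>
       morse_index L u\<^sub>0 \<le> morse_index Lt u \<and>
       morse_index Lt u \<le> morse_index L u\<^sub>0 + nullity L u\<^sub>0"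
proof -
  have u0: "u\<^sub>0 \<in> V" using crit by (auto simp: critical_points_def)
  obtain S T where fr: "spectral_frame (B u\<^sub>0) S T" using spectral_frame_B[OF u0] by blast
  have oS: "orthonormal S" and T: "orthonormal T" by (rule spectral_frameD[OF fr])+
  have H0: "null_space (hessian L u\<^sub>0) = span T"
    using spectral_frameD(5)[OF fr] by (simp add: hessian_eq[OF u0])
  define W where "W = span T \<inter> ball 0 \<epsilon>\<^sub>0"
  have \<epsilon>0: "\<epsilon>\<^sub>0 > 0" and \<phi>c: "continuous_on W \<phi>" and \<phi>0: "\<phi> 0 = 0"
    and \<phi>oc: "\<And>z. z \<in> W \<Longrightarrow> \<phi> z \<in> orthogonal_comp (span T)"
    and \<phi>V: "\<And>z. z \<in> W \<Longrightarrow> u\<^sub>0 + z + \<phi> z \<in> V"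
    and \<phi>g: "\<And>z. z \<in> W \<Longrightarrow> gradient L (u\<^sub>0 + z + \<phi> z) = proj T (gradient L (u\<^sub>0 + z + \<phi> z))"
    using red unfolding reduction_map_def Let_def H0 orth_proj_span[OF T] W_def by auto
  have \<phi>o: "\<phi> z \<bullet> f = 0" if "z \<in> W" "f \<in> T" for z f
    by (rule orthogonal_comp_span[OF \<phi>oc[OF that(1)] that(2)])
  have \<phi>s: "gradient L (u\<^sub>0 + z + \<phi> z) \<in> span T" if "z \<in> W" for z
    by (subst \<phi>g[OF that]) (rule proj_in_span)
  have C1W: "C1_on W \<phi>" using C1\<phi> by (simp add: H0 W_def)
  show thesis
  proof (rule local_estimates[OF u0 fr], rule reduced_gradient_C1[OF T W_def C1W \<phi>o \<phi>V \<phi>s])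
    fix c M r1 and D :: "'a \<Rightarrow> 'a \<Rightarrow>\<^sub>L 'a"
    assume c: "c > 0" "M \<ge> 0" and r1: "r1 > 0" "ball u\<^sub>0 r1 \<subseteq> V"
      and E1: "\<And>a a'. a \<in> ball u\<^sub>0 r1 \<Longrightarrow> a' \<in> ball u\<^sub>0 r1 \<Longrightarrow>
       c * norm (a - a' - proj T (a - a')) \<le> norm (gradient L a - gradient L a') + M * norm (proj T (a - a'))"
      and E2: "\<And>a a'. a \<in> ball u\<^sub>0 r1 \<Longrightarrow> a' \<in> ball u\<^sub>0 r1 \<Longrightarrow> proj T (a - a') = 0 \<Longrightarrow>
       gradient L a - gradient L a' \<in> span T \<Longrightarrow> a = a'"
      and E3: "\<And>u k. u \<in> ball u\<^sub>0 r1 \<Longrightarrow> proj T k = 0 \<Longrightarrow>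
       (\<And>y. (\<And>f. f \<in> T \<Longrightarrow> y \<bullet> f = 0) \<Longrightarrow> B u k \<bullet> y = 0) \<Longrightarrow> k = 0"
      and pos: "\<And>u v. u \<in> ball u\<^sub>0 r1 \<Longrightarrow> v \<noteq> 0 \<Longrightarrow> (\<And>e. e \<in> S \<union> T \<Longrightarrow> v \<bullet> e = 0) \<Longrightarrow> B u v \<bullet> v > 0"
      and neg: "\<And>u v. u \<in> ball u\<^sub>0 r1 \<Longrightarrow> v \<noteq> 0 \<Longrightarrow> v \<in> span S \<Longrightarrow> B u v \<bullet> v < 0"
      and D1: "\<And>z. z \<in> W \<Longrightarrow> ((\<lambda>z. proj T (gradient L (u\<^sub>0 + z + \<phi> z))) has_derivative blinfun_apply (D z)) (at z within W)"
      and D2: "continuous_on W D"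
      and D3: "\<And>z v. z \<in> W \<Longrightarrow> v \<in> span T \<Longrightarrow> \<exists>y. proj T y = v \<and>
       (\<forall>e. (\<forall>f\<in>T. e \<bullet> f = 0) \<longrightarrow> B (u\<^sub>0 + z + \<phi> z) y \<bullet> e = 0) \<and>
       D z v = proj T (B (u\<^sub>0 + z + \<phi> z) y)"
    define G where "G z = proj T (gradient L (u\<^sub>0 + z + \<phi> z))" for z
    have "0 \<in> W" using \<epsilon>0 by (simp add: W_def span_zero)
    then obtain s1 where s1: "s1 > 0" "\<And>z. z \<in> W \<Longrightarrow> norm z < s1 \<Longrightarrow> norm (\<phi> z) < r1 / 2"
      using \<phi>c[unfolded continuous_on_iff, rule_format, of 0 "r1 / 2"] r1(1) by (auto simp: \<phi>0)
    obtain U C where U: "open U" "u\<^sub>0 \<in> U" "U \<subseteq> V" "C > 0" "\<And>x v. x \<in> U \<Longrightarrow> P x v \<bullet> v \<ge> C * (norm v)\<^sup>2"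
      using coercive_P[OF u0] by blast
    obtain d where d: "d > 0" "ball u\<^sub>0 d \<subseteq> U" using U openE by blast
    \<comment> \<open>r confines the support, r1/2 keeps the graph over \<open>K0\<close> within the
      local estimates, d/2 puts the support strictly inside the region of coercivity, and the last
      two keep \<open>K0\<close> where \<phi> is defined and small.\<close>
    define \<rho> where "\<rho> = min r (min (r1 / 2) (min (d / 2) (min (\<epsilon>\<^sub>0 / 2) (s1 / 2))))"
    have \<rho>: "\<rho> > 0" "\<rho> \<le> r" "\<rho> \<le> r1 / 2" "\<rho> < d" "\<rho> < \<epsilon>\<^sub>0" "\<rho> < s1"
      using r r1 d \<epsilon>0 s1 by (auto simp: \<rho>_def min_less_iff_disj)
    have \<rho>r1: "\<rho> < r1" using \<rho>(3) r1(1) by simp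
    \<comment> \<open>Critical points will lie within \<rho>/2 of the center, so their kernel
      components lie in this ball. Being compact and convex, it is also where Sard's theorem and
      finiteness of the fiber apply.\<close>
    define K0 where "K0 = span T \<inter> cball 0 (\<rho> / 2)"
    have K0: "compact K0" "convex K0" "K0 \<subseteq> span T" "K0 \<subseteq> W"
      unfolding K0_def W_def using \<rho>
      by (auto intro: compact_span_cball[OF T] convex_Int subspace_imp_convex)
    have Ub: "u\<^sub>0 + z + \<phi> z \<in> ball u\<^sub>0 r1" if "z \<in> K0" for z
    proof -
      have "norm z \<le> \<rho> / 2" using that by (simp add: K0_def)
      moreover have "norm (\<phi> z) < r1 / 2" using that K0(4) \<rho> \<open>norm z \<le> \<rho> / 2\<close> by (intro s1(2)) auto
      moreover have "norm (z + \<phi> z) \<le> norm z + norm (\<phi> z)" by (rule norm_triangle_ineq)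
      ultimately have "norm (z + \<phi> z) < r1" using \<rho>(1,3) by linarith
      then have "dist (u\<^sub>0 + z + \<phi> z) u\<^sub>0 < r1" by (simp add: dist_norm add.assoc)
      then show ?thesis by (simp only: mem_ball dist_commute)
    qed
    have cb: "cball u\<^sub>0 \<rho> \<subseteq> cball u\<^sub>0 r" using \<rho>(2) by (rule subset_cball)
    obtain m where m: "m > 0" "\<And>u. \<rho> / 2 \<le> norm (u - u\<^sub>0) \<Longrightarrow> norm (u - u\<^sub>0) \<le> \<rho> \<Longrightarrow> m \<le> norm (gradient L u)"
      by (rule gradient_bounded_below_annulus[OF PS crit \<rho>(1), of R]) (use cb r(2) bd in blast)+
    obtain M1 where M1: "M1 > 0" and pert: "\<And>b. \<exists>\<eta> k K. localized_perturbation u\<^sub>0 \<rho> b (M1 * norm b) \<eta> k K"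
      using localized_linear_functional[OF \<rho>(1), of u\<^sub>0] by metis
    \<comment> \<open>M1 times the norm of b bounds the perturbation, its gradient and its Hessian.
      The three caps are for the annulus (m/2), for closeness (\<epsilon>) and for coercivity
      (C/2).\<close>
    define \<delta> where "\<delta> = min (m / 2) (min \<epsilon> (C / 2)) / M1"
    have \<delta>: "\<delta> > 0" using m(1) \<epsilon> U(4) M1 by (simp add: \<delta>_def)
    obtain b where b: "b \<in> span T" "norm b < \<delta>"
      and reg: "\<And>z v. z \<in> K0 \<Longrightarrow> G z = b \<Longrightarrow> v \<in> span T \<Longrightarrow> v \<noteq> 0 \<Longrightarrow> D z v \<noteq> 0"
    proof (rule Sard_finite_dim[OF T K0(1-3) _ continuous_on_subset[OF D2 K0(4)] \<delta>])
      show "(G has_derivative blinfun_apply (D z)) (at z within K0)" if "z \<in> K0" for z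
        unfolding G_def by (rule has_derivative_subset[OF D1 K0(4)]) (use that K0(4) in blast)
      fix b assume "b \<in> span T" "norm b < \<delta>"
        "\<And>z v. z \<in> K0 \<Longrightarrow> G z = b \<Longrightarrow> v \<in> span T \<Longrightarrow> v \<noteq> 0 \<Longrightarrow> D z v \<noteq> 0"
      then show thesis by (rule that)
    qed
    have "M1 * norm (- b) \<le> M1 * \<delta>" using b(2) M1 by simp
    also have "M1 * \<delta> = min (m / 2) (min \<epsilon> (C / 2))" using M1 by (simp add: \<delta>_def)
    finally have small: "M1 * norm (- b) \<le> m / 2" "M1 * norm (- b) \<le> \<epsilon>" "M1 * norm (- b) \<le> C / 2" by simp_all
    \<comment> \<open>The perturbation uses -b, so that critical points solve
      \<open>gradient L u = b\<close> with the regular value b of \<open>G\<close>.\<close>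
    obtain \<eta> k K where lp: "localized_perturbation u\<^sub>0 \<rho> (- b) (M1 * norm (- b)) \<eta> k K"
      using pert by blast
    have \<eta>: "\<And>u. GDERIV \<eta> u :> k u" "\<And>u. (k has_derivative blinfun_apply (K u)) (at u)"
      and K: "continuous_on UNIV K" "\<And>u. selfadjoint (K u)"
      and inner: "\<And>u. norm (u - u\<^sub>0) \<le> \<rho> / 2 \<Longrightarrow> k u = - b \<and> K u = 0"
      and outer: "\<And>u. norm (u - u\<^sub>0) \<ge> \<rho> \<Longrightarrow> \<eta> u = 0 \<and> k u = 0 \<and> K u = 0"
      and le: "\<And>u. \<bar>\<eta> u\<bar> \<le> M1 * norm (- b) \<and> norm (k u) \<le> M1 * norm (- b) \<and> norm (K u) \<le> M1 * norm (- b)"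
      using lp unfolding localized_perturbation_def by simp_all
    have le\<epsilon>: "\<bar>\<eta> u\<bar> \<le> \<epsilon>" "norm (k u) \<le> \<epsilon>" "norm (K u) \<le> \<epsilon>" for u using le[of u] small(2) by linarith+
    have km: "norm (k u) \<le> m / 2" and KC: "norm (K u) \<le> C / 2" for u using le[of u] small by linarith+
    define Lt where "Lt u = L u + \<eta> u" for u
    have outK: "K u = 0" if "norm (u - u\<^sub>0) \<ge> \<rho>" for u using outer[OF that] by blast
    have ballV: "ball u\<^sub>0 d \<subseteq> V" using d(2) U(3) by blast
    have PC: "P u v \<bullet> v \<ge> C * (norm v)\<^sup>2" if "u \<in> ball u\<^sub>0 d" for u v using U(5) d(2) that by blast
    note pf = perturbed_functional_B[OF \<eta> K _ KC \<rho>(4) ballV U(4), folded Lt_def]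
    have pf1: "functional_B V Lt (\<lambda>u. B u + K u) (\<lambda>u. P u + K u) Q"
      by (rule pf(1)) (erule outK, erule PC)
    have pf2: "GDERIV Lt u :> gradient L u + k u" if "u \<in> V" for u
      by (rule pf(2)) (erule outK, erule PC, rule that)
    have pf3: "has_gateaux_derivative (\<lambda>u. gradient L u + k u) (B u + K u) u" if "u \<in> V" for u
      by (rule pf(3)) (erule outK, erule PC, rule that)
    have Lt1: "C1_on V Lt" using functional_B.C1[OF pf1] .
    have Lt2: "hypothesis_B V Lt" by (rule functional_B.hypothesis_B[OF pf1])
    have Lt3: "palais_smale V Lt"
      unfolding Lt_def
      by (rule perturbed_palais_smale[OF PS pf2[unfolded Lt_def[abs_def]] _ _ m(1) km m(2) T \<rho>(1) \<rho>r1 c E1])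
         (use inner outer in blast)+
    have critLt: "norm (u - u\<^sub>0) < \<rho> / 2 \<and> gradient L u = b" if u: "u \<in> critical_points V Lt" for u
    proof -
      have uV: "u \<in> V" and g0: "gradient L u + k u = 0"
        using u critical_points_gderiv[OF pf2] by auto
      have "\<not> norm (u - u\<^sub>0) \<ge> \<rho>"
      proof
        assume far: "norm (u - u\<^sub>0) \<ge> \<rho>"
        then have "gradient L u = 0" using g0 outer[OF far] by simp
        then have "u \<in> critical_points V L" using uV critical_points_gderiv[OF gderiv] by blast
        then show False using crit far \<rho>(1) by simp
      qed
      moreover have "\<not> norm (u - u\<^sub>0) \<ge> \<rho> / 2"
      proof
        assume "norm (u - u\<^sub>0) \<ge> \<rho> / 2"
        then have "m \<le> norm (gradient L u)" using calculation by (intro m(2)) auto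
        also have "gradient L u = - k u" using g0 by (simp add: eq_neg_iff_add_eq_0)
        finally show False using km[of u] m(1) by simp
      qed
      ultimately have "norm (u - u\<^sub>0) < \<rho> / 2" by simp
      moreover have "gradient L u = b" using g0 inner[of u] calculation by simp
      ultimately show ?thesis by blast
    qed
    \<comment> \<open>The critical point and the graph point above its kernel component have the
      same projection, and both gradients lie in the kernel; by the uniqueness estimate
      \<open>E2\<close> they coincide.\<close>
    have param: "proj T (u - u\<^sub>0) \<in> K0 \<and> G (proj T (u - u\<^sub>0)) = b \<and>
        u = u\<^sub>0 + proj T (u - u\<^sub>0) + \<phi> (proj T (u - u\<^sub>0))" if u: "u \<in> critical_points V Lt" for u
    proof -
      define z where "z = proj T (u - u\<^sub>0)"
      have nu: "norm (u - u\<^sub>0) < \<rho> / 2" and gu: "gradient L u = b" using critLt[OF u] by auto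
      have zT: "z \<in> span T" by (simp add: z_def proj_in_span)
      have zK: "z \<in> K0" using norm_proj_le[OF T, of "u - u\<^sub>0"] nu zT by (simp add: K0_def z_def)
      then have zW: "z \<in> W" using K0(4) by blast
      have eq: "u = u\<^sub>0 + z + \<phi> z"
      proof (rule E2)
        show "u \<in> ball u\<^sub>0 r1" using nu \<rho>(1) \<rho>r1 by (simp add: dist_norm norm_minus_commute)
        show "u\<^sub>0 + z + \<phi> z \<in> ball u\<^sub>0 r1" by (rule Ub[OF zK])
        have e: "u - (u\<^sub>0 + z + \<phi> z) = (u - u\<^sub>0) - z - \<phi> z" by simp
        have "proj T (\<phi> z) = 0" using \<phi>o[OF zW] by (simp add: proj_eq_0_iff[OF T])
        moreover have "proj T z = z" by (rule proj_span[OF T zT])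
        moreover have "proj T (u - (u\<^sub>0 + z + \<phi> z)) = proj T (u - u\<^sub>0) - proj T z - proj T (\<phi> z)"
          unfolding e by (simp only: proj_diff[of T "u - u\<^sub>0 - z" "\<phi> z"] proj_diff[of T "u - u\<^sub>0" z])
        ultimately show "proj T (u - (u\<^sub>0 + z + \<phi> z)) = 0" by (simp only: z_def[symmetric] diff_self)
        show "gradient L u - gradient L (u\<^sub>0 + z + \<phi> z) \<in> span T"
          unfolding gu by (intro span_diff b(1) \<phi>s zW)
      qed
      have "G z = gradient L u" using \<phi>g[OF zW] eq by (simp add: G_def)
      then show ?thesis using zK gu eq unfolding z_def by simp
    qed
    have DK: "(G has_derivative blinfun_apply (D z)) (at z within K0)" if "z \<in> K0" for z
      unfolding G_def by (rule has_derivative_subset[OF D1 K0(4)]) (use that K0(4) in blast)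
    have Lt9: "finite (critical_points V Lt)"
    proof (rule finite_subset)
      show "critical_points V Lt \<subseteq> (\<lambda>z. u\<^sub>0 + z + \<phi> z) ` {z \<in> K0. G z = b}"
        using param by blast
      show "finite ((\<lambda>z. u\<^sub>0 + z + \<phi> z) ` {z \<in> K0. G z = b})"
        by (intro finite_imageI finite_regular_fiber[OF T K0(1,3) DK reg])
    qed
    have index: "nondegenerate Lt u \<and> morse_index L u\<^sub>0 \<le> morse_index Lt u \<and>
       morse_index Lt u \<le> morse_index L u\<^sub>0 + nullity L u\<^sub>0" if u: "u \<in> critical_points V Lt" for u
    proof -
      define z where "z = proj T (u - u\<^sub>0)"
      have z: "z \<in> K0" "G z = b" "u = u\<^sub>0 + z + \<phi> z" using param[OF u] by (auto simp: z_def)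
      have zW: "z \<in> W" using z(1) K0(4) by blast
      have ub: "u \<in> ball u\<^sub>0 r1" using Ub[OF z(1)] z(3) by simp
      have uV: "u \<in> V" using ub r1(2) by blast
      have "K u = 0" using critLt[OF u] inner[of u] by simp
      then have hess: "hessian Lt u = B u"
        using deriv2_at_gateaux(2)[OF open_V uV pf2 pf3[OF uV]] by simp
      \<comment> \<open>The tangent vector y above the kernel component v of h and h itself differ
        by a vector to which \<open>E3\<close> applies, so y = h. Then \<open>D z v\<close>
        vanishes, regularity gives v = 0, and \<open>E3\<close> applied to h gives h = 0.\<close>
      have ker: "h = 0" if h: "B u h = 0" for h
      proof -
        define v where "v = proj T h"
        have vT: "v \<in> span T" by (simp add: v_def proj_in_span)
        obtain y where y: "proj T y = v" "\<And>e. (\<forall>f\<in>T. e \<bullet> f = 0) \<Longrightarrow> B u y \<bullet> e = 0" "D z v = proj T (B u y)"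
          using D3[OF zW vT] z(3) by auto
        have "y - h = 0"
        proof (rule E3[OF ub])
          show "proj T (y - h) = 0" by (simp add: proj_diff y(1) v_def)
          show "B u (y - h) \<bullet> e = 0" if "\<And>f. f \<in> T \<Longrightarrow> e \<bullet> f = 0" for e
            using y(2)[of e] that by (simp add: blinfun.diff_right h)
        qed
        then have "B u y = 0" using h by simp
        then have "D z v = 0" using y(3) by simp
        then have v0: "proj T h = 0" using reg[OF z(1,2) vT] unfolding v_def by blast
        show "h = 0" by (rule E3[OF ub v0]) (simp add: h)
      qed
      obtain S' T' where fr': "spectral_frame (B u) S' T'" using spectral_frame_B[OF uV] by blast
      have "null_space (B u) = {0}" using ker by (auto simp: null_space_def)
      then have "nullity Lt u = edim {0 :: 'a}" by (simp add: nullity_def hess)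
      also have "\<dots> = 0"
        using edim_span_orthonormal[OF orthonormal_empty, where 'a='a] by (simp add: zero_enat_def)
      finally have nd: "nondegenerate Lt u" by (simp add: nondegenerate_def)
      have mi: "morse_index Lt u = enat (card S')"
        by (rule morse_index_frame(1)[of Lt u S' T']) (use fr' selfadjoint_B[OF uV] in \<open>simp_all add: hess\<close>)
      have mi0: "morse_index L u\<^sub>0 = enat (card S)" "nullity L u\<^sub>0 = enat (card T)"
        by (rule morse_index_frame[of L u\<^sub>0 S T];
            use fr selfadjoint_B[OF u0] in \<open>simp add: hessian_eq[OF u0]\<close>)+
      have "card S \<le> card S'"
        by (rule card_le_negative_frame[OF oS fr' selfadjoint_B[OF uV]]) (use neg[OF ub] in blast)
      \<comment> \<open>\<open>B u\<close> is positive off both the negative and the kernel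
        directions of the center, which is what the upper count requires.\<close>
      moreover have "card S' \<le> card (S \<union> T)"
        by (rule negative_frame_card_le[OF fr'])
           (use orthonormal_finite[OF oS] orthonormal_finite[OF T] pos[OF ub] in simp_all)
      moreover have "card (S \<union> T) \<le> card S + card T" by (rule card_Un_le)
      ultimately show ?thesis using nd by (simp add: mi mi0)
    qed
    show thesis
    proof (rule that[OF Lt1 Lt2 Lt3 _ _ _ _ _ Lt9 index])
      show "\<bar>L u - Lt u\<bar> \<le> \<epsilon>" for u using le\<epsilon>(1)[of u] by (simp add: Lt_def)
      show "norm (deriv_at L u - deriv_at Lt u) \<le> \<epsilon>" if "u \<in> V" for u
        using le\<epsilon>(2)[of u]
        by (simp add: deriv_at_gderiv[OF gderiv[OF that]] deriv_at_gderiv[OF pf2[OF that]]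
            blinfun_inner_left_diff norm_blinfun_inner_left)
      show "norm (deriv2_at L u - deriv2_at Lt u) \<le> \<epsilon>" if uV: "u \<in> V" for u
      proof -
        have "deriv2_at L u - deriv2_at Lt u = dual_embedding o\<^sub>L (B u - (B u + K u))"
          using deriv2_at_gateaux(1)[OF open_V uV gderiv gateaux[OF uV]]
            deriv2_at_gateaux(1)[OF open_V uV pf2 pf3[OF uV]]
          by (simp only: bounded_bilinear.diff_right[OF bounded_bilinear_blinfun_compose])
        then have "norm (deriv2_at L u - deriv2_at Lt u) \<le> norm (B u - (B u + K u))"
          by (simp only: norm_dual_embedding_compose)
        then show ?thesis using le\<epsilon>(3)[of u] by simp
      qed
      show "L u = Lt u" if "norm (u - u\<^sub>0) \<ge> r" for u
        using outer[of u] that \<rho>(2) by (simp add: Lt_def)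
      show "critical_points V Lt \<subseteq> ball u\<^sub>0 r"
      proof
        fix u assume "u \<in> critical_points V Lt"
        then have "norm (u - u\<^sub>0) < \<rho> / 2" using critLt by blast
        then show "u \<in> ball u\<^sub>0 r" using \<rho>(1,2) by (simp add: dist_norm norm_minus_commute)
      qed
    qed
  qed
qed

end

text \<open>A pointwise bound passes to the supremum only in its non-strict form; half the tolerance
  restores strictness.\<close>

lemma SUP_ereal_less:
  assumes "e > 0" "\<And>u. u \<in> V \<Longrightarrow> f u \<le> e / 2"
  shows "(SUP u\<in>V. ereal (f u)) < ereal e"
proof -
  have "(SUP u\<in>V. ereal (f u)) \<le> ereal (e / 2)" by (rule SUP_least) (use assms in simp)
  also have "\<dots> < ereal e" using assms(1) by simp
  finally show ?thesis .
qed

theorem theorem3p2: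
  fixes V :: "'a::{real_inner,complete_space} set"
    and L :: "'a \<Rightarrow> real"
    and u\<^sub>0 :: 'a
    and \<epsilon>\<^sub>0 :: real
    and \<phi> :: "'a \<Rightarrow> 'a"
    and \<epsilon> r :: real
  assumes "open V"
    and "C1_on V L"
    and "hypothesis_B V L"
    and "critical_points V L = {u\<^sub>0}"
    and "reduction_map V L u\<^sub>0 \<epsilon>\<^sub>0 \<phi>"
    and "C1_on (null_space (hessian L u\<^sub>0) \<inter> ball 0 \<epsilon>\<^sub>0) \<phi>"
    and "C2_on (null_space (hessian L u\<^sub>0) \<inter> ball 0 \<epsilon>\<^sub>0) (reduced_functional L u\<^sub>0 \<phi>)"
    and "palais_smale V L"
    and "\<epsilon> > 0"
    and "r > 0"
    and "cball u\<^sub>0 r \<subseteq> V"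
    and "(SUP u\<in>cball u\<^sub>0 r. ereal \<bar>L u\<bar>) < \<infinity>"
  shows "\<exists>Lt :: 'a \<Rightarrow> real.
    C1_on V Lt \<and> hypothesis_B V Lt \<and> palais_smale V Lt \<and>
    (SUP u\<in>V. ereal \<bar>L u - Lt u\<bar>) < ereal \<epsilon> \<and>
    (SUP u\<in>V. ereal (norm (deriv_at L u - deriv_at Lt u))) < ereal \<epsilon> \<and>
    (SUP u\<in>V. ereal (norm (deriv2_at L u - deriv2_at Lt u))) < ereal \<epsilon> \<and>
    (\<forall>u\<in>V. norm (u - u\<^sub>0) \<ge> r \<longrightarrow> L u = Lt u) \<and>
    critical_points V Lt \<subseteq> ball u\<^sub>0 r \<and>
    finite (critical_points V Lt) \<and>
    (\<forall>u\<in>critical_points V Lt.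
       nondegenerate Lt u \<and>
       morse_index L u\<^sub>0 \<le> morse_index Lt u \<and>
       morse_index Lt u \<le> morse_index L u\<^sub>0 + nullity L u\<^sub>0)"
proof -
  obtain B P Q where fB: "functional_B V L B P Q"
    by (rule functional_B_I[OF assms(1-3)])
  obtain R where R: "(SUP u\<in>cball u\<^sub>0 r. ereal \<bar>L u\<bar>) \<le> ereal R"
    using assms(12) by (cases "SUP u\<in>cball u\<^sub>0 r. ereal \<bar>L u\<bar>") auto
  have bd: "\<bar>L u\<bar> \<le> R" if "u \<in> cball u\<^sub>0 r" for u
    using order_trans[OF SUP_upper[OF that, of "\<lambda>u. ereal \<bar>L u\<bar>"] R] by simp
  have \<epsilon>2: "\<epsilon> / 2 > 0" using assms(9) by simp
  show ?thesis
  proof (rule functional_B.nondegenerate_perturbation[OF fB assms(4,5,6,8) \<epsilon>2 assms(10,11) bd])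
    fix Lt :: "'a \<Rightarrow> real"
    assume Lt: "C1_on V Lt" "hypothesis_B V Lt" "palais_smale V Lt"
      "\<And>u. u \<in> V \<Longrightarrow> \<bar>L u - Lt u\<bar> \<le> \<epsilon> / 2"
      "\<And>u. u \<in> V \<Longrightarrow> norm (deriv_at L u - deriv_at Lt u) \<le> \<epsilon> / 2"
      "\<And>u. u \<in> V \<Longrightarrow> norm (deriv2_at L u - deriv2_at Lt u) \<le> \<epsilon> / 2"
      "\<And>u. norm (u - u\<^sub>0) \<ge> r \<Longrightarrow> L u = Lt u"
      "critical_points V Lt \<subseteq> ball u\<^sub>0 r" "finite (critical_points V Lt)"
      "\<And>u. u \<in> critical_points V Lt \<Longrightarrow> nondegenerate Lt u \<and>
         morse_index L u\<^sub>0 \<le> morse_index Lt u \<and>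
         morse_index Lt u \<le> morse_index L u\<^sub>0 + nullity L u\<^sub>0"
    show ?thesis
      using SUP_ereal_less[OF assms(9) Lt(4)] SUP_ereal_less[OF assms(9) Lt(5)]
        SUP_ereal_less[OF assms(9) Lt(6)] Lt(1-3,7-10)
      by (intro exI[of _ Lt] conjI ballI impI) simp_all
  qed
qed

end
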